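(* Let $1/2<H<1$ and fix $t_0>0$. Let $Z^H_t=\int_{\mathbb R} f(t,s)\,dZ_s$, $t\ge t_0$, be the fractional Lévy motion driven by a two-sided real-valued Lévy process $Z$ with Lévy measure $\mu$ (no Gaussian part, no drift, $Z_0=0$). Suppose that: 1) $\mu((0,\infty))>0$; 2) for all $C\in\mathbb R$, $\int_{|y|\ge 1} e^{Cy}\,\mu(dy)<\infty$; 3) there exists $\gamma\in(0,1)$ such that $M_4(\xi)\ll \big(M_2(\gamma\xi)\big)^2$ as $\xi\to+\infty$; 4) $\ln\Big(\frac{M_4(\xi)}{M_2(\xi)}\vee 1\Big)+\ln\ln M_2(\xi)\ll \xi$ as $\xi\to+\infty$. Then the distribution density $p_t(x)$ of $Z^H_t$ exists, $p_t\in C_b^\infty(\mathbb R)$, and $$p_t(x)\sim \frac{1}{\sqrt{2\pi t^{2H}K(xt^{-H-1/2})}}\;e^{tD(xt^{-H-1/2})},\qquad t+x\to\infty,\quad (t,x)\in[t_0,\infty)\times\mathbb R_+ .$$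
   Context: Notation: $x_+=\max(x,0)$, $a\vee b=\max(a,b)$, $\mathbb R_+=[0,\infty)$; $f\ll g$ means $f/g\to0$, $f\sim g$ means $f/g\to1$. A relation "$t+x\to\infty$, $(t,x)\in A$" means that the ratio tends to $1$ as $t+x\to\infty$ with $(t,x)$ restricted to $A$. $C_b^\infty(\mathbb R)$ is the set of infinitely differentiable functions bounded together with all derivatives. The process $Z=(Z_s)_{s\in\mathbb R}$ is a real-valued two-sided Lévy process: $Z_0=0$, $Z$ has stationary independent increments and $E e^{iz(Z_t-Z_s)}=e^{(t-s)\psi(z)}$ for $t>s$, with $$\psi(z)=\int_{\mathbb R}\big(e^{iuz}-1-izu1_{\{|u|\le1\}}\big)\mu(du),$$ where $\mu$ is a Lévy measure ($\mu(\{0\})=0$, $\int(1\wedge u^2)\mu(du)<\infty$, $\mu(\mathbb R)>0$). The kernel is $$f(t,s)=\frac{1}{\Gamma(H+1/2)}\left[(t-s)_+^{H-1/2}-(-s)_+^{H-1/2}\right],\quad t,s\in\mathbb R.$$ The integral $Z^H_t=\int_{\mathbb R}f(t,s)\,dZ_s$ is understood as the limit in probability of the respective integral sums (in the sense of Rajput and Rosinski). Its characteristic function is $E e^{izZ^H_t}=e^{\Psi(t,-z)}$, where $$\Psi(t,z)=\int_{\mathbb R}\int_{\mathbb R}\left(e^{-izf(t,s)u}-1+izf(t,s)u1_{|u|\le1}\right)\mu(du)\,ds .$$ When $\mu$ has all exponential moments, $\Psi(t,\cdot)$ extends to complex $z$. Put $\mathcal H(x,z)=izx+\Psi(1,z)$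 and let $i\xi(x)$, $\xi(x)\in\mathbb R$, be the unique critical point of $\mathcal H(x,\cdot)$ on the line $i\mathbb R$. Define $$D(x)=\mathcal H(x,i\xi(x)),\qquad K(x)=\frac{\partial^2}{\partial\xi^2}\mathcal H(x,i\xi)\Big|_{\xi=\xi(x)},\qquad M_k(\xi)=\int_{\mathbb R}u^ke^{\xi u}\mu(du),\ k\ge2,\ \xi\in\mathbb R.$$ *)

theory Defs
  imports "HOL-Probability.Probability"
begin

definition levy_measure :: "real measure \<Rightarrow> bool" where
  "levy_measure \<mu> \<longleftrightarrow>
     sets \<mu> = sets borel \<and> emeasure \<mu> {0} = 0 \<and>
     (\<integral>\<^sup>+u. ennreal (min 1 (u\<^sup>2)) \<partial>\<mu>) < \<infinity> \<and> emeasure \<mu> UNIV > 0"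

definition levy_exponent :: "real measure \<Rightarrow> real \<Rightarrow> complex" where
  "levy_exponent \<mu> z =
     (LINT u|\<mu>. iexp (u * z) - 1 - \<i> * of_real (z * u * indicator {-1..1} u))"

text \<open>Two-sided process: the time parameter ranges over all of \<open>\<real>\<close>. No path regularity is assumed.\<close>

definition levy_process :: "'w measure \<Rightarrow> (real \<Rightarrow> 'w \<Rightarrow> real) \<Rightarrow> real measure \<Rightarrow> bool" where
  "levy_process M Z \<mu> \<longleftrightarrow>
     (\<forall>t. Z t \<in> borel_measurable M) \<and>
     (AE \<omega> in M. Z 0 \<omega> = 0) \<and>
     (\<forall>(n::nat) (\<tau>::nat \<Rightarrow> real). strict_mono_on {..n} \<tau> \<longrightarrow>
        prob_space.indep_vars M (\<lambda>_. borel) (\<lambda>i \<omega>. Z (\<tau> (Suc i)) \<omega> - Z (\<tau> i) \<omega>) {..<n}) \<and>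
     (\<forall>s t h. s < t \<longrightarrow>
        distr M borel (\<lambda>\<omega>. Z (t + h) \<omega> - Z (s + h) \<omega>) = distr M borel (\<lambda>\<omega>. Z t \<omega> - Z s \<omega>)) \<and>
     (\<forall>s t z. s < t \<longrightarrow>
        char (distr M borel (\<lambda>\<omega>. Z t \<omega> - Z s \<omega>)) z = exp (of_real (t - s) * levy_exponent \<mu> z))"

definition converges_in_prob ::
  "'w measure \<Rightarrow> (nat \<Rightarrow> 'w \<Rightarrow> real) \<Rightarrow> ('w \<Rightarrow> real) \<Rightarrow> bool" where
  "converges_in_prob M X Y \<longleftrightarrow>
     Y \<in> borel_measurable M \<and>
     (\<forall>\<epsilon>>0. (\<lambda>n. measure M {\<omega> \<in> space M. \<bar>X n \<omega> - Y \<omega>\<bar> > \<epsilon>}) \<longlonglongrightarrow> 0)"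

text \<open>The stochastic integral of a deterministic function, following Rajput and Rosinski
  (Spectral representations of infinitely divisible processes, 1989).  The random measure is
  indexed by the \<open>\<delta>\<close>-ring of bounded Borel sets.\<close>

definition bounded_borel :: "real set set" where
  "bounded_borel = {A \<in> sets borel. bounded A}"

definition independently_scattered :: "'w measure \<Rightarrow> (real set \<Rightarrow> 'w \<Rightarrow> real) \<Rightarrow> bool" where
  "independently_scattered M \<Lambda> \<longleftrightarrow>
     (\<forall>A\<in>bounded_borel. \<Lambda> A \<in> borel_measurable M) \<and>
     (\<forall>A::nat \<Rightarrow> real set. range A \<subseteq> bounded_borel \<and> disjoint_family A \<longrightarrow>
        prob_space.indep_vars M (\<lambda>_. borel) (\<lambda>n. \<Lambda> (A n)) UNIV \<and>
        ((\<Union>n. A n) \<in> bounded_borel \<longrightarrow>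
          (AE \<omega> in M. (\<lambda>n. \<Lambda> (A n) \<omega>) sums \<Lambda> (\<Union>n. A n) \<omega>)))"

definition random_measure_of ::
  "'w measure \<Rightarrow> (real \<Rightarrow> 'w \<Rightarrow> real) \<Rightarrow> (real set \<Rightarrow> 'w \<Rightarrow> real) \<Rightarrow> bool" where
  "random_measure_of M Z \<Lambda> \<longleftrightarrow>
     independently_scattered M \<Lambda> \<and>
     (\<forall>a b. a \<le> b \<longrightarrow> (AE \<omega> in M. \<Lambda> {a<..b} \<omega> = Z b \<omega> - Z a \<omega>))"

definition simple_integrand :: "(real \<Rightarrow> real) \<Rightarrow> bool" where
  "simple_integrand g \<longleftrightarrow> finite (range g) \<and> (\<forall>c. c \<noteq> 0 \<longrightarrow> g -` {c} \<in> bounded_borel)"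

definition simple_stoch_integral ::
  "(real set \<Rightarrow> 'w \<Rightarrow> real) \<Rightarrow> real set \<Rightarrow> (real \<Rightarrow> real) \<Rightarrow> 'w \<Rightarrow> real" where
  "simple_stoch_integral \<Lambda> A g \<omega> = (\<Sum>c\<in>range g - {0}. c * \<Lambda> (A \<inter> g -` {c}) \<omega>)"

text \<open>\<open>X\<close> is a version of the integral of \<open>g\<close> with respect to \<open>Z\<close>; in particular \<open>g\<close> is
  integrable.  Convergence of the integrals over every Borel set \<open>A\<close> is part of the definition;
  without it the limit could depend on the approximating sequence.\<close>

definition stoch_integral ::
  "'w measure \<Rightarrow> (real \<Rightarrow> 'w \<Rightarrow> real) \<Rightarrow> (real \<Rightarrow> real) \<Rightarrow> ('w \<Rightarrow> real) \<Rightarrow> bool" where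
  "stoch_integral M Z g X \<longleftrightarrow>
     (\<exists>\<Lambda> G. random_measure_of M Z \<Lambda> \<and>
        (\<forall>n::nat. simple_integrand (G n)) \<and>
        (AE s in lborel. (\<lambda>n. G n s) \<longlonglongrightarrow> g s) \<and>
        (\<forall>A\<in>sets borel. \<exists>Y. converges_in_prob M (\<lambda>n. simple_stoch_integral \<Lambda> A (G n)) Y) \<and>
        converges_in_prob M (\<lambda>n. simple_stoch_integral \<Lambda> UNIV (G n)) X)"

text \<open>For \<open>H > 1/2\<close> the convention \<open>0 powr a = 0\<close> gives the positive-part powers their
  intended value at \<open>0\<close>.\<close>

definition frac_kernel :: "real \<Rightarrow> real \<Rightarrow> real \<Rightarrow> real" where
  "frac_kernel H t s =
     (max (t - s) 0 powr (H - 1/2) - max (- s) 0 powr (H - 1/2)) / Gamma (H + 1/2)"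

definition Psi :: "real measure \<Rightarrow> real \<Rightarrow> real \<Rightarrow> complex \<Rightarrow> complex" where
  "Psi \<mu> H t z =
     (LINT s|lborel. LINT u|\<mu>.
        exp (- \<i> * z * of_real (frac_kernel H t s * u)) - 1
          + \<i> * z * of_real (frac_kernel H t s * u * indicator {-1..1} u))"

definition Hfun :: "real measure \<Rightarrow> real \<Rightarrow> real \<Rightarrow> complex \<Rightarrow> complex" where
  "Hfun \<mu> H x z = \<i> * z * of_real x + Psi \<mu> H 1 z"

definition crit_pt :: "real measure \<Rightarrow> real \<Rightarrow> real \<Rightarrow> real" where
  "crit_pt \<mu> H x = (THE \<xi>::real. (Hfun \<mu> H x has_field_derivative 0) (at (\<i> * of_real \<xi>)))"

text \<open>\<open>Hfun\<close> takes real values on the imaginary axis, so \<open>Re\<close> only adjusts the type in the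
  next two definitions.\<close>

definition Dfun :: "real measure \<Rightarrow> real \<Rightarrow> real \<Rightarrow> real" where
  "Dfun \<mu> H x = Re (Hfun \<mu> H x (\<i> * of_real (crit_pt \<mu> H x)))"

definition Kfun :: "real measure \<Rightarrow> real \<Rightarrow> real \<Rightarrow> real" where
  "Kfun \<mu> H x = (deriv ^^ 2) (\<lambda>\<xi>::real. Re (Hfun \<mu> H x (\<i> * of_real \<xi>))) (crit_pt \<mu> H x)"

definition exp_moment :: "real measure \<Rightarrow> nat \<Rightarrow> real \<Rightarrow> real" where
  "exp_moment \<mu> k \<xi> = (LINT u|\<mu>. u ^ k * exp (\<xi> * u))"

definition Cb_infinity :: "(real \<Rightarrow> real) set" where
  "Cb_infinity = {g. \<forall>n. (\<forall>x. (deriv ^^ n) g differentiable (at x)) \<and> bounded (range ((deriv ^^ n) g))}"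

end

theory Submission
  imports Defs "HOL-Complex_Analysis.Complex_Analysis" "HOL-Real_Asymp.Real_Asymp"
begin

text \<open>Write \<open>Q\<close> for the image of \<open>lborel \<Otimes> \<mu>\<close> under \<open>(s, u) \<mapsto> f(1, s) u\<close> and \<open>\<kappa>(\<zeta>) = \<integral> (e^(\<zeta>v) - 1 - \<zeta>v) dQ(v)\<close>.
  The kernel is square integrable but not integrable, so the existence of the stochastic integral
  forces \<open>\<integral> u 1{|u| > 1} d\<mu> = 0\<close>; by self-similarity of the kernel the characteristic function of \<open>Z\<^sup>H\<close>
  at time \<open>t\<close> is then \<open>z \<mapsto> exp (t \<kappa>(i z t^(H - 1/2)))\<close>. The slowly decaying left tail of the kernel makes
  \<open>Re \<kappa>(\<xi> + i w) - \<kappa>(\<xi>) \<le> - b (|w| - W)\<close> uniformly in \<open>\<xi> \<ge> 0\<close>, which yields a smooth density and allows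
  the inversion contour to be moved to the saddle point \<open>\<xi>\<close>, where \<open>\<kappa>'(\<xi>) = x t^(-H - 1/2)\<close>. There the
  integrand is compared with the Gaussian: the Taylor error is controlled by \<open>M\<^sub>4 / (t M\<^sub>2\<^sup>2)\<close> for the moments of the
  tilted \<open>Q\<close>, which vanishes when \<open>t + x\<close> grows because then \<open>t\<close> or \<open>\<xi>\<close> is large, and
  hypothesis 4 beats the remaining frequencies, on which the integrand is at most
  \<open>exp (- t b e^(d \<xi>) min (w\<^sup>2) 1)\<close>.\<close>

section \<open>Cumulants with exponential moments\<close>

text \<open>The definition of the stochastic integral gives limits in probability of simple
  integrals over each fixed Borel set, while the target is an exponent integrated over the line. On
  sets \<open>B k\<close> where all approximants are bounded the limit is explicit, but exhausting
  the line by \<open>B k\<close> exchanges two limits; convergence over every Borel set makes this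
  possible. The drift then shows up as phases exp (i z mean I_k), with I_k the kernel integral over
  \<open>B k\<close>. As I_k diverges, these cannot converge to a function continuous at 0 unless
  \<open>mean\<close> is 0. Smoothness comes from the kernel: it spreads a single jump size over an
  interval of values, so one compact set of positive jumps with positive mass yields all decay
  bounds. The kernel has maximum c = 1 / Gamma (H + 1/2) and stays above \<gamma> c on an interval
  of positive length. Hence the fourth moment at \<xi> is bounded above through \<mu> at c \<xi> and
  the second below through \<mu> at \<gamma> c \<xi>; this is the comparison that hypothesis 3
  provides.\<close>

lemma norm_exp_minus_Taylor1:
  fixes z :: complex
  shows "norm (exp z - 1 - z) \<le> (norm z)\<^sup>2 * exp (norm z)"
proof -
  have "norm (exp z - (\<Sum>k\<le>1. z ^ k / fact k)) \<le> exp \<bar>Re z\<bar> * (norm z)^(Suc 1) / fact 1"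
    by (rule Taylor_exp)
  also have "\<dots> \<le> (norm z)\<^sup>2 * exp (norm z)"
    using abs_Re_le_cmod[of z] by (simp add: power2_eq_square mult.commute mult_right_mono)
  finally show ?thesis by (simp add: algebra_simps)
qed

lemma norm_exp_minus_1:
  fixes z :: complex
  shows "norm (exp z - 1) \<le> norm z * exp (norm z)"
proof -
  have "norm (exp z - (\<Sum>k\<le>0. z ^ k / fact k)) \<le> exp \<bar>Re z\<bar> * (norm z)^(Suc 0) / fact 0"
    by (rule Taylor_exp)
  also have "\<dots> \<le> norm z * exp (norm z)"
    using abs_Re_le_cmod[of z] by (simp add: mult.commute mult_left_mono)
  finally show ?thesis by simp
qed

lemma norm_iexp_minus2: "norm (iexp x - 1 - \<i> * x) \<le> x\<^sup>2 / 2"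
  using iexp_approx1[of x 1] by (simp add: power2_eq_square diff_diff_eq)

lemma norm_iexp_minus3: "norm (iexp x - 1 - \<i> * x + x\<^sup>2 / 2) \<le> \<bar>x\<bar> ^ 3 / 6"
proof -
  have "(\<Sum>k\<le>2. (\<i> * complex_of_real x) ^ k / fact k) = 1 + \<i> * x - x\<^sup>2 / 2"
    by (simp add: numeral_2_eq_2 power_mult_distrib)
  then have "iexp x - 1 - \<i> * x + x\<^sup>2 / 2 = iexp x - (\<Sum>k\<le>2. (\<i> * complex_of_real x) ^ k / fact k)"
    by (simp only:) simp
  then show ?thesis using iexp_approx1[of x 2] by (simp only: eval_nat_numeral) (simp add: fact_numeral)
qed

text \<open>The surplus factor x^(k-2) is, up to (k-2)!, one term of the exponential series and
  costs one extra unit in the exponent. So every moment of order at least 2 is dominated by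
  \<open>moments2\<close>.\<close>

lemma power_mult_exp_le:
  fixes x C :: real
  assumes "2 \<le> k" "0 \<le> x"
  shows "x ^ k * exp (C * x) \<le> fact k * (x\<^sup>2 * exp ((C + 1) * x))"
proof -
  have "x ^ (k - 2) / fact (k - 2) \<le> exp x"
    using sum_le_suminf[of "\<lambda>n. x ^ n / fact n" "{k - 2}"] assms(2) summable_exp[of x]
    by (simp add: exp_def divide_inverse mult.commute scaleR_conv_of_real)
  then have "x ^ (k - 2) \<le> fact (k - 2) * exp x" by (simp add: field_simps)
  also have "\<dots> \<le> fact k * exp x" by (intro mult_right_mono fact_mono) auto
  finally have "x\<^sup>2 * x ^ (k - 2) * exp (C * x) \<le> x\<^sup>2 * (fact k * exp x) * exp (C * x)"
    by (intro mult_right_mono mult_left_mono) auto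
  moreover have "x\<^sup>2 * x ^ (k - 2) = x ^ k" using assms(1) by (metis le_add_diff_inverse power_add)
  ultimately show ?thesis by (simp add: algebra_simps exp_add)
qed

lemma integral_diff3:
  fixes f g h :: "'a \<Rightarrow> 'b::{banach, second_countable_topology}"
  assumes "integrable M f" "integrable M g" "integrable M h"
  shows "(LINT x|M. f x - g x - h x) = integral\<^sup>L M f - integral\<^sup>L M g - integral\<^sup>L M h"
  using assms by simp

text \<open>A measure with a jump function \<open>V\<close> takes the place of the image measure:
  the same results then serve \<mu> itself, with \<open>V\<close> the identity, and the product of
  time and jump size, where Fubini applies directly. The square in \<open>moments2\<close> allows
  infinite mass near \<open>V = 0\<close>.\<close>

locale exp_moments =
  fixes Q :: "'a measure" and V :: "'a \<Rightarrow> real"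
  assumes measV [measurable]: "V \<in> borel_measurable Q"
    and moments2: "\<And>C. integrable Q (\<lambda>x. (V x)\<^sup>2 * exp (C * \<bar>V x\<bar>))"
begin

lemma int_abs_power: "2 \<le> k \<Longrightarrow> integrable Q (\<lambda>x. \<bar>V x\<bar> ^ k * exp (C * \<bar>V x\<bar>))"
proof (rule Bochner_Integration.integrable_bound[OF integrable_mult_right[OF moments2[of "C + 1"], of "fact k"]])
  assume "2 \<le> k"
  show "AE x in Q. norm (\<bar>V x\<bar> ^ k * exp (C * \<bar>V x\<bar>)) \<le> norm (fact k * ((V x)\<^sup>2 * exp ((C + 1) * \<bar>V x\<bar>)))"
    using power_mult_exp_le[OF \<open>2 \<le> k\<close>, of "\<bar>V x\<bar>" C for x] by (auto simp: abs_mult)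
qed auto

lemma int_bounded_by:
  fixes g :: "'a \<Rightarrow> 'b::{banach, second_countable_topology}"
  assumes "2 \<le> k" and [measurable]: "g \<in> borel_measurable Q"
    and "\<And>x. norm (g x) \<le> B * (\<bar>V x\<bar> ^ k * exp (C * \<bar>V x\<bar>))"
  shows "integrable Q g"
  by (rule Bochner_Integration.integrable_bound[OF integrable_mult_right[OF int_abs_power[OF assms(1), of C], of B]])
     (use assms(3) in \<open>auto intro!: AE_I2 order_trans[OF assms(3)] abs_ge_self\<close>)

lemma norm_int_bounded_by:
  fixes g :: "'a \<Rightarrow> 'b::{banach, second_countable_topology}"
  assumes "2 \<le> k" and [measurable]: "g \<in> borel_measurable Q"
    and "\<And>x. norm (g x) \<le> B * (\<bar>V x\<bar> ^ k * exp (C * \<bar>V x\<bar>))"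
  shows "norm (integral\<^sup>L Q g) \<le> B * (LINT x|Q. \<bar>V x\<bar> ^ k * exp (C * \<bar>V x\<bar>))"
proof -
  have "norm (integral\<^sup>L Q g) \<le> (LINT x|Q. norm (g x))" by (rule integral_norm_bound)
  also have "\<dots> \<le> (LINT x|Q. B * (\<bar>V x\<bar> ^ k * exp (C * \<bar>V x\<bar>)))"
    using assms by (intro integral_mono integrable_norm int_bounded_by[OF assms] integrable_mult_right int_abs_power)
  finally show ?thesis by simp
qed

text \<open>Compensated on all jumps, unlike \<open>levy_exponent\<close>, which compensates only
  jumps of size at most 1. The square moments make this integrable, and no truncation survives in
  the derivatives.\<close>

definition cumul :: "complex \<Rightarrow> complex" where
  "cumul \<zeta> = (LINT x|Q. exp (\<zeta> * V x) - 1 - \<zeta> * V x)"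

definition cumul1 :: "complex \<Rightarrow> complex" where
  "cumul1 \<zeta> = (LINT x|Q. of_real (V x) * (exp (\<zeta> * of_real (V x)) - 1))"

definition cumul2 :: "complex \<Rightarrow> complex" where
  "cumul2 \<zeta> = (LINT x|Q. of_real ((V x)\<^sup>2) * exp (\<zeta> * of_real (V x)))"

lemma norm_exp_le: "norm (exp (\<zeta> * complex_of_real v)) \<le> exp (norm \<zeta> * \<bar>v\<bar>)"
  by (metis norm_exp norm_mult norm_of_real)

lemma exp_mult_le: "exp (x * y) \<le> exp (\<bar>x\<bar> * \<bar>y\<bar> :: real)"
  by (simp flip: abs_mult)

lemma int_cumul:
  fixes \<zeta> :: complex
  shows "integrable Q (\<lambda>x. exp (\<zeta> * V x) - 1 - \<zeta> * V x)"
proof (rule int_bounded_by[of 2 _ "(norm \<zeta>)\<^sup>2" "norm \<zeta>"])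
  show "norm (exp (\<zeta> * V x) - 1 - \<zeta> * V x) \<le> (norm \<zeta>)\<^sup>2 * (\<bar>V x\<bar>\<^sup>2 * exp (norm \<zeta> * \<bar>V x\<bar>))" for x
    using norm_exp_minus_Taylor1[of "\<zeta> * V x"] by (simp add: norm_mult power_mult_distrib mult.assoc)
qed auto

lemma int_cumul1:
  fixes \<zeta> :: complex
  shows "integrable Q (\<lambda>x. V x * (exp (\<zeta> * V x) - 1))"
proof (rule int_bounded_by[of 2 _ "norm \<zeta>" "norm \<zeta>"])
  show "norm (V x * (exp (\<zeta> * V x) - 1)) \<le> norm \<zeta> * (\<bar>V x\<bar>\<^sup>2 * exp (norm \<zeta> * \<bar>V x\<bar>))" for x
    using mult_left_mono[OF norm_exp_minus_1[of "\<zeta> * V x"], of "\<bar>V x\<bar>"]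
    by (simp add: norm_mult power2_eq_square mult.assoc mult.left_commute)
qed auto

lemma int_power_exp:
  fixes \<zeta> :: complex
  shows "2 \<le> k \<Longrightarrow> integrable Q (\<lambda>x. of_real (V x ^ k) * exp (\<zeta> * of_real (V x)))"
  by (rule int_bounded_by[of k _ 1 "norm \<zeta>"])
     (simp_all add: norm_mult norm_power mult_left_mono[OF norm_exp_le] del: norm_exp_eq_Re)

lemma int_power_exp_real: "2 \<le> k \<Longrightarrow> integrable Q (\<lambda>x. (V x) ^ k * exp (\<xi> * V x))"
  by (rule int_bounded_by[of k _ 1 "\<bar>\<xi>\<bar>"])
     (simp_all add: abs_mult power_abs mult_left_mono[OF exp_mult_le])

lemma int_abs_power_exp_real: "2 \<le> k \<Longrightarrow> integrable Q (\<lambda>x. \<bar>V x\<bar> ^ k * exp (\<xi> * V x))"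
  by (rule int_bounded_by[of k _ 1 "\<bar>\<xi>\<bar>"])
     (simp_all add: abs_mult power_abs mult_left_mono[OF exp_mult_le])

text \<open>Stands in for differentiation under the integral sign: one integral estimate of the
  second-order remainder, uniform for |h| <= 1, yields the complex derivative.\<close>

lemma quadratic_bound_imp_derivative:
  fixes F :: "complex \<Rightarrow> complex"
  assumes "\<And>h. norm h \<le> 1 \<Longrightarrow> norm (F (z + h) - F z - h * D) \<le> B * (norm h)\<^sup>2"
  shows "(F has_field_derivative D) (at z)"
  unfolding has_field_derivative_iff tendsto_iff dist_norm
proof (intro allI impI)
  fix e :: real assume "0 < e"
  define B' where "B' = \<bar>B\<bar> + 1"
  have "B' > 0" by (simp add: B'_def)
  have *: "norm ((F (z + h) - F z) / h - D) < e" if "h \<noteq> 0" "norm h < min 1 (e / B')" for h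
  proof -
    have "norm ((F (z + h) - F z) / h - D) = norm (F (z + h) - F z - h * D) / norm h"
      using that by (simp add: field_simps flip: norm_divide)
    also have "\<dots> \<le> B * (norm h)\<^sup>2 / norm h" using assms[of h] that by (intro divide_right_mono) auto
    also have "\<dots> = B * norm h" by (simp add: power2_eq_square)
    also have "\<dots> \<le> B' * norm h" by (intro mult_right_mono) (auto simp: B'_def)
    also have "\<dots> < e" using that \<open>B' > 0\<close> by (simp add: field_simps)
    finally show ?thesis .
  qed
  show "\<forall>\<^sub>F y in at z. norm ((F y - F z) / (y - z) - D) < e"
    unfolding eventually_at
  proof (intro exI[of _ "min 1 (e / B')"] conjI ballI impI)
    fix y assume "y \<noteq> z \<and> dist y z < min 1 (e / B')"
    then show "norm ((F y - F z) / (y - z) - D) < e" using *[of "y - z"] by (simp add: dist_norm)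
  qed (use \<open>0 < e\<close> \<open>B' > 0\<close> in auto)
qed

lemma Taylor1_at_bound:
  fixes h \<zeta> :: complex
  assumes "norm h \<le> 1"
  shows "norm (exp (\<zeta> * V x) * (exp (h * V x) - 1 - h * V x))
      \<le> (norm h)\<^sup>2 * (\<bar>V x\<bar>\<^sup>2 * exp ((norm \<zeta> + 1) * \<bar>V x\<bar>))"
proof -
  have "norm (exp (\<zeta> * V x) * (exp (h * V x) - 1 - h * V x))
    \<le> exp (norm \<zeta> * \<bar>V x\<bar>) * ((norm (h * V x))\<^sup>2 * exp (norm (h * V x)))"
    unfolding norm_mult by (intro mult_mono norm_exp_le norm_exp_minus_Taylor1[of "h * V x", unfolded norm_mult]) auto
  also have "\<dots> \<le> exp (norm \<zeta> * \<bar>V x\<bar>) * ((norm (h * V x))\<^sup>2 * exp (1 * \<bar>V x\<bar>))"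
    using assms by (intro mult_left_mono) (auto simp: norm_mult intro!: mult_right_mono mult_left_le_one_le)
  also have "\<dots> = (norm h)\<^sup>2 * (\<bar>V x\<bar>\<^sup>2 * exp ((norm \<zeta> + 1) * \<bar>V x\<bar>))"
    by (simp add: norm_mult power_mult_distrib algebra_simps exp_add)
  finally show ?thesis .
qed

lemma deriv_cumul: "(cumul has_field_derivative cumul1 \<zeta>) (at \<zeta>)"
proof (rule quadratic_bound_imp_derivative)
  fix h :: complex assume h: "norm h \<le> 1"
  have "cumul (\<zeta> + h) - cumul \<zeta> - h * cumul1 \<zeta> = (LINT x|Q. exp (\<zeta> * V x) * (exp (h * V x) - 1 - h * V x))"
  proof -
    have "cumul (\<zeta> + h) - cumul \<zeta> - h * cumul1 \<zeta>
       = (LINT x|Q. (exp ((\<zeta> + h) * V x) - 1 - (\<zeta> + h) * V x) - (exp (\<zeta> * V x) - 1 - \<zeta> * V x)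
           - h * (of_real (V x) * (exp (\<zeta> * V x) - 1)))"
      using integral_diff3[OF int_cumul[of "\<zeta> + h"] int_cumul[of \<zeta>] integrable_mult_right[OF int_cumul1[of \<zeta>], of h]]
      unfolding cumul_def cumul1_def integral_mult_right_zero by (rule sym)
    also have "\<dots> = (LINT x|Q. exp (\<zeta> * V x) * (exp (h * V x) - 1 - h * V x))"
      by (intro Bochner_Integration.integral_cong refl) (simp only: exp_add ring_distribs mult_1_left mult_1_right, simp add: algebra_simps)
    finally show ?thesis .
  qed
  also have "norm \<dots> \<le> (norm h)\<^sup>2 * (LINT x|Q. \<bar>V x\<bar>\<^sup>2 * exp ((norm \<zeta> + 1) * \<bar>V x\<bar>))"
    by (rule norm_int_bounded_by[OF order_refl _ Taylor1_at_bound[OF h]]) measurable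
  finally show "norm (cumul (\<zeta> + h) - cumul \<zeta> - h * cumul1 \<zeta>)
     \<le> (LINT x|Q. \<bar>V x\<bar>\<^sup>2 * exp ((norm \<zeta> + 1) * \<bar>V x\<bar>)) * (norm h)\<^sup>2" by (simp add: mult.commute)
qed

lemma deriv_cumul1: "(cumul1 has_field_derivative cumul2 \<zeta>) (at \<zeta>)"
proof (rule quadratic_bound_imp_derivative)
  fix h :: complex assume h: "norm h \<le> 1"
  have i2: "integrable Q (\<lambda>x. of_real ((V x)\<^sup>2) * exp (\<zeta> * of_real (V x)))" using int_power_exp[of 2 \<zeta>] by simp
  have "cumul1 (\<zeta> + h) - cumul1 \<zeta> - h * cumul2 \<zeta> = (LINT x|Q. of_real (V x) * (exp (\<zeta> * V x) * (exp (h * V x) - 1 - h * V x)))"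
  proof -
    have "cumul1 (\<zeta> + h) - cumul1 \<zeta> - h * cumul2 \<zeta>
       = (LINT x|Q. of_real (V x) * (exp ((\<zeta> + h) * V x) - 1) - of_real (V x) * (exp (\<zeta> * V x) - 1)
           - h * (of_real ((V x)\<^sup>2) * exp (\<zeta> * V x)))"
      using integral_diff3[OF int_cumul1[of "\<zeta> + h"] int_cumul1[of \<zeta>] integrable_mult_right[OF i2, of h]]
      unfolding cumul2_def cumul1_def integral_mult_right_zero by (rule sym)
    also have "\<dots> = (LINT x|Q. of_real (V x) * (exp (\<zeta> * V x) * (exp (h * V x) - 1 - h * V x)))"
      by (intro Bochner_Integration.integral_cong refl) (simp only: exp_add ring_distribs mult_1_left mult_1_right, simp add: algebra_simps power2_eq_square)
    finally show ?thesis .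
  qed
  also have "norm \<dots> \<le> (norm h)\<^sup>2 * (LINT x|Q. \<bar>V x\<bar>^3 * exp ((norm \<zeta> + 1) * \<bar>V x\<bar>))"
  proof (rule norm_int_bounded_by)
    show "norm (V x * (exp (\<zeta> * V x) * (exp (h * V x) - 1 - h * V x)))
       \<le> (norm h)\<^sup>2 * (\<bar>V x\<bar>^3 * exp ((norm \<zeta> + 1) * \<bar>V x\<bar>))" for x
      using mult_left_mono[OF Taylor1_at_bound[OF h, of \<zeta> x], of "\<bar>V x\<bar>"]
      by (simp add: norm_mult power2_eq_square power3_eq_cube mult.assoc mult.left_commute)
  qed auto
  finally show "norm (cumul1 (\<zeta> + h) - cumul1 \<zeta> - h * cumul2 \<zeta>)
     \<le> (LINT x|Q. \<bar>V x\<bar>^3 * exp ((norm \<zeta> + 1) * \<bar>V x\<bar>)) * (norm h)\<^sup>2" by (simp add: mult.commute)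
qed

definition mom :: "nat \<Rightarrow> real \<Rightarrow> real" where
  "mom k \<xi> = (LINT x|Q. V x ^ k * exp (\<xi> * V x))"

definition absmom3 :: "real \<Rightarrow> real" where
  "absmom3 \<xi> = (LINT x|Q. \<bar>V x\<bar> ^ 3 * exp (\<xi> * V x))"

text \<open>The compensated exponent, at i w, of the measure tilted by e^(\<xi> V). It is what
  remains of \<open>cumul\<close> on the vertical line through \<xi> once its value and linear term
  at \<xi> are removed (\<open>tilted_eq\<close>), and its real part is never positive.\<close>

definition tilted :: "real \<Rightarrow> real \<Rightarrow> complex" where
  "tilted \<xi> w = (LINT x|Q. exp (\<xi> * V x) * (iexp (w * V x) - 1 - \<i> * (w * V x)))"

lemma cumul2_of_real: "cumul2 (of_real \<xi>) = of_real (mom 2 \<xi>)"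
  unfolding cumul2_def mom_def
  by (subst integral_complex_of_real[symmetric]) (simp flip: exp_of_real)

lemma cumul1_of_real: "cumul1 (of_real \<xi>) = of_real (LINT x|Q. V x * (exp (\<xi> * V x) - 1))"
  unfolding cumul1_def
  by (subst integral_complex_of_real[symmetric]) (simp flip: exp_of_real)

lemma cumul_of_real: "cumul (of_real \<xi>) = of_real (LINT x|Q. exp (\<xi> * V x) - 1 - \<xi> * V x)"
  unfolding cumul_def
  by (subst integral_complex_of_real[symmetric]) (simp flip: exp_of_real)

lemma cumul_Re: "cumul (of_real \<xi>) = of_real (Re (cumul (of_real \<xi>)))"
  by (simp add: cumul_of_real)

lemma cumul1_Re: "cumul1 (of_real \<xi>) = of_real (Re (cumul1 (of_real \<xi>)))"
  by (simp add: cumul1_of_real)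

lemma tilted_eq:
  "tilted \<xi> w = cumul (of_real \<xi> + \<i> * of_real w) - cumul (of_real \<xi>) - \<i> * of_real w * cumul1 (of_real \<xi>)"
proof -
  let ?z = "of_real \<xi> + \<i> * of_real w :: complex"
  have "cumul ?z - cumul (of_real \<xi>) - \<i> * of_real w * cumul1 (of_real \<xi>)
    = (LINT x|Q. (exp (?z * of_real (V x)) - 1 - ?z * of_real (V x))
       - (exp (of_real \<xi> * of_real (V x)) - 1 - of_real \<xi> * of_real (V x))
       - \<i> * of_real w * (of_real (V x) * (exp (of_real \<xi> * of_real (V x)) - 1)))"
    using integral_diff3[OF int_cumul[of ?z] int_cumul[of "of_real \<xi>"]
        integrable_mult_right[OF int_cumul1[of "of_real \<xi>"], of "\<i> * of_real w"]]
    unfolding cumul_def cumul1_def integral_mult_right_zero by (rule sym)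
  also have "\<dots> = tilted \<xi> w"
    unfolding tilted_def
    by (intro Bochner_Integration.integral_cong refl)
       (simp add: exp_add ring_distribs flip: exp_of_real, simp add: algebra_simps)
  finally show ?thesis ..
qed

lemma int_tilted: "integrable Q (\<lambda>x. exp (\<xi> * V x) * (iexp (w * V x) - 1 - \<i> * (w * V x)))"
proof (rule int_bounded_by[of 2 _ "w\<^sup>2 / 2" "\<bar>\<xi>\<bar>"])
  show "norm (exp (\<xi> * V x) * (iexp (w * V x) - 1 - \<i> * (w * V x)))
      \<le> w\<^sup>2 / 2 * (\<bar>V x\<bar>\<^sup>2 * exp (\<bar>\<xi>\<bar> * \<bar>V x\<bar>))" for x
    using mult_mono[OF exp_mult_le[of \<xi> "V x"] norm_iexp_minus2[of "w * V x"]]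
    by (simp add: norm_mult power_mult_distrib mult_ac)
qed auto

lemma Re_tilted: "Re (tilted \<xi> w) = - (LINT x|Q. exp (\<xi> * V x) * (1 - cos (w * V x)))"
proof -
  have "Re (tilted \<xi> w) = (LINT x|Q. - (exp (\<xi> * V x) * (1 - cos (w * V x))))"
    unfolding tilted_def integral_Re[OF int_tilted, symmetric]
    by (intro Bochner_Integration.integral_cong refl) (simp add: Re_exp algebra_simps)
  then show ?thesis by simp
qed

lemma int_one_minus_cos: "integrable Q (\<lambda>x. exp (\<xi> * V x) * (1 - cos (w * V x)))"
proof -
  have "integrable Q (\<lambda>x. - Re (exp (\<xi> * V x) * (iexp (w * V x) - 1 - \<i> * (w * V x))))"
    by (intro integrable_minus integrable_Re int_tilted)
  moreover have "- Re (exp (\<xi> * V x) * (iexp (w * V x) - 1 - \<i> * (w * V x))) = exp (\<xi> * V x) * (1 - cos (w * V x))" for x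
    by (simp add: Re_exp algebra_simps)
  ultimately show ?thesis by (simp only:)
qed

lemma Re_tilted_nonpos: "Re (tilted \<xi> w) \<le> 0"
  unfolding Re_tilted by (simp add: integral_nonneg)

text \<open>From 1 - cos y <= y^2 / 2. At w = 1 it converts a decay bound into a lower bound for the
  second moment (\<open>mom2_ge\<close>).\<close>

lemma Re_tilted_ge: "- Re (tilted \<xi> w) \<le> w\<^sup>2 / 2 * mom 2 \<xi>"
proof -
  have *: "1 - cos y \<le> y\<^sup>2 / 2" for y :: real
    using norm_iexp_minus2[of y] abs_Re_le_cmod[of "iexp y - 1 - \<i> * y"] by (simp add: Re_exp)
  have "(LINT x|Q. exp (\<xi> * V x) * (1 - cos (w * V x))) \<le> (LINT x|Q. w\<^sup>2 / 2 * (V x ^ 2 * exp (\<xi> * V x)))"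
  proof (rule integral_mono[OF int_one_minus_cos integrable_mult_right[OF int_power_exp_real]])
    show "exp (\<xi> * V x) * (1 - cos (w * V x)) \<le> w\<^sup>2 / 2 * (V x ^ 2 * exp (\<xi> * V x))" for x
      using mult_left_mono[OF *[of "w * V x"], of "exp (\<xi> * V x)"] by (simp add: power_mult_distrib mult_ac)
  qed auto
  then show ?thesis by (simp add: Re_tilted mom_def)
qed

text \<open>The quadratic Taylor term of the phase integrates to the second moment; the cubic
  remainder calls for the absolute third moment because \<open>V\<close> may change sign.\<close>

lemma tilted_approx: "norm (tilted \<xi> w + w\<^sup>2 / 2 * mom 2 \<xi>) \<le> \<bar>w\<bar> ^ 3 / 6 * absmom3 \<xi>"
proof -
  have i2: "integrable Q (\<lambda>x. complex_of_real (w\<^sup>2 / 2 * (V x ^ 2 * exp (\<xi> * V x))))"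
    by (intro integrable_of_real integrable_mult_right int_power_exp_real) simp
  have "tilted \<xi> w + w\<^sup>2 / 2 * mom 2 \<xi> = tilted \<xi> w + (LINT x|Q. complex_of_real (w\<^sup>2 / 2 * (V x ^ 2 * exp (\<xi> * V x))))"
    unfolding mom_def by (subst integral_complex_of_real) simp
  also have "\<dots> = (LINT x|Q. exp (\<xi> * V x) * (iexp (w * V x) - 1 - \<i> * (w * V x))
      + complex_of_real (w\<^sup>2 / 2 * (V x ^ 2 * exp (\<xi> * V x))))"
    unfolding tilted_def by (rule Bochner_Integration.integral_add[OF int_tilted i2, symmetric])
  finally have "norm (tilted \<xi> w + w\<^sup>2 / 2 * mom 2 \<xi>) \<le> (LINT x|Q. norm (exp (\<xi> * V x) * (iexp (w * V x) - 1 - \<i> * (w * V x))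
      + complex_of_real (w\<^sup>2 / 2 * (V x ^ 2 * exp (\<xi> * V x)))))"
    by (simp only: integral_norm_bound)
  also have "\<dots> \<le> (LINT x|Q. \<bar>w\<bar> ^ 3 / 6 * (\<bar>V x\<bar> ^ 3 * exp (\<xi> * V x)))"
  proof (rule integral_mono[OF integrable_norm[OF Bochner_Integration.integrable_add[OF int_tilted i2]]
          integrable_mult_right[OF int_abs_power_exp_real]])
    fix x
    have "exp (\<xi> * V x) * (iexp (w * V x) - 1 - \<i> * (w * V x)) + complex_of_real (w\<^sup>2 / 2 * (V x ^ 2 * exp (\<xi> * V x)))
      = of_real (exp (\<xi> * V x)) * (iexp (w * V x) - 1 - \<i> * (w * V x) + (w * V x)\<^sup>2 / 2)"
      by (simp add: power_mult_distrib algebra_simps)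
    then show "norm (exp (\<xi> * V x) * (iexp (w * V x) - 1 - \<i> * (w * V x)) + complex_of_real (w\<^sup>2 / 2 * (V x ^ 2 * exp (\<xi> * V x))))
      \<le> \<bar>w\<bar> ^ 3 / 6 * (\<bar>V x\<bar> ^ 3 * exp (\<xi> * V x))"
      using mult_left_mono[OF norm_iexp_minus3[of "w * V x"], of "exp (\<xi> * V x)"]
      by (simp add: norm_mult abs_mult power_mult_distrib mult_ac)
  qed auto
  finally show ?thesis by (simp add: absmom3_def)
qed

lemma mom_nonneg: "even k \<Longrightarrow> 0 \<le> mom k \<xi>"
  unfolding mom_def by (intro integral_nonneg_AE AE_I2) (simp add: zero_le_even_power)

text \<open>Cauchy-Schwarz for |V|^3 = |V| V^2, obtained from 2 l |V|^3 <= l^2 V^2 + V^4 with l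
  close to the optimum sqrt (mom 4 / mom 2). Only even moments remain, and these are what the
  hypotheses control.\<close>

lemma absmom3_le:
  assumes "0 < mom 2 \<xi>"
  shows "absmom3 \<xi> \<le> sqrt (mom 4 \<xi> / mom 2 \<xi>) * mom 2 \<xi>"
proof -
  let ?s = "sqrt (mom 4 \<xi> / mom 2 \<xi>)"
  have s0: "0 \<le> ?s" using mom_nonneg[of 4 \<xi>] assms by simp
  have s2: "mom 4 \<xi> = ?s\<^sup>2 * mom 2 \<xi>" using mom_nonneg[of 4 \<xi>] assms by simp
  \<comment> \<open>The estimate divides by l, and the optimum \<open>?s\<close> is only known to be
    nonnegative here; every larger l works, and \<open>dense_ge\<close> passes to the limit.\<close>
  have "absmom3 \<xi> / mom 2 \<xi> \<le> l" if "?s < l" for l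
  proof -
    have l: "0 < l" using that s0 by linarith
    have "absmom3 \<xi> \<le> (LINT x|Q. l / 2 * (V x ^ 2 * exp (\<xi> * V x)) + 1 / (2 * l) * (V x ^ 4 * exp (\<xi> * V x)))"
      unfolding absmom3_def
    proof (rule integral_mono[OF int_abs_power_exp_real Bochner_Integration.integrable_add[OF
            integrable_mult_right[OF int_power_exp_real] integrable_mult_right[OF int_power_exp_real]]])
      fix x
      have "2 * l * \<bar>V x\<bar> ^ 3 \<le> l\<^sup>2 * V x ^ 2 + V x ^ 4"
      proof -
        have "0 \<le> (V x)\<^sup>2 * (l - \<bar>V x\<bar>)\<^sup>2" by simp
        also have "\<dots> = l\<^sup>2 * V x ^ 2 + V x ^ 4 - 2 * l * \<bar>V x\<bar> ^ 3"
        proof -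
          have "(V x)\<^sup>2 = \<bar>V x\<bar>\<^sup>2" "V x ^ 4 = \<bar>V x\<bar> ^ 4" by auto
          then show ?thesis by (simp only: power2_eq_square power3_eq_cube power4_eq_xxxx) (simp add: algebra_simps)
        qed
        finally show ?thesis by simp
      qed
      then have "\<bar>V x\<bar> ^ 3 \<le> l / 2 * V x ^ 2 + 1 / (2 * l) * V x ^ 4"
        using l by (simp add: divide_simps power2_eq_square mult_ac)
      from mult_right_mono[OF this, of "exp (\<xi> * V x)"]
      show "\<bar>V x\<bar> ^ 3 * exp (\<xi> * V x) \<le> l / 2 * (V x ^ 2 * exp (\<xi> * V x)) + 1 / (2 * l) * (V x ^ 4 * exp (\<xi> * V x))"
        by (simp add: algebra_simps)
    qed auto
    also have "\<dots> = l / 2 * mom 2 \<xi> + 1 / (2 * l) * mom 4 \<xi>"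
      by (subst Bochner_Integration.integral_add) (simp_all add: mom_def int_power_exp_real)
    also have "\<dots> \<le> l * mom 2 \<xi>"
    proof -
      have "?s\<^sup>2 \<le> l\<^sup>2" using that s0 by (intro power_mono) auto
      then have "?s\<^sup>2 * mom 2 \<xi> \<le> l\<^sup>2 * mom 2 \<xi>" using assms by (intro mult_right_mono) auto
      then have "1 / (2 * l) * mom 4 \<xi> \<le> 1 / (2 * l) * (l\<^sup>2 * mom 2 \<xi>)"
        using l s2 by (intro mult_left_mono) auto
      also have "\<dots> = l / 2 * mom 2 \<xi>" using l by (simp add: power2_eq_square)
      finally show ?thesis by simp
    qed
    finally show ?thesis using assms by (simp add: divide_le_eq)
  qed
  then have "absmom3 \<xi> / mom 2 \<xi> \<le> ?s" by (rule dense_ge)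
  then show ?thesis using assms by (simp add: field_simps)
qed

text \<open>Vanishing of the second moment means \<open>V = 0\<close> almost everywhere, a condition
  free of \<xi>.\<close>

lemma mom2_pos:
  assumes "0 < mom 2 \<xi>"
  shows "0 < mom 2 \<xi>'"
proof -
  have eq: "mom 2 \<eta> = 0 \<longleftrightarrow> (AE x in Q. V x = 0)" for \<eta>
    unfolding mom_def by (subst integral_nonneg_eq_0_iff_AE) (auto intro: int_power_exp_real)
  show ?thesis using assms eq[of \<xi>] eq[of \<xi>'] mom_nonneg[of 2 \<xi>'] by fastforce
qed

end

section \<open>The saddle point estimate\<close>

text \<open>The weight of the relative error in \<open>pointwise_error\<close>; exp (- v^2 / 4) is
  the normal density of variance 2 up to its factor sqrt (4 pi).\<close>

lemma integrable_power_gauss: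
  "integrable lborel (\<lambda>v::real. (\<bar>v\<bar> ^ 3 + \<bar>v\<bar>) * exp (- v\<^sup>2 / 4))"
proof -
  have "integrable lborel (\<lambda>v::real. normal_density 0 (sqrt 2) v * \<bar>v - 0\<bar> ^ k)" for k
    by (rule integrable_normal_moment_abs) simp
  from Bochner_Integration.integrable_add[OF this[of 3] this[of 1]]
  have "integrable lborel (\<lambda>v::real. sqrt (4 * pi) * (normal_density 0 (sqrt 2) v * \<bar>v - 0\<bar> ^ 3 + normal_density 0 (sqrt 2) v * \<bar>v - 0\<bar> ^ 1))"
    by (rule integrable_mult_right)
  then show ?thesis
    by (rule Bochner_Integration.integrable_cong[THEN iffD1, rotated 2])
       (simp_all add: normal_density_def field_simps)
qed

lemma gauss_half:
  "has_bochner_integral lborel (\<lambda>v::real. exp (- v\<^sup>2 / 2)) (sqrt (2 * pi))"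
proof -
  have "has_bochner_integral lborel (\<lambda>v::real. sqrt (2 * pi) * std_normal_density v) (sqrt (2 * pi) * 1)"
    using integral_std_normal_moment_even[of 0] integrable_std_normal_moment[of 0]
    by (intro has_bochner_integral_mult_right) (simp add: has_bochner_integral_iff)
  then show ?thesis
    by (simp add: std_normal_density_def)
qed

lemma integrable_exp_abs:
  assumes "0 < (c::real)"
  shows "integrable lborel (\<lambda>w::real. exp (- c * \<bar>w\<bar>))"
proof -
  have "integrable lborel (\<lambda>w. (1 + 2 / c\<^sup>2) * inverse (1 + w\<^sup>2))"
    using integrable_inverse_1_plus_square by (intro integrable_mult_right) (simp add: set_integrable_def)
  then show ?thesis
  proof (rule Bochner_Integration.integrable_bound)
    show "AE w in lborel. norm (exp (- c * \<bar>w\<bar>)) \<le> norm ((1 + 2 / c\<^sup>2) * inverse (1 + w\<^sup>2))"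
    proof (rule AE_I2)
      fix w :: real
      have "1 + c * \<bar>w\<bar> + (c * \<bar>w\<bar>)\<^sup>2 / 2 \<le> exp (c * \<bar>w\<bar>)"
        using assms by (intro exp_lower_Taylor_quadratic) auto
      moreover have "0 \<le> c * \<bar>w\<bar>" using assms by simp
      ultimately have "(c * \<bar>w\<bar>)\<^sup>2 / 2 \<le> exp (c * \<bar>w\<bar>)" "1 \<le> exp (c * \<bar>w\<bar>)" by auto
      then have "w\<^sup>2 \<le> 2 / c\<^sup>2 * exp (c * \<bar>w\<bar>)" "1 \<le> exp (c * \<bar>w\<bar>)"
        using assms by (auto simp: power_mult_distrib field_simps)
      then have "1 + w\<^sup>2 \<le> (1 + 2 / c\<^sup>2) * exp (c * \<bar>w\<bar>)"
        unfolding ring_distribs mult_1_left by linarith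
      moreover have "0 < 1 + w\<^sup>2" by (simp add: add_pos_nonneg)
      ultimately have "exp (- (c * \<bar>w\<bar>)) \<le> (1 + 2 / c\<^sup>2) * inverse (1 + w\<^sup>2)"
        by (simp add: exp_minus field_simps)
      then show "norm (exp (- c * \<bar>w\<bar>)) \<le> norm ((1 + 2 / c\<^sup>2) * inverse (1 + w\<^sup>2))"
        by (simp add: abs_mult order_trans[OF _ abs_ge_self])
    qed
  qed simp
qed

lemma has_bochner_integral_scale:
  fixes g :: "real \<Rightarrow> 'b::{banach, second_countable_topology}"
  assumes "has_bochner_integral lborel g x" "0 < c"
  shows "has_bochner_integral lborel (\<lambda>w. g (c * w)) (x /\<^sub>R c)"
  using lborel_has_bochner_integral_real_affine_iff[of c g x 0] assms by simp

lemma has_bochner_integral_scale_real: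
  fixes g :: "real \<Rightarrow> real"
  assumes "has_bochner_integral lborel g x" "0 < c"
  shows "has_bochner_integral lborel (\<lambda>w. g (c * w)) (x / c)"
  using has_bochner_integral_scale[OF assms] by (simp add: divide_inverse mult.commute)

text \<open>Mean value inequality on the convex half-plane Re w <= - B, where the derivative of
  \<open>exp\<close> has modulus at most exp (- B).\<close>

lemma norm_exp_diff_le:
  fixes z :: complex
  assumes "Re z \<le> - B" "r \<le> - B"
  shows "norm (exp z - exp (of_real r)) \<le> norm (z - of_real r) * exp (- B)"
proof -
  have "norm (exp z - exp (of_real r)) \<le> exp (- B) * norm (z - of_real r)"
  proof (rule field_differentiable_bound[where S = "{w. Re w \<le> - B}" and f' = exp])
    show "convex {w. Re w \<le> - B}" by (rule convex_halfspace_Re_le)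
    show "(exp has_field_derivative exp w) (at w within {w. Re w \<le> - B})" for w
      by (auto intro!: derivative_eq_intros)
  qed (use assms in auto)
  then show ?thesis by (simp add: mult.commute)
qed

text \<open>\<open>decay_near\<close> gains a factor e^(d \<xi>) but is flat for large |w|;
  \<open>decay_far\<close> gives integrability in w without any gain in \<xi>. Both are wanted at
  once, hence the halving of exponents below. \<open>mom4_small\<close> will come from hypothesis 3,
  \<open>mom4_le\<close> and \<open>mom2_le\<close> from hypothesis 4.\<close>

locale saddle = exp_moments +
  fixes b d W t0 :: real
  assumes pos: "0 < b" "0 < d" "0 < t0"
    and decay_near: "\<And>\<xi> w. 0 \<le> \<xi> \<Longrightarrow> Re (tilted \<xi> w) \<le> - b * exp (d * \<xi>) * min (w\<^sup>2) 1"
    and decay_far: "\<And>\<xi> w. 0 \<le> \<xi> \<Longrightarrow> Re (tilted \<xi> w) \<le> - b * (\<bar>w\<bar> - W)"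
    and mom4_small: "((\<lambda>\<xi>. mom 4 \<xi> / (mom 2 \<xi>)\<^sup>2) \<longlongrightarrow> 0) at_top"
    and mom4_le: "\<And>\<epsilon>. 0 < \<epsilon> \<Longrightarrow> \<exists>C. \<forall>\<xi>\<ge>0. mom 4 \<xi> \<le> C * exp (\<epsilon> * \<xi>) * mom 2 \<xi>"
    and mom2_le: "\<And>\<epsilon>. 0 < \<epsilon> \<Longrightarrow> \<exists>C. \<forall>\<xi>\<ge>0. mom 2 \<xi> \<le> exp (C * exp (\<epsilon> * \<xi>))"
begin

lemma mom2_ge: "0 \<le> \<xi> \<Longrightarrow> 2 * b * exp (d * \<xi>) \<le> mom 2 \<xi>"
  using decay_near[of \<xi> 1] Re_tilted_ge[of \<xi> 1] by simp

lemma mom2_pos': "0 < mom 2 \<xi>"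
proof (rule mom2_pos)
  show "0 < mom 2 0" using mom2_ge[of 0] pos by simp
qed

text \<open>The limit bounds the ratio beyond some X; on [0, X] this is done by
  \<open>mom4_le\<close> and the lower bound for \<open>mom 2\<close>. It serves the case of large t
  and moderate \<xi>, where only the division by t makes the error small.\<close>

lemma mom4_ratio_bounded:
  obtains B where "\<And>\<xi>. 0 \<le> \<xi> \<Longrightarrow> mom 4 \<xi> / (mom 2 \<xi>)\<^sup>2 \<le> B" "0 < B"
proof -
  obtain X where X: "\<And>\<xi>. X \<le> \<xi> \<Longrightarrow> \<bar>mom 4 \<xi> / (mom 2 \<xi>)\<^sup>2\<bar> < 1"
    using tendstoD[OF mom4_small, of 1] by (auto simp: eventually_at_top_linorder)
  obtain C where C: "\<And>\<xi>. 0 \<le> \<xi> \<Longrightarrow> mom 4 \<xi> \<le> C * exp (1 * \<xi>) * mom 2 \<xi>" using mom4_le[of 1] by auto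
  define B where "B = 1 + \<bar>C\<bar> * exp \<bar>X\<bar> / (2 * b)"
  have "mom 4 \<xi> / (mom 2 \<xi>)\<^sup>2 \<le> B" if "0 \<le> \<xi>" for \<xi>
  proof (cases "X \<le> \<xi>")
    case True
    have "0 \<le> \<bar>C\<bar> * exp \<bar>X\<bar> / (2 * b)" using pos by simp
    then show ?thesis using X[OF True] unfolding B_def by linarith
  next
    case False
    have "mom 4 \<xi> / (mom 2 \<xi>)\<^sup>2 \<le> C * exp (1 * \<xi>) * mom 2 \<xi> / (mom 2 \<xi>)\<^sup>2"
      by (intro divide_right_mono C that) simp
    also have "\<dots> = C * exp \<xi> / mom 2 \<xi>" using mom2_pos'[of \<xi>] by (simp add: power2_eq_square)
    also have "\<dots> \<le> \<bar>C\<bar> * exp \<bar>X\<bar> / mom 2 \<xi>"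
      using False mom2_pos'[of \<xi>] that by (intro divide_right_mono mult_mono) auto
    also have "\<dots> \<le> \<bar>C\<bar> * exp \<bar>X\<bar> / (2 * b)"
    proof (intro divide_left_mono)
      have "1 \<le> exp (d * \<xi>)" using pos that by simp
      then have "2 * b \<le> 2 * b * exp (d * \<xi>)" using pos by simp
      then show "2 * b \<le> mom 2 \<xi>" using mom2_ge[OF that] by linarith
    qed (use pos mom2_pos'[of \<xi>] in auto)
    finally show ?thesis by (simp add: B_def)
  qed
  moreover have "0 < B" using pos by (simp add: B_def add_pos_nonneg)
  ultimately show ?thesis using that by blast
qed

lemma isCont_tilted: "isCont (tilted \<xi>) w"
proof -
  have "isCont cumul z" for z using deriv_cumul DERIV_isCont by blast
  then have *: "isCont (\<lambda>w. cumul (of_real \<xi> + \<i> * of_real w)) w"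
    by (intro isCont_o2[where g = cumul and f = "\<lambda>w. of_real \<xi> + \<i> * of_real w"] continuous_intros)
  have "tilted \<xi> = (\<lambda>w. cumul (of_real \<xi> + \<i> * of_real w) - cumul (of_real \<xi>) - \<i> * of_real w * cumul1 (of_real \<xi>))"
    by (simp add: fun_eq_iff tilted_eq)
  then show ?thesis by (simp only:) (intro continuous_intros *)
qed

lemma tilted_measurable [measurable]: "tilted \<xi> \<in> borel_measurable borel"
  by (intro borel_measurable_continuous_onI continuous_at_imp_continuous_on ballI isCont_tilted)

text \<open>Majorant for half of the exponent, with t lowered to \<open>t0\<close>: integrable and
  independent of t and \<xi>, while the other half of the exponent stays free to supply
  smallness.\<close>

definition tail :: "real \<Rightarrow> real" where
  "tail w = exp (t0 / 2 * (b * W)) * exp (- (t0 * b / 2) * \<bar>w\<bar>)"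

lemma integrable_tail: "integrable lborel tail"
  unfolding tail_def using pos by (intro integrable_mult_right integrable_exp_abs) auto

lemma norm_exp_tilted_half:
  assumes "0 \<le> \<xi>" "t0 \<le> t"
  shows "exp (t / 2 * Re (tilted \<xi> w)) \<le> tail w"
proof -
  have "t / 2 * Re (tilted \<xi> w) \<le> t0 / 2 * Re (tilted \<xi> w)"
    using assms Re_tilted_nonpos[of \<xi> w] by (intro mult_right_mono_neg) auto
  also have "\<dots> \<le> t0 / 2 * (- b * (\<bar>w\<bar> - W))" using pos assms by (intro mult_left_mono decay_far) auto
  finally show ?thesis unfolding tail_def by (simp add: algebra_simps flip: exp_add)
qed

lemma norm_exp_tilted:
  "norm (exp (of_real t * tilted \<xi> w)) = exp (t / 2 * Re (tilted \<xi> w)) * exp (t / 2 * Re (tilted \<xi> w))"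
  by (simp flip: exp_add)

lemma integrable_exp_tilted:
  assumes "0 \<le> \<xi>" "t0 \<le> t"
  shows "integrable lborel (\<lambda>w. exp (of_real t * tilted \<xi> w))"
proof (rule Bochner_Integration.integrable_bound[OF integrable_tail])
  show "AE w in lborel. norm (exp (of_real t * tilted \<xi> w)) \<le> norm (tail w)"
  proof (rule AE_I2)
    fix w
    have "exp (t / 2 * Re (tilted \<xi> w)) * exp (t / 2 * Re (tilted \<xi> w)) \<le> tail w * 1"
      using assms pos Re_tilted_nonpos[of \<xi> w]
      by (intro mult_mono norm_exp_tilted_half) (auto simp: tail_def mult_nonneg_nonpos)
    then show "norm (exp (of_real t * tilted \<xi> w)) \<le> norm (tail w)"
      by (simp add: norm_exp_tilted tail_def del: norm_exp_eq_Re)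
  qed
qed measurable

text \<open>In this region w^2 exceeds mom 2 / mom 4, which by \<open>mom4_le\<close> is at least of
  order e^(- d \<xi> / 2); half of the rate d in \<open>decay_near\<close> therefore
  survives.\<close>

lemma far_bound:
  obtains b' d' where "0 < b'" "0 < d'"
    "\<And>\<xi> w. 0 \<le> \<xi> \<Longrightarrow> 1 < w\<^sup>2 * (mom 4 \<xi> / mom 2 \<xi>) \<Longrightarrow> Re (tilted \<xi> w) \<le> - b' * exp (2 * d' * \<xi>)"
    "d' = d / 4"
proof -
  obtain C where C: "\<And>\<xi>. 0 \<le> \<xi> \<Longrightarrow> mom 4 \<xi> \<le> C * exp (d / 2 * \<xi>) * mom 2 \<xi>"
    using mom4_le[of "d / 2"] pos by auto
  define C' where "C' = \<bar>C\<bar> + 1"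
  have C': "1 \<le> C'" "C \<le> C'" by (auto simp: C'_def)
  show ?thesis
  \<comment> \<open>The surviving rate d / 2 is recorded as 2 d', so that \<open>far_term_le\<close>
    can bound \<open>mom 2\<close> at rate d' and play e^(d' \<xi>) against its square.\<close>
  proof (rule that[of "b / C'" "d / 4"])
    fix \<xi> w :: real assume \<xi>: "0 \<le> \<xi>" and w: "1 < w\<^sup>2 * (mom 4 \<xi> / mom 2 \<xi>)"
    have "mom 4 \<xi> / mom 2 \<xi> \<le> C * exp (d / 2 * \<xi>)"
      using C[OF \<xi>] mom2_pos'[of \<xi>] by (simp add: divide_le_eq)
    also have "\<dots> \<le> C' * exp (d / 2 * \<xi>)" using C' by (intro mult_right_mono) auto
    finally have "w\<^sup>2 * (mom 4 \<xi> / mom 2 \<xi>) \<le> w\<^sup>2 * (C' * exp (d / 2 * \<xi>))" by (intro mult_left_mono) auto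
    with w have "1 < w\<^sup>2 * (C' * exp (d / 2 * \<xi>))" by linarith
    then have 1: "exp (- (d / 2 * \<xi>)) / C' \<le> w\<^sup>2"
      using C' by (simp add: exp_minus field_simps)
    have "exp (- (d / 2 * \<xi>)) \<le> 1" using pos \<xi> by simp
    then have "exp (- (d / 2 * \<xi>)) \<le> C'" using C' by linarith
    then have 2: "exp (- (d / 2 * \<xi>)) / C' \<le> 1" using C' by (simp add: divide_le_eq)
    have "b * exp (d * \<xi>) * (exp (- (d / 2 * \<xi>)) / C') \<le> b * exp (d * \<xi>) * min (w\<^sup>2) 1"
      using pos 1 2 by (intro mult_left_mono) auto
    moreover have "b * exp (d * \<xi>) * (exp (- (d / 2 * \<xi>)) / C') = b / C' * exp (2 * (d / 4) * \<xi>)"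
    proof -
      have "exp (d * \<xi>) * exp (- (d / 2 * \<xi>)) = exp (2 * (d / 4) * \<xi>)"
        by (simp add: mult_exp_exp)
      then show ?thesis by simp
    qed
    ultimately show "Re (tilted \<xi> w) \<le> - (b / C') * exp (2 * (d / 4) * \<xi>)"
      using decay_near[OF \<xi>, of w] by (simp only: mult_minus_left)
  qed (use pos C' in auto)
qed

text \<open>With \<open>v = sqrt (t * mom 2 \<xi>) * w\<close>, the region \<open>w\<^sup>2 * mom 4 \<xi> \<le> mom 2 \<xi>\<close> is where the
  cubic Taylor error is dominated by the Gaussian; \<open>\<eta>\<close> is the resulting relative error.\<close>

lemma pointwise_error:
  fixes t \<xi> w :: real
  assumes \<xi>: "0 \<le> \<xi>" and t: "0 < t"
  defines "A \<equiv> t * mom 2 \<xi>" and "\<eta> \<equiv> sqrt (mom 4 \<xi> / (mom 2 \<xi>)\<^sup>2 / t)"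
  defines "v \<equiv> sqrt A * w"
  shows "norm (exp (of_real t * tilted \<xi> w) - exp (of_real (- v\<^sup>2 / 2)))
     \<le> \<eta> * ((\<bar>v\<bar> ^ 3 + \<bar>v\<bar>) * exp (- v\<^sup>2 / 4))
        + (if 1 < w\<^sup>2 * (mom 4 \<xi> / mom 2 \<xi>) then exp (t * Re (tilted \<xi> w)) else 0)"
proof -
  define s where "s = sqrt (mom 4 \<xi> / mom 2 \<xi>)"
  note p = mom2_pos'[of \<xi>]
  have m4: "0 \<le> mom 4 \<xi>" by (simp add: mom_nonneg)
  have s: "0 \<le> s" "s\<^sup>2 = mom 4 \<xi> / mom 2 \<xi>" using p m4 by (auto simp: s_def)
  have A: "0 < A" using p t by (simp add: A_def)
  have v2: "v\<^sup>2 = A * w\<^sup>2" using A by (simp add: v_def power_mult_distrib)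
  have \<eta>: "\<eta> = s / sqrt A"
  proof -
    have "mom 4 \<xi> / (mom 2 \<xi>)\<^sup>2 / t = (mom 4 \<xi> / mom 2 \<xi>) / A" using t p by (simp add: A_def power2_eq_square)
    then show ?thesis unfolding \<eta>_def s_def by (simp only: real_sqrt_divide)
  qed
  have vw: "\<bar>v\<bar> * \<eta> = \<bar>w\<bar> * s" using A by (simp add: \<eta> v_def abs_mult)
  have \<eta>0: "0 \<le> \<eta>" using s A by (simp add: \<eta>)
  show ?thesis
  proof (cases "1 < w\<^sup>2 * (mom 4 \<xi> / mom 2 \<xi>)")
    case True
    then have "1 < (\<bar>w\<bar> * s)\<^sup>2" by (simp add: power_mult_distrib s)
    moreover have "0 \<le> \<bar>w\<bar> * s" using s(1) by simp
    ultimately have "1 < \<bar>w\<bar> * s" by (metis one_power2 power2_less_imp_less)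
    \<comment> \<open>Outside the region the Gaussian itself counts as error. Since |v| \<eta> > 1
      it may be multiplied by |v| \<eta>; this is the origin of the linear term in the
      weight.\<close>
    then have 1: "1 < \<bar>v\<bar> * \<eta>" unfolding vw .
    have "exp (- v\<^sup>2 / 2) \<le> exp (- v\<^sup>2 / 4)" by simp
    also have "\<dots> \<le> (\<bar>v\<bar> * \<eta>) * exp (- v\<^sup>2 / 4)" using 1 by simp
    also have "\<dots> \<le> \<eta> * ((\<bar>v\<bar> ^ 3 + \<bar>v\<bar>) * exp (- v\<^sup>2 / 4))"
      using \<eta>0 by (simp add: algebra_simps)
    finally have 2: "exp (- v\<^sup>2 / 2) \<le> \<eta> * ((\<bar>v\<bar> ^ 3 + \<bar>v\<bar>) * exp (- v\<^sup>2 / 4))" .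
    have "norm (exp (of_real t * tilted \<xi> w) - exp (of_real (- v\<^sup>2 / 2)))
      \<le> norm (exp (of_real t * tilted \<xi> w)) + norm (exp (complex_of_real (- v\<^sup>2 / 2)))"
      by (rule norm_triangle_ineq4)
    also have "\<dots> = exp (t * Re (tilted \<xi> w)) + exp (- v\<^sup>2 / 2)" by (simp add: Re_divide_of_real power2_eq_square)
    finally show ?thesis using True 2 by simp
  next
    case False
    then have "(\<bar>w\<bar> * s)\<^sup>2 \<le> 1" by (simp add: power_mult_distrib s)
    then have 1: "\<bar>w\<bar> * s \<le> 1" using s(1) by (simp add: abs_square_le_1 abs_mult)
    have E: "norm (tilted \<xi> w + w\<^sup>2 / 2 * mom 2 \<xi>) \<le> \<bar>w\<bar> ^ 3 / 6 * (s * mom 2 \<xi>)"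
      using order_trans[OF tilted_approx mult_left_mono[OF absmom3_le[OF p]]] by (simp add: s_def)
    also have E1: "\<bar>w\<bar> ^ 3 / 6 * (s * mom 2 \<xi>) = (\<bar>w\<bar> * s) * (w\<^sup>2 / 6 * mom 2 \<xi>)"
      by (simp add: power3_eq_cube power2_eq_square flip: abs_mult)
    also have "\<dots> \<le> 1 * (w\<^sup>2 / 6 * mom 2 \<xi>)" using 1 p by (intro mult_right_mono) auto
    finally have F: "norm (tilted \<xi> w + w\<^sup>2 / 2 * mom 2 \<xi>) \<le> 1 * (w\<^sup>2 / 6 * mom 2 \<xi>)" .
    have "Re (tilted \<xi> w + of_real (w\<^sup>2 / 2 * mom 2 \<xi>)) \<le> 1 * (w\<^sup>2 / 6 * mom 2 \<xi>)"
      using order_trans[OF complex_Re_le_cmod F] by simp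
    then have "Re (tilted \<xi> w) + (w\<^sup>2 * mom 2 \<xi>) / 2 \<le> (w\<^sup>2 * mom 2 \<xi>) / 6"
      by (simp del: of_real_mult of_real_divide)
    moreover have "0 \<le> w\<^sup>2 * mom 2 \<xi>" using p by simp
    \<comment> \<open>The main term has coefficient - 1/2 and the remainder at most 1/6, which gives
      - 1/3. The weaker - 1/4 matches the weight exp (- v^2 / 4), a common bound for both
      exponentials.\<close>
    ultimately have "Re (tilted \<xi> w) \<le> - ((w\<^sup>2 * mom 2 \<xi>) / 4)" by linarith
    then have "Re (tilted \<xi> w) \<le> - (w\<^sup>2 / 4 * mom 2 \<xi>)" by simp
    then have "t * Re (tilted \<xi> w) \<le> t * - (w\<^sup>2 / 4 * mom 2 \<xi>)" using t by (intro mult_left_mono) auto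
    then have R: "Re (of_real t * tilted \<xi> w) \<le> - (v\<^sup>2 / 4)" by (simp add: v2 A_def algebra_simps)
    have "norm (exp (of_real t * tilted \<xi> w) - exp (of_real (- v\<^sup>2 / 2)))
      \<le> norm (of_real t * tilted \<xi> w - of_real (- v\<^sup>2 / 2)) * exp (- (v\<^sup>2 / 4))"
      by (rule norm_exp_diff_le[OF R]) simp
    also have "of_real t * tilted \<xi> w - of_real (- v\<^sup>2 / 2) = of_real t * (tilted \<xi> w + w\<^sup>2 / 2 * mom 2 \<xi>)"
      by (simp add: v2 A_def algebra_simps)
    also have "norm \<dots> * exp (- (v\<^sup>2 / 4)) \<le> (t * (\<bar>w\<bar> ^ 3 / 6 * (s * mom 2 \<xi>))) * exp (- (v\<^sup>2 / 4))"
      using E t by (intro mult_right_mono) (auto simp: norm_mult intro!: mult_left_mono)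
    also have "t * (\<bar>w\<bar> ^ 3 / 6 * (s * mom 2 \<xi>)) = (\<bar>w\<bar> * s) * (A * w\<^sup>2) / 6"
      unfolding E1 by (simp add: A_def)
    also have "\<dots> = \<eta> * \<bar>v\<bar> ^ 3 / 6"
      unfolding v2[symmetric] vw[symmetric] by (simp add: power3_eq_cube power2_eq_square)
    also have "\<dots> * exp (- (v\<^sup>2 / 4)) \<le> \<eta> * ((\<bar>v\<bar> ^ 3 + \<bar>v\<bar>) * exp (- v\<^sup>2 / 4))"
    proof -
      have "0 \<le> \<bar>v\<bar> ^ 3" "0 \<le> \<bar>v\<bar>" by simp_all
      then have "\<bar>v\<bar> ^ 3 / 6 \<le> \<bar>v\<bar> ^ 3 + \<bar>v\<bar>" by linarith
      then have "\<eta> * (\<bar>v\<bar> ^ 3 / 6) \<le> \<eta> * (\<bar>v\<bar> ^ 3 + \<bar>v\<bar>)" using \<eta>0 by (rule mult_left_mono)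
      then have "\<eta> * (\<bar>v\<bar> ^ 3 / 6) * exp (- (v\<^sup>2 / 4)) \<le> \<eta> * (\<bar>v\<bar> ^ 3 + \<bar>v\<bar>) * exp (- (v\<^sup>2 / 4))"
        by (rule mult_right_mono) simp
      then show ?thesis by (simp add: mult.assoc)
    qed
    finally show ?thesis using False by simp
  qed
qed

text \<open>Integrates \<open>pointwise_error\<close> after the substitution v = sqrt (t mom 2) w.
  \<open>C1\<close> is a Gaussian integral and \<open>C2\<close> the integral of
  \<open>tail\<close>, so neither depends on t or \<xi>.\<close>

lemma integral_error:
  obtains C1 C2 b' d' where "0 < b'" "0 < d'" "d' = d / 4"
    "\<And>\<xi> t. 0 \<le> \<xi> \<Longrightarrow> t0 \<le> t \<Longrightarrow>
      norm (of_real (sqrt (t * mom 2 \<xi>)) * (LINT w|lborel. exp (of_real t * tilted \<xi> w)) - sqrt (2 * pi))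
      \<le> C1 * sqrt (mom 4 \<xi> / (mom 2 \<xi>)\<^sup>2 / t)
        + C2 * (sqrt (t * mom 2 \<xi>) * exp (- (t / 2) * b' * exp (2 * d' * \<xi>)))"
proof -
  obtain b' d' where b': "0 < b'" "0 < d'" "d' = d / 4"
    and far: "\<And>\<xi> w. 0 \<le> \<xi> \<Longrightarrow> 1 < w\<^sup>2 * (mom 4 \<xi> / mom 2 \<xi>) \<Longrightarrow> Re (tilted \<xi> w) \<le> - b' * exp (2 * d' * \<xi>)"
    using far_bound by metis
  define C1 where "C1 = (LINT v::real|lborel. (\<bar>v\<bar> ^ 3 + \<bar>v\<bar>) * exp (- v\<^sup>2 / 4))"
  define C2 where "C2 = integral\<^sup>L lborel tail"
  show ?thesis
  proof (rule that[OF b'])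
    fix \<xi> t :: real assume \<xi>: "0 \<le> \<xi>" and t: "t0 \<le> t"
    have t': "0 < t" using pos t by simp
    define A where "A = t * mom 2 \<xi>"
    have A: "0 < A" using t' mom2_pos'[of \<xi>] by (simp add: A_def)
    then have sA: "0 < sqrt A" by simp
    define \<eta> where "\<eta> = sqrt (mom 4 \<xi> / (mom 2 \<xi>)\<^sup>2 / t)"
    define q where "q = exp (- (t / 2) * b' * exp (2 * d' * \<xi>))"
    have 1: "has_bochner_integral lborel (\<lambda>w. \<eta> * ((\<bar>sqrt A * w\<bar> ^ 3 + \<bar>sqrt A * w\<bar>) * exp (- (sqrt A * w)\<^sup>2 / 4))) (\<eta> * (C1 / sqrt A))"
      unfolding C1_def
      by (intro has_bochner_integral_mult_right has_bochner_integral_scale_real[where g = "\<lambda>v. (\<bar>v\<bar> ^ 3 + \<bar>v\<bar>) * exp (- v\<^sup>2 / 4)"]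
           has_bochner_integral_integrable integrable_power_gauss sA)
    have 2: "has_bochner_integral lborel (\<lambda>w. q * tail w) (q * C2)"
      unfolding C2_def by (intro has_bochner_integral_mult_right has_bochner_integral_integrable integrable_tail)
    have 3: "has_bochner_integral lborel (\<lambda>w. complex_of_real (exp (- (sqrt A * w)\<^sup>2 / 2))) (complex_of_real (sqrt (2 * pi) / sqrt A))"
      by (intro has_bochner_integral_of_real has_bochner_integral_scale_real[where g = "\<lambda>v. exp (- v\<^sup>2 / 2)"] gauss_half sA)
    have pw: "norm (exp (of_real t * tilted \<xi> w) - complex_of_real (exp (- (sqrt A * w)\<^sup>2 / 2)))
      \<le> \<eta> * ((\<bar>sqrt A * w\<bar> ^ 3 + \<bar>sqrt A * w\<bar>) * exp (- (sqrt A * w)\<^sup>2 / 4)) + q * tail w" for w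
    proof -
      have "(if 1 < w\<^sup>2 * (mom 4 \<xi> / mom 2 \<xi>) then exp (t * Re (tilted \<xi> w)) else 0) \<le> q * tail w"
      proof (cases "1 < w\<^sup>2 * (mom 4 \<xi> / mom 2 \<xi>)")
        case True
        \<comment> \<open>One half of the exponent gives the small factor \<open>q\<close> through
          the far bound, the other half gives integrability through \<open>tail\<close>.\<close>
        have "exp (t / 2 * Re (tilted \<xi> w)) * exp (t / 2 * Re (tilted \<xi> w)) \<le> q * tail w"
        proof (intro mult_mono norm_exp_tilted_half \<xi> t)
          have "t / 2 * Re (tilted \<xi> w) \<le> t / 2 * (- b' * exp (2 * d' * \<xi>))"
            using t' by (intro mult_left_mono far \<xi> True) auto
          then show "exp (t / 2 * Re (tilted \<xi> w)) \<le> q" by (simp add: q_def)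
        qed (auto simp: q_def)
        moreover have "exp (t / 2 * Re (tilted \<xi> w)) * exp (t / 2 * Re (tilted \<xi> w)) = exp (t * Re (tilted \<xi> w))"
          by (simp add: mult_exp_exp)
        ultimately show ?thesis using True by simp
      qed (auto simp: q_def tail_def)
      then show ?thesis
        using pointwise_error[OF \<xi> t', of w] unfolding A_def[symmetric] \<eta>_def[symmetric] exp_of_real[symmetric]
        by linarith
    qed
    have "norm ((LINT w|lborel. exp (of_real t * tilted \<xi> w)) - complex_of_real (sqrt (2 * pi) / sqrt A))
      = norm (LINT w|lborel. exp (of_real t * tilted \<xi> w) - complex_of_real (exp (- (sqrt A * w)\<^sup>2 / 2)))"
      using 3 integrable_exp_tilted[OF \<xi> t] by (subst Bochner_Integration.integral_diff) (auto simp: has_bochner_integral_iff)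
    also have "\<dots> \<le> (LINT w|lborel. norm (exp (of_real t * tilted \<xi> w) - complex_of_real (exp (- (sqrt A * w)\<^sup>2 / 2))))"
      by (rule integral_norm_bound)
    also have "\<dots> \<le> (LINT w|lborel. \<eta> * ((\<bar>sqrt A * w\<bar> ^ 3 + \<bar>sqrt A * w\<bar>) * exp (- (sqrt A * w)\<^sup>2 / 4)) + q * tail w)"
      using 1 2 3 integrable_exp_tilted[OF \<xi> t] pw
      by (intro integral_mono integrable_norm Bochner_Integration.integrable_diff Bochner_Integration.integrable_add)
         (auto simp: has_bochner_integral_iff)
    also have "\<dots> = \<eta> * (C1 / sqrt A) + q * C2"
      using has_bochner_integral_add[OF 1 2] by (simp add: has_bochner_integral_iff)
    finally have "sqrt A * norm ((LINT w|lborel. exp (of_real t * tilted \<xi> w)) - complex_of_real (sqrt (2 * pi) / sqrt A))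
      \<le> sqrt A * (\<eta> * (C1 / sqrt A) + q * C2)" using sA by (intro mult_left_mono) auto
    also have "sqrt A * (\<eta> * (C1 / sqrt A) + q * C2) = C1 * \<eta> + C2 * (sqrt A * q)"
      using sA by (simp add: field_simps)
    also have "sqrt A * norm ((LINT w|lborel. exp (of_real t * tilted \<xi> w)) - complex_of_real (sqrt (2 * pi) / sqrt A))
       = norm (of_real (sqrt A) * ((LINT w|lborel. exp (of_real t * tilted \<xi> w)) - complex_of_real (sqrt (2 * pi) / sqrt A)))"
      using A by (simp only: norm_mult norm_of_real real_sqrt_abs2 abs_of_pos[OF sA])
    also have "of_real (sqrt A) * ((LINT w|lborel. exp (of_real t * tilted \<xi> w)) - complex_of_real (sqrt (2 * pi) / sqrt A))
       = of_real (sqrt A) * (LINT w|lborel. exp (of_real t * tilted \<xi> w)) - sqrt (2 * pi)"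
    proof -
      have "sqrt A * (sqrt (2 * pi) / sqrt A) = sqrt (2 * pi)" using sA by simp
      then show ?thesis unfolding right_diff_distrib by (simp only: of_real_mult[symmetric])
    qed
    finally show "norm (of_real (sqrt (t * mom 2 \<xi>)) * (LINT w|lborel. exp (of_real t * tilted \<xi> w)) - sqrt (2 * pi))
      \<le> C1 * sqrt (mom 4 \<xi> / (mom 2 \<xi>)\<^sup>2 / t)
        + C2 * (sqrt (t * mom 2 \<xi>) * exp (- (t / 2) * b' * exp (2 * d' * \<xi>)))"
      unfolding A_def \<eta>_def q_def .
  qed
qed

text \<open>With E = e^(d' \<xi>) the second moment is at most exp (C0 E), whereas the decay has E^2
  in its exponent, so the square wins.\<close>

lemma far_term_le:
  assumes "0 < b'" "0 < d'"
  obtains C where "0 < C"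
    "\<And>\<xi> t. 0 \<le> \<xi> \<Longrightarrow> t0 \<le> t \<Longrightarrow>
       sqrt (t * mom 2 \<xi>) * exp (- (t / 2) * b' * exp (2 * d' * \<xi>)) \<le> C / (sqrt t * exp (2 * d' * \<xi>))"
proof -
  obtain C0 where C0: "\<And>\<xi>. 0 \<le> \<xi> \<Longrightarrow> mom 2 \<xi> \<le> exp (C0 * exp (d' * \<xi>))"
    using mom2_le[of d'] assms by auto
  define C where "C = exp (C0\<^sup>2 / (4 * t0 * b')) * (4 / b')"
  show ?thesis
  proof (rule that[of C])
    show "0 < C" using assms pos by (simp add: C_def)
    fix \<xi> t :: real assume \<xi>: "0 \<le> \<xi>" and t: "t0 \<le> t"
    have t': "0 < t" using t pos by simp
    define E where "E = exp (d' * \<xi>)"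
    have E: "0 < E" by (simp add: E_def)
    have E2: "exp (2 * d' * \<xi>) = E\<^sup>2" unfolding E_def by (simp add: power2_eq_square mult_exp_exp)
    have "sqrt (mom 2 \<xi>) \<le> sqrt (exp (C0 * E))" unfolding E_def using C0[OF \<xi>] by simp
    also have "\<dots> = exp (C0 * E / 2)"
      by (rule real_sqrt_unique) (auto simp: power2_eq_square mult_exp_exp)
    finally have m: "sqrt (mom 2 \<xi>) \<le> exp (C0 * E / 2)" .
    have "sqrt (t * mom 2 \<xi>) * exp (- (t / 2) * b' * E\<^sup>2) \<le> sqrt t * exp (C0 * E / 2) * exp (- (t / 2) * b' * E\<^sup>2)"
      unfolding real_sqrt_mult using m t' by (intro mult_right_mono mult_left_mono) auto
    \<comment> \<open>The decay is split into two equal parts: one completes the square against C0 E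
      / 2, using t >= \<open>t0\<close>; the other gives the factor 4 / (t b' E^2) through e^(-x) <=
      1 / x.\<close>
    also have "\<dots> = sqrt t * (exp (C0 * E / 2 - t * b' / 4 * E\<^sup>2) * exp (- (t * b' / 4 * E\<^sup>2)))"
      by (simp add: mult_exp_exp algebra_simps)
    also have "\<dots> \<le> sqrt t * (exp (C0\<^sup>2 / (4 * t0 * b')) * (4 / (t * b' * E\<^sup>2)))"
    proof (intro mult_left_mono mult_mono)
      have "C0 * E / 2 - t * b' / 4 * E\<^sup>2 \<le> C0 * E / 2 - t0 * b' / 4 * E\<^sup>2"
        using t assms by (intro diff_left_mono mult_right_mono divide_right_mono) auto
      also have "\<dots> \<le> C0\<^sup>2 / (4 * t0 * b')"
      proof -
        have "0 \<le> (C0 - t0 * b' * E)\<^sup>2 / (4 * t0 * b')" using pos assms by simp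
        also have "\<dots> = C0\<^sup>2 / (4 * t0 * b') - (C0 * E / 2 - t0 * b' / 4 * E\<^sup>2)"
          using pos assms by (simp add: field_simps power2_eq_square)
        finally show ?thesis by simp
      qed
      finally show "exp (C0 * E / 2 - t * b' / 4 * E\<^sup>2) \<le> exp (C0\<^sup>2 / (4 * t0 * b'))" by simp
      have "0 < t * b' / 4 * E\<^sup>2" using t' assms E by simp
      moreover have "t * b' / 4 * E\<^sup>2 \<le> exp (t * b' / 4 * E\<^sup>2)"
        using exp_ge_add_one_self[of "t * b' / 4 * E\<^sup>2"] by linarith
      ultimately have "exp (- (t * b' / 4 * E\<^sup>2)) \<le> 1 / (t * b' / 4 * E\<^sup>2)"
        by (simp add: exp_minus divide_simps)
      then show "exp (- (t * b' / 4 * E\<^sup>2)) \<le> 4 / (t * b' * E\<^sup>2)" by simp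
    qed (use t' in auto)
    also have "\<dots> = C / (sqrt t * E\<^sup>2)"
    proof -
      obtain r where r: "0 < r" "t = r\<^sup>2" using t' by (metis real_sqrt_gt_zero real_sqrt_pow2 less_imp_le)
      then show ?thesis using E assms by (simp add: C_def power2_eq_square)
    qed
    finally show "sqrt (t * mom 2 \<xi>) * exp (- (t / 2) * b' * exp (2 * d' * \<xi>)) \<le> C / (sqrt t * exp (2 * d' * \<xi>))"
      unfolding E2 .
  qed
qed

text \<open>If t is large, a bounded moment ratio is divided by t; if \<xi> is large, t >=
  \<open>t0\<close> is enough because the ratio tends to 0. Smallness under either condition alone
  is what t + x -> infinity calls for.\<close>

lemma saddle_uniform:
  assumes "0 < e"
  obtains q where "0 < q" "\<And>\<xi> t. 0 \<le> \<xi> \<Longrightarrow> t0 \<le> t \<Longrightarrow> q \<le> t \<or> q \<le> \<xi> \<Longrightarrow>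
      norm (of_real (sqrt (t * mom 2 \<xi>)) * (LINT w|lborel. exp (of_real t * tilted \<xi> w)) - sqrt (2 * pi)) < e"
proof -
  obtain C1 C2 b' d' where b': "0 < b'" "0 < d'" and
    err: "\<And>\<xi> t. 0 \<le> \<xi> \<Longrightarrow> t0 \<le> t \<Longrightarrow>
      norm (of_real (sqrt (t * mom 2 \<xi>)) * (LINT w|lborel. exp (of_real t * tilted \<xi> w)) - sqrt (2 * pi))
      \<le> C1 * sqrt (mom 4 \<xi> / (mom 2 \<xi>)\<^sup>2 / t)
        + C2 * (sqrt (t * mom 2 \<xi>) * exp (- (t / 2) * b' * exp (2 * d' * \<xi>)))"
    using integral_error by metis
  obtain C where C: "0 < C"
    "\<And>\<xi> t. 0 \<le> \<xi> \<Longrightarrow> t0 \<le> t \<Longrightarrow>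
       sqrt (t * mom 2 \<xi>) * exp (- (t / 2) * b' * exp (2 * d' * \<xi>)) \<le> C / (sqrt t * exp (2 * d' * \<xi>))"
    using far_term_le[OF b'] by metis
  obtain B where B: "\<And>\<xi>. 0 \<le> \<xi> \<Longrightarrow> mom 4 \<xi> / (mom 2 \<xi>)\<^sup>2 \<le> B" "0 < B" using mom4_ratio_bounded by metis
  define R where "R = (\<lambda>\<xi>. mom 4 \<xi> / (mom 2 \<xi>)\<^sup>2)"
  have R0: "0 \<le> R \<xi>" for \<xi> by (simp add: R_def mom_nonneg)
  define D1 where "D1 = \<bar>C1\<bar>"
  define D2 where "D2 = \<bar>C2\<bar> * C"
  have D: "0 \<le> D1" "0 \<le> D2" using C by (auto simp: D1_def D2_def)
  have err': "norm (of_real (sqrt (t * mom 2 \<xi>)) * (LINT w|lborel. exp (of_real t * tilted \<xi> w)) - sqrt (2 * pi))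
      \<le> D1 * sqrt (R \<xi> / t) + D2 / (sqrt t * exp (2 * d' * \<xi>))" if "0 \<le> \<xi>" "t0 \<le> t" for \<xi> t
  proof -
    have t': "0 < t" using that pos by simp
    have "C1 * sqrt (R \<xi> / t) \<le> D1 * sqrt (R \<xi> / t)" using R0 t' by (intro mult_right_mono) (auto simp: D1_def)
    moreover have "C2 * (sqrt (t * mom 2 \<xi>) * exp (- (t / 2) * b' * exp (2 * d' * \<xi>))) \<le> \<bar>C2\<bar> * (C / (sqrt t * exp (2 * d' * \<xi>)))"
      using C(2)[OF that] t' mom2_pos'[of \<xi>] by (intro mult_mono) auto
    ultimately show ?thesis using err[OF that] unfolding R_def D2_def by simp
  qed
  have "((\<lambda>t. D1 * sqrt (B / t) + D2 * (1 / sqrt t)) \<longlongrightarrow> 0) at_top"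
  proof (intro tendsto_add_zero tendsto_mult_right_zero)
    show "((\<lambda>t. sqrt (B / t)) \<longlongrightarrow> 0) at_top" using B(2) by real_asymp
    show "((\<lambda>t::real. 1 / sqrt t) \<longlongrightarrow> 0) at_top" by real_asymp
  qed
  then have "((\<lambda>t. D1 * sqrt (B / t) + D2 / sqrt t) \<longlongrightarrow> 0) at_top" by simp
  from tendstoD[OF this assms] obtain q1 where q1: "\<And>t. q1 \<le> t \<Longrightarrow> \<bar>D1 * sqrt (B / t) + D2 / sqrt t\<bar> < e"
    by (auto simp: eventually_at_top_linorder)
  have "((\<lambda>\<xi>. D1 * sqrt (R \<xi> / t0) + D2 / (sqrt t0 * exp (2 * d' * \<xi>))) \<longlongrightarrow> D1 * sqrt (0 / t0) + 0) at_top"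
  proof (intro tendsto_add tendsto_mult tendsto_const tendsto_real_sqrt tendsto_divide)
    show "(R \<longlongrightarrow> 0) at_top" unfolding R_def by (rule mom4_small)
    have "((\<lambda>\<xi>. D2 / sqrt t0 * exp (- (2 * d' * \<xi>))) \<longlongrightarrow> 0) at_top"
      by (rule tendsto_mult_right_zero) (use b' in real_asymp)
    then show "((\<lambda>\<xi>. D2 / (sqrt t0 * exp (2 * d' * \<xi>))) \<longlongrightarrow> 0) at_top"
      by (simp add: exp_minus divide_simps)
  qed (use pos in auto)
  then have "((\<lambda>\<xi>. D1 * sqrt (R \<xi> / t0) + D2 / (sqrt t0 * exp (2 * d' * \<xi>))) \<longlongrightarrow> 0) at_top" by simp
  from tendstoD[OF this assms] obtain q2 where q2: "\<And>\<xi>. q2 \<le> \<xi> \<Longrightarrow> \<bar>D1 * sqrt (R \<xi> / t0) + D2 / (sqrt t0 * exp (2 * d' * \<xi>))\<bar> < e"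
    by (auto simp: eventually_at_top_linorder)
  show ?thesis
  proof (rule that[of "max 1 (max q1 q2)"])
    fix \<xi> t assume \<xi>: "0 \<le> \<xi>" and t: "t0 \<le> t" and "max 1 (max q1 q2) \<le> t \<or> max 1 (max q1 q2) \<le> \<xi>"
    have t': "0 < t" using t pos by simp
    have "D1 * sqrt (R \<xi> / t) + D2 / (sqrt t * exp (2 * d' * \<xi>)) < e"
    proof (cases "q1 \<le> t")
      case True
      have "R \<xi> \<le> B" using B(1)[OF \<xi>] by (simp add: R_def)
      then have "sqrt (R \<xi> / t) \<le> sqrt (B / t)" using t' by (intro real_sqrt_le_mono divide_right_mono) auto
      moreover have "D2 / (sqrt t * exp (2 * d' * \<xi>)) \<le> D2 / (sqrt t * 1)"
        using D t' b' \<xi> by (intro divide_left_mono mult_left_mono) auto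
      ultimately show ?thesis using q1[OF True] D(1) by (smt (verit) mult_left_mono mult_1_right)
    next
      case False
      then have "q2 \<le> \<xi>" using \<open>max 1 (max q1 q2) \<le> t \<or> _\<close> by auto
      have "sqrt (R \<xi> / t) \<le> sqrt (R \<xi> / t0)" using R0[of \<xi>] t pos by (simp add: divide_left_mono)
      moreover have "D2 / (sqrt t * exp (2 * d' * \<xi>)) \<le> D2 / (sqrt t0 * exp (2 * d' * \<xi>))"
        using D t t' pos by (intro divide_left_mono mult_right_mono) auto
      ultimately show ?thesis using q2[OF \<open>q2 \<le> \<xi>\<close>] D(1) by (smt (verit) mult_left_mono)
    qed
    then show "norm (of_real (sqrt (t * mom 2 \<xi>)) * (LINT w|lborel. exp (of_real t * tilted \<xi> w)) - sqrt (2 * pi)) < e"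
      using err'[OF \<xi> t] by linarith
  qed simp
qed

end

section \<open>Moving the inversion contour to the saddle point\<close>

lemma integral_symmetric_limit:
  fixes g :: "real \<Rightarrow> 'b::{banach, second_countable_topology}"
  assumes "integrable lborel g"
  shows "(\<lambda>n. LINT w|lborel. indicator {- real n..real n} w *\<^sub>R g w) \<longlonglongrightarrow> integral\<^sup>L lborel g"
proof (rule integral_dominated_convergence[where w = "\<lambda>w. norm (g w)"])
  show "AE w in lborel. (\<lambda>n. indicator {- real n..real n} w *\<^sub>R g w) \<longlonglongrightarrow> g w"
  proof (rule AE_I2)
    fix w :: real
    obtain N :: nat where "\<bar>w\<bar> \<le> real N" using real_arch_simple by blast
    then have "\<forall>\<^sub>F n in sequentially. indicator {- real n..real n} w *\<^sub>R g w = g w"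
      unfolding eventually_sequentially by (intro exI[of _ N]) (auto simp: indicator_def)
    then show "(\<lambda>n. indicator {- real n..real n} w *\<^sub>R g w) \<longlonglongrightarrow> g w"
      by (rule tendsto_eventually)
  qed
qed (use assms in \<open>auto simp: indicator_def\<close>)

text \<open>An entire function has a primitive, so the two horizontal integrals over \<open>{-n..n}\<close> differ
  only by increments of the primitive along the vertical sides, which the decay kills.\<close>

lemma contour_shift:
  fixes F :: "complex \<Rightarrow> complex"
  assumes hol: "F holomorphic_on UNIV" and \<xi>: "0 \<le> \<xi>" and c: "0 < c"
    and bound: "\<And>\<eta> w. 0 \<le> \<eta> \<Longrightarrow> \<eta> \<le> \<xi> \<Longrightarrow> norm (F (of_real \<eta> + \<i> * of_real w)) \<le> C * exp (- c * \<bar>w\<bar>)"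
  shows "(LINT w|lborel. F (\<i> * of_real w)) = (LINT w|lborel. F (of_real \<xi> + \<i> * of_real w))"
proof -
  obtain G where G: "\<And>z. (G has_field_derivative F z) (at z)"
    using holomorphic_convex_primitive'[OF convex_UNIV open_UNIV hol] by auto
  have contF: "isCont F z" for z
    using holomorphic_on_imp_continuous_on[OF hol] by (simp add: continuous_on_eq_continuous_at)
  have contFw: "continuous_on S (\<lambda>w. F (of_real \<eta> + \<i> * of_real w))" for \<eta> S
    by (intro continuous_at_imp_continuous_on ballI isCont_o2[OF _ contF] continuous_intros)
  have int: "integrable lborel (\<lambda>w. F (of_real \<eta> + \<i> * of_real w))" if "0 \<le> \<eta>" "\<eta> \<le> \<xi>" for \<eta>
  proof (rule Bochner_Integration.integrable_bound[OF integrable_mult_right[OF integrable_exp_abs[OF c], of C]])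
    show "(\<lambda>w. F (of_real \<eta> + \<i> * of_real w)) \<in> borel_measurable lborel"
      using borel_measurable_continuous_onI[OF contFw[of UNIV \<eta>]] by simp
    show "AE w in lborel. norm (F (of_real \<eta> + \<i> * of_real w)) \<le> norm (C * exp (- c * \<bar>w\<bar>))"
      using bound[OF that] by (auto intro!: AE_I2 order_trans[OF _ abs_ge_self])
  qed
  have ftc: "(LINT w|lborel. indicator {- real n..real n} w *\<^sub>R F (of_real \<eta> + \<i> * of_real w))
      = (G (of_real \<eta> + \<i> * of_real (real n)) - G (of_real \<eta> - \<i> * of_real (real n))) / \<i>" for n \<eta>
  proof -
    have "((\<lambda>w. G (of_real \<eta> + \<i> * of_real w) / \<i>) has_vector_derivative F (of_real \<eta> + \<i> * of_real w)) (at w within {- real n..real n})" for w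
    proof -
      have "((\<lambda>z. G (of_real \<eta> + \<i> * z) / \<i>) has_field_derivative F (of_real \<eta> + \<i> * of_real w)) (at (of_real w))"
        using DERIV_cdivide[OF DERIV_chain2[OF G DERIV_add[OF DERIV_const[of "of_real \<eta>"] DERIV_cmult_Id[of \<i>]]],
            where c = \<i> and s = UNIV and x = "of_real w"]
        by (simp add: mult.left_commute[of \<i> _ \<i>])
      then show ?thesis by (rule has_vector_derivative_real_field)
    qed
    from integral_FTC_Icc[OF _ this contFw]
    show ?thesis unfolding diff_divide_distrib by simp
  qed
  have side: "norm (G (of_real \<xi> + \<i> * of_real w) - G (of_real 0 + \<i> * of_real w)) \<le> C * exp (- c * \<bar>w\<bar>) * \<xi>" for w
  proof -
    define S where "S = (\<lambda>\<eta>. of_real \<eta> + \<i> * of_real w) ` {0..\<xi>}"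
    have "norm (G (of_real \<xi> + \<i> * of_real w) - G (of_real 0 + \<i> * of_real w))
      \<le> C * exp (- c * \<bar>w\<bar>) * norm ((of_real \<xi> + \<i> * of_real w) - (of_real 0 + \<i> * of_real w))"
    proof (rule field_differentiable_bound[where S = S and f' = F])
      have "S = (+) (\<i> * of_real w) ` (of_real ` {0..\<xi>})" by (auto simp: S_def image_image add.commute)
      moreover have "convex (of_real ` {0..\<xi>} :: complex set)"
        by (intro convex_linear_image) (auto simp: linear_iff scaleR_conv_of_real)
      ultimately show "convex S" by (simp add: convex_translation)
      show "(G has_field_derivative F z) (at z within S)" for z using G has_field_derivative_at_within by blast
      show "norm (F z) \<le> C * exp (- c * \<bar>w\<bar>)" if "z \<in> S" for z using that bound by (auto simp: S_def)
    qed (use \<xi> in \<open>auto simp: S_def\<close>)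
    then show ?thesis using \<xi> by simp
  qed
  let ?I = "\<lambda>\<eta> n. LINT w|lborel. indicator {- real n..real n} w *\<^sub>R F (of_real \<eta> + \<i> * of_real w)"
  have "norm (?I \<xi> n - ?I 0 n) \<le> 2 * (C * exp (- c * real n) * \<xi>)" for n
  proof -
    have "?I \<xi> n - ?I 0 n = ((G (of_real \<xi> + \<i> * of_real (real n)) - G (of_real 0 + \<i> * of_real (real n)))
        - (G (of_real \<xi> + \<i> * of_real (- real n)) - G (of_real 0 + \<i> * of_real (- real n)))) / \<i>"
      unfolding ftc by (simp add: right_diff_distrib)
    then have "norm (?I \<xi> n - ?I 0 n) = norm ((G (of_real \<xi> + \<i> * of_real (real n)) - G (of_real 0 + \<i> * of_real (real n)))
        - (G (of_real \<xi> + \<i> * of_real (- real n)) - G (of_real 0 + \<i> * of_real (- real n))))" by (simp only: norm_divide norm_ii div_by_1)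
    also have "\<dots> \<le> C * exp (- c * \<bar>real n\<bar>) * \<xi> + C * exp (- c * \<bar>- real n\<bar>) * \<xi>"
      by (intro order_trans[OF norm_triangle_ineq4] add_mono side)
    finally show ?thesis unfolding abs_minus_cancel by (simp only: abs_of_nat mult_2)
  qed
  moreover have "(\<lambda>n. 2 * (C * exp (- c * real n) * \<xi>)) \<longlonglongrightarrow> 0"
  proof -
    have "(\<lambda>n. exp (- c * real n)) \<longlonglongrightarrow> 0" using c by real_asymp
    then show ?thesis by (intro tendsto_mult_right_zero tendsto_mult_left_zero)
  qed
  ultimately have "(\<lambda>n. ?I \<xi> n - ?I 0 n) \<longlonglongrightarrow> 0"
    by (rule Lim_null_comparison[OF always_eventually, OF allI])
  moreover have "(\<lambda>n. ?I \<xi> n - ?I 0 n) \<longlonglongrightarrow> (LINT w|lborel. F (of_real \<xi> + \<i> * of_real w)) - (LINT w|lborel. F (of_real 0 + \<i> * of_real w))"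
    by (intro tendsto_diff integral_symmetric_limit int \<xi> order_refl)
  ultimately have "(LINT w|lborel. F (of_real \<xi> + \<i> * of_real w)) - (LINT w|lborel. F (of_real 0 + \<i> * of_real w)) = 0"
    using LIMSEQ_unique by blast
  then show ?thesis by simp
qed

context saddle
begin

lemma deriv_rcumul: "((\<lambda>\<xi>. Re (cumul (of_real \<xi>))) has_real_derivative Re (cumul1 (of_real \<xi>))) (at \<xi>)"
  by (rule has_field_derivative_Re[OF has_vector_derivative_real_field[OF deriv_cumul]])

lemma deriv_rcumul1: "((\<lambda>\<xi>. Re (cumul1 (of_real \<xi>))) has_real_derivative mom 2 \<xi>) (at \<xi>)"
  using has_field_derivative_Re[OF has_vector_derivative_real_field[OF deriv_cumul1]]
  by (simp add: cumul2_of_real)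

lemma rcumul1_less: "\<xi> < \<xi>' \<Longrightarrow> Re (cumul1 (of_real \<xi>)) < Re (cumul1 (of_real \<xi>'))"
  by (rule DERIV_pos_imp_increasing[where f = "\<lambda>\<xi>. Re (cumul1 (of_real \<xi>))"])
     (auto intro: deriv_rcumul1 mom2_pos')

lemma cumul1_inject: "cumul1 (of_real \<xi>) = cumul1 (of_real \<xi>') \<Longrightarrow> \<xi> = \<xi>'"
  using rcumul1_less[of \<xi> \<xi>'] rcumul1_less[of \<xi>' \<xi>] by (cases \<xi> \<xi>' rule: linorder_cases) auto

lemma cumul1_0: "cumul1 0 = 0"
  by (simp add: cumul1_def)

lemma rcumul1_ge:
  assumes "0 \<le> \<xi>"
  shows "2 * b * \<xi> \<le> Re (cumul1 (of_real \<xi>))"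
proof -
  have "(\<lambda>\<xi>. Re (cumul1 (of_real \<xi>)) - 2 * b * \<xi>) 0 \<le> (\<lambda>\<xi>. Re (cumul1 (of_real \<xi>)) - 2 * b * \<xi>) \<xi>"
  proof (rule DERIV_nonneg_imp_nondecreasing[OF assms])
    fix x :: real assume "0 \<le> x"
    have "1 \<le> exp (d * x)" using \<open>0 \<le> x\<close> pos by simp
    then have "2 * b \<le> 2 * b * exp (d * x)" using pos by simp
    then have "0 \<le> mom 2 x - 2 * b" using mom2_ge[OF \<open>0 \<le> x\<close>] by linarith
    moreover have "((\<lambda>\<xi>. Re (cumul1 (of_real \<xi>)) - 2 * b * \<xi>) has_real_derivative mom 2 x - 2 * b) (at x)"
      by (intro DERIV_diff deriv_rcumul1 DERIV_cmult_Id)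
    ultimately show "\<exists>y. ((\<lambda>\<xi>. Re (cumul1 (of_real \<xi>)) - 2 * b * \<xi>) has_real_derivative y) (at x) \<and> 0 \<le> y" by blast
  qed
  then show ?thesis by (simp add: cumul1_0)
qed

text \<open>\<open>rcumul1_ge\<close> makes the first derivative grow at least linearly, which gives
  the bracket [0, y / (2 b)] for the intermediate value theorem.\<close>

lemma ex_saddle_point:
  assumes "0 \<le> y"
  obtains \<xi> where "0 \<le> \<xi>" "cumul1 (of_real \<xi>) = of_real y"
proof -
  have "y \<le> Re (cumul1 (of_real (y / (2 * b))))"
    using rcumul1_ge[of "y / (2 * b)"] assms pos by (simp del: of_real_divide of_real_mult)
  then have "\<exists>\<xi>\<ge>0. \<xi> \<le> y / (2 * b) \<and> Re (cumul1 (of_real \<xi>)) = y"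
    using assms pos DERIV_isCont[OF deriv_rcumul1] by (intro IVT) (auto simp: cumul1_0)
  then obtain \<xi> where "0 \<le> \<xi>" "Re (cumul1 (of_real \<xi>)) = y" by blast
  then show ?thesis using that cumul1_Re by metis
qed

lemma Re_cumul_line: "Re (cumul (of_real \<eta> + \<i> * of_real w)) = Re (cumul (of_real \<eta>)) + Re (tilted \<eta> w)"
proof -
  have "Re (\<i> * of_real w * cumul1 (of_real \<eta>)) = 0" by (subst cumul1_Re) simp
  then show ?thesis by (simp add: tilted_eq)
qed

lemma cumul_holomorphic: "cumul holomorphic_on UNIV"
  using deriv_cumul by (auto simp: holomorphic_on_def field_differentiable_def intro: has_field_derivative_at_within)

text \<open>The equation cumul1 \<xi> = y cancels the linear term of the exponent on the shifted
  line, so exactly \<open>tilted\<close> remains; the factor in front is the exponential of t times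
  the exponent's value at the saddle point.\<close>

lemma saddle_shift:
  assumes \<xi>: "0 \<le> \<xi>" and t: "t0 \<le> t" and y: "cumul1 (of_real \<xi>) = of_real y"
  shows "(LINT w|lborel. exp (of_real t * cumul (\<i> * of_real w) - \<i> * of_real w * of_real (t * y)))
    = of_real (exp (t * (Re (cumul (of_real \<xi>)) - \<xi> * y))) * (LINT w|lborel. exp (of_real t * tilted \<xi> w))"
proof -
  define F where "F z = exp (of_real t * cumul z - z * of_real (t * y))" for z
  have t': "0 < t" using t pos by simp
  \<comment> \<open>The contour shift wants one decay bound for the whole strip between 0 and \<xi>.
    \<open>decay_far\<close> handles the vertical direction, compactness of [0, \<xi>] the real
    one.\<close>
  have "continuous_on {0..\<xi>} (\<lambda>\<eta>. Re (cumul (of_real \<eta>)) - \<eta> * y)"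
    using DERIV_isCont[OF deriv_rcumul] by (intro continuous_at_imp_continuous_on ballI continuous_intros)
  from compact_imp_bounded[OF compact_continuous_image[OF this compact_Icc]]
  obtain B where "\<forall>x\<in>(\<lambda>\<eta>. Re (cumul (of_real \<eta>)) - \<eta> * y) ` {0..\<xi>}. norm x \<le> B"
    unfolding bounded_iff by blast
  then have B: "\<bar>Re (cumul (of_real \<eta>)) - \<eta> * y\<bar> \<le> B" if "0 \<le> \<eta>" "\<eta> \<le> \<xi>" for \<eta>
    using that by simp
  have "(LINT w|lborel. F (\<i> * of_real w)) = (LINT w|lborel. F (of_real \<xi> + \<i> * of_real w))"
  proof (rule contour_shift[OF _ \<xi>, where c = "t * b" and C = "exp (t * B + t * (b * W))"])
    show "F holomorphic_on UNIV" unfolding F_def by (intro holomorphic_intros cumul_holomorphic)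
    fix \<eta> w assume \<eta>: "0 \<le> \<eta>" "\<eta> \<le> \<xi>"
    have "t * Re (cumul (of_real \<eta>)) + t * Re (tilted \<eta> w) - \<eta> * (t * y)
        = t * (Re (cumul (of_real \<eta>)) - \<eta> * y + Re (tilted \<eta> w))" by (simp add: algebra_simps)
    also have "\<dots> \<le> t * (B + - b * (\<bar>w\<bar> - W))"
      using t' B[OF \<eta>] decay_far[OF \<eta>(1), of w] by (intro mult_left_mono add_mono) auto
    finally have "norm (F (of_real \<eta> + \<i> * of_real w)) \<le> exp (t * (B + - b * (\<bar>w\<bar> - W)))"
      by (simp add: F_def Re_cumul_line ring_distribs)
    also have "\<dots> = exp (t * B + t * (b * W)) * exp (- (t * b) * \<bar>w\<bar>)"
      by (simp add: mult_exp_exp algebra_simps)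
    finally show "norm (F (of_real \<eta> + \<i> * of_real w)) \<le> exp (t * B + t * (b * W)) * exp (- (t * b) * \<bar>w\<bar>)" .
  qed (use t' pos in auto)
  also have "\<dots> = (LINT w|lborel. of_real (exp (t * (Re (cumul (of_real \<xi>)) - \<xi> * y))) * exp (of_real t * tilted \<xi> w))"
  proof (intro Bochner_Integration.integral_cong refl)
    fix w
    have "cumul (of_real \<xi>) = of_real (Re (cumul (of_real \<xi>)))" by (rule cumul_Re)
    then have "of_real t * cumul (of_real \<xi> + \<i> * of_real w) - (of_real \<xi> + \<i> * of_real w) * of_real (t * y)
      = of_real (t * (Re (cumul (of_real \<xi>)) - \<xi> * y)) + of_real t * tilted \<xi> w"
      unfolding tilted_eq y by (simp add: algebra_simps)
    then show "F (of_real \<xi> + \<i> * of_real w) = of_real (exp (t * (Re (cumul (of_real \<xi>)) - \<xi> * y))) * exp (of_real t * tilted \<xi> w)"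
      by (simp only: F_def exp_add exp_of_real)
  qed
  finally show ?thesis by (simp add: F_def)
qed

end

section \<open>Fourier inversion for exponentially decaying characteristic functions\<close>

lemma power_le_exp:
  fixes x c :: real
  assumes "0 \<le> x" "0 < c"
  shows "x ^ k \<le> fact k / c ^ k * exp (c * x)"
proof -
  have "(c * x) ^ k / fact k \<le> exp (c * x)"
    using sum_le_suminf[of "\<lambda>n. (c * x) ^ n / fact n" "{k}"] assms summable_exp[of "c * x"]
    by (simp add: exp_def divide_inverse mult.commute scaleR_conv_of_real)
  then show ?thesis using assms by (simp add: power_mult_distrib field_simps)
qed

lemma integrable_power_exp_abs:
  assumes "0 < (c::real)"
  shows "integrable lborel (\<lambda>w::real. \<bar>w\<bar> ^ k * exp (- c * \<bar>w\<bar>))"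
proof (rule Bochner_Integration.integrable_bound[OF integrable_mult_right[OF integrable_exp_abs[of "c / 2"], of "fact k / (c / 2) ^ k"]])
  show "AE w::real in lborel. norm (\<bar>w\<bar> ^ k * exp (- c * \<bar>w\<bar>)) \<le> norm (fact k / (c / 2) ^ k * exp (- (c / 2) * \<bar>w\<bar>))"
  proof (rule AE_I2)
    fix w :: real
    have "\<bar>w\<bar> ^ k * exp (- c * \<bar>w\<bar>) \<le> fact k / (c / 2) ^ k * exp (c / 2 * \<bar>w\<bar>) * exp (- c * \<bar>w\<bar>)"
      using assms by (intro mult_right_mono power_le_exp) auto
    also have "\<dots> = fact k / (c / 2) ^ k * exp (- (c / 2) * \<bar>w\<bar>)" by (simp add: mult_exp_exp)
    finally show "norm (\<bar>w\<bar> ^ k * exp (- c * \<bar>w\<bar>)) \<le> norm (fact k / (c / 2) ^ k * exp (- (c / 2) * \<bar>w\<bar>))"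
      using assms by (simp add: abs_mult)
  qed
qed (use assms in auto)

lemma quadratic_bound_imp_vector_derivative:
  fixes F :: "real \<Rightarrow> 'b::real_normed_vector"
  assumes "\<And>h. norm (F (x + h) - F x - h *\<^sub>R D) \<le> B * h\<^sup>2"
  shows "(F has_vector_derivative D) (at x)"
  unfolding has_vector_derivative_def has_derivative_iff_norm
proof (intro conjI bounded_linear_scaleR_left)
  have 1: "((\<lambda>y. \<bar>B\<bar> * \<bar>y - x\<bar>) \<longlongrightarrow> 0) (at x)"
    by (rule tendsto_mult_right_zero[OF tendsto_rabs_zero[OF LIM_zero[OF tendsto_ident_at]]])
  have 2: "norm (norm (F y - F x - (y - x) *\<^sub>R D) / norm (y - x)) \<le> \<bar>B\<bar> * \<bar>y - x\<bar>" for y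
  proof (cases "y = x")
    case False
    have "norm (F y - F x - (y - x) *\<^sub>R D) \<le> \<bar>B\<bar> * (y - x)\<^sup>2"
    proof -
      have "norm (F y - F x - (y - x) *\<^sub>R D) \<le> B * (y - x)\<^sup>2" using assms[of "y - x"] by simp
      also have "\<dots> \<le> \<bar>B\<bar> * (y - x)\<^sup>2" by (intro mult_right_mono) auto
      finally show ?thesis .
    qed
    also have "\<dots> = (\<bar>B\<bar> * \<bar>y - x\<bar>) * \<bar>y - x\<bar>"
      by (metis mult.assoc power2_abs power2_eq_square)
    finally show ?thesis using False by (simp add: divide_le_eq)
  qed simp
  show "((\<lambda>y. norm (F y - F x - (y - x) *\<^sub>R D) / norm (y - x)) \<longlongrightarrow> 0) (at x)"
    by (rule Lim_null_comparison[OF always_eventually[OF allI[OF 2]] 1])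
qed

locale exp_decaying =
  fixes \<phi> :: "real \<Rightarrow> complex" and C c :: real
  assumes meas\<phi> [measurable]: "\<phi> \<in> borel_measurable borel"
    and decay: "\<And>z. norm (\<phi> z) \<le> C * exp (- c * \<bar>z\<bar>)"
    and c_pos: "0 < c"
begin

lemma int_weight:
  assumes [measurable]: "g \<in> borel_measurable borel" and "\<And>z. norm (g z :: complex) \<le> B * \<bar>z\<bar> ^ k"
  shows "integrable lborel (\<lambda>z. g z * \<phi> z)"
    and "norm (LINT z|lborel. g z * \<phi> z) \<le> B * C * (LINT z|lborel. \<bar>z\<bar> ^ k * exp (- c * \<bar>z\<bar>))"
proof -
  have *: "norm (g z * \<phi> z) \<le> B * C * (\<bar>z\<bar> ^ k * exp (- c * \<bar>z\<bar>))" for z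
  proof -
    have "norm (g z * \<phi> z) \<le> (B * \<bar>z\<bar> ^ k) * (C * exp (- c * \<bar>z\<bar>))"
      unfolding norm_mult by (intro mult_mono assms decay) (auto intro: order_trans[OF norm_ge_zero assms(2)])
    then show ?thesis by (simp add: mult_ac)
  qed
  have i: "integrable lborel (\<lambda>z. B * C * (\<bar>z\<bar> ^ k * exp (- c * \<bar>z\<bar>)))"
    by (intro integrable_mult_right integrable_power_exp_abs c_pos)
  show 1: "integrable lborel (\<lambda>z. g z * \<phi> z)"
    by (rule Bochner_Integration.integrable_bound[OF i])
       (use order_trans[OF * abs_ge_self] in \<open>simp_all only: real_norm_def AE_I2, simp_all\<close>)
  have "norm (LINT z|lborel. g z * \<phi> z) \<le> (LINT z|lborel. norm (g z * \<phi> z))" by (rule integral_norm_bound)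
  also have "\<dots> \<le> (LINT z|lborel. B * C * (\<bar>z\<bar> ^ k * exp (- c * \<bar>z\<bar>)))"
    by (rule integral_mono[OF integrable_norm[OF 1] i *])
  finally show "norm (LINT z|lborel. g z * \<phi> z) \<le> B * C * (LINT z|lborel. \<bar>z\<bar> ^ k * exp (- c * \<bar>z\<bar>))" by simp
qed

text \<open>The n-th derivative of the unnormalised inverse transform: each differentiation in x
  brings down a factor - i z, harmless against the exponential decay. Carrying n along turns
  smoothness with bounded derivatives into one induction.\<close>

definition fourier :: "nat \<Rightarrow> real \<Rightarrow> complex" where
  "fourier n x = (LINT z|lborel. ((- \<i> * of_real z) ^ n * iexp (- (z * x))) * \<phi> z)"

lemma norm_fourier_kernel: "norm ((- \<i> * of_real z) ^ n * iexp (- (z * x))) \<le> 1 * \<bar>z\<bar> ^ n"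
  by (simp add: norm_mult norm_power)

lemma fourier_bounded: "norm (fourier n x) \<le> 1 * C * (LINT z|lborel. \<bar>z\<bar> ^ n * exp (- c * \<bar>z\<bar>))"
  unfolding fourier_def by (rule int_weight(2)[OF _ norm_fourier_kernel]) measurable

lemma int_fourier: "integrable lborel (\<lambda>z. ((- \<i> * of_real z) ^ n * iexp (- (z * x))) * \<phi> z)"
  by (rule int_weight(1)[OF _ norm_fourier_kernel]) measurable

lemma fourier_deriv: "(fourier n has_vector_derivative fourier (Suc n) x) (at x)"
proof (rule quadratic_bound_imp_vector_derivative)
  fix h :: real
  let ?g = "\<lambda>z. (- \<i> * of_real z) ^ n * iexp (- (z * x)) * (iexp (- (z * h)) - 1 - \<i> * of_real (- (z * h)))"
  have "fourier n (x + h) - fourier n x - h *\<^sub>R fourier (Suc n) x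
    = (LINT z|lborel. ((- \<i> * of_real z) ^ n * iexp (- (z * (x + h)))) * \<phi> z - ((- \<i> * of_real z) ^ n * iexp (- (z * x))) * \<phi> z
        - h *\<^sub>R (((- \<i> * of_real z) ^ Suc n * iexp (- (z * x))) * \<phi> z))"
    using integral_diff3[OF int_fourier[of n "x + h"] int_fourier[of n x] integrable_scaleR_right[OF int_fourier[of "Suc n" x], of h]]
    unfolding fourier_def integral_scaleR_right by (rule sym)
  also have "\<dots> = (LINT z|lborel. ?g z * \<phi> z)"
  proof (intro Bochner_Integration.integral_cong refl)
    fix z :: real
    have "iexp (- (z * (x + h))) = iexp (- (z * x)) * iexp (- (z * h))"
      by (simp add: mult_exp_exp ring_distribs)
    then show "((- \<i> * of_real z) ^ n * iexp (- (z * (x + h)))) * \<phi> z - ((- \<i> * of_real z) ^ n * iexp (- (z * x))) * \<phi> z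
        - h *\<^sub>R (((- \<i> * of_real z) ^ Suc n * iexp (- (z * x))) * \<phi> z) = ?g z * \<phi> z"
      by (simp only: scaleR_conv_of_real power_Suc of_real_mult of_real_minus) (simp add: algebra_simps)
  qed
  finally have eq: "fourier n (x + h) - fourier n x - h *\<^sub>R fourier (Suc n) x = (LINT z|lborel. ?g z * \<phi> z)" .
  have "norm (LINT z|lborel. ?g z * \<phi> z) \<le> h\<^sup>2 / 2 * C * (LINT z|lborel. \<bar>z\<bar> ^ (n + 2) * exp (- c * \<bar>z\<bar>))"
  proof (rule int_weight(2))
    show "norm (?g z) \<le> h\<^sup>2 / 2 * \<bar>z\<bar> ^ (n + 2)" for z
    proof -
      have "norm (?g z) \<le> 1 * \<bar>z\<bar> ^ n * ((- (z * h))\<^sup>2 / 2)"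
        unfolding norm_mult[of "_ * _" "_ - _"] by (intro mult_mono norm_fourier_kernel norm_iexp_minus2) auto
      also have "\<dots> = h\<^sup>2 / 2 * \<bar>z\<bar> ^ (n + 2)" by (simp add: power_mult_distrib power_add power2_eq_square)
      finally show ?thesis .
    qed
  qed measurable
  then show "norm (fourier n (x + h) - fourier n x - h *\<^sub>R fourier (Suc n) x)
    \<le> (C / 2 * (LINT z|lborel. \<bar>z\<bar> ^ (n + 2) * exp (- c * \<bar>z\<bar>))) * h\<^sup>2"
    unfolding eq by (simp add: mult_ac)
qed

definition pdf :: "real \<Rightarrow> real" where
  "pdf x = Re (fourier 0 x) / (2 * pi)"

lemma deriv_pdf: "(deriv ^^ n) pdf = (\<lambda>x. Re (fourier n x) / (2 * pi))"
proof (induction n)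
  case (Suc n)
  have "((\<lambda>x. Re (fourier n x) / (2 * pi)) has_real_derivative Re (fourier (Suc n) x) / (2 * pi)) (at x)" for x
    by (intro DERIV_cdivide has_field_derivative_Re fourier_deriv)
  then show ?case by (auto simp: Suc intro!: DERIV_imp_deriv)
qed (simp add: pdf_def fun_eq_iff)

lemma pdf_Cb_infinity: "pdf \<in> Cb_infinity"
  unfolding Cb_infinity_def mem_Collect_eq deriv_pdf
proof (intro allI conjI)
  fix n x
  have "((\<lambda>x. Re (fourier n x) / (2 * pi)) has_real_derivative Re (fourier (Suc n) x) / (2 * pi)) (at x)"
    by (intro DERIV_cdivide has_field_derivative_Re fourier_deriv)
  then show "(\<lambda>x. Re (fourier n x) / (2 * pi)) differentiable at x"
    unfolding differentiable_def has_field_derivative_def by blast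
  show "bounded (range (\<lambda>x. Re (fourier n x) / (2 * pi)))"
  proof (rule boundedI)
    fix y assume "y \<in> range (\<lambda>x. Re (fourier n x) / (2 * pi))"
    then obtain x where "y = Re (fourier n x) / (2 * pi)" by auto
    then have "norm y = \<bar>Re (fourier n x)\<bar> / (2 * pi)" by simp
    also have "\<dots> \<le> 1 * C * (LINT z|lborel. \<bar>z\<bar> ^ n * exp (- c * \<bar>z\<bar>)) / (2 * pi)"
      by (intro divide_right_mono order_trans[OF abs_Re_le_cmod fourier_bounded]) simp
    finally show "norm y \<le> 1 * C * (LINT z|lborel. \<bar>z\<bar> ^ n * exp (- c * \<bar>z\<bar>)) / (2 * pi)" .
  qed
qed

text \<open>The integral of e^(- i z y) over y from 0 to x, with the removable singularity at z = 0
  filled in. Differences of it in x are the kernel of Levy's inversion formula.\<close>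

definition prim_kernel :: "real \<Rightarrow> real \<Rightarrow> complex" where
  "prim_kernel x z = (if z = 0 then of_real x else (1 - iexp (- (z * x))) / (\<i> * of_real z))"

lemma prim_kernel_measurable [measurable]: "prim_kernel x \<in> borel_measurable borel"
  unfolding prim_kernel_def by measurable

lemma prim_kernel_bound: "norm (prim_kernel x z) \<le> \<bar>x\<bar> * \<bar>z\<bar> ^ 0"
proof (cases "z = 0")
  case False
  have "norm (iexp (- (z * x)) - 1) \<le> \<bar>z * x\<bar>"
    using iexp_approx1[of "- (z * x)" 0] by simp
  then show ?thesis using False by (simp add: prim_kernel_def norm_divide norm_mult norm_minus_commute field_simps abs_mult)
qed (simp add: prim_kernel_def)

definition prim :: "real \<Rightarrow> complex" where
  "prim x = (LINT z|lborel. prim_kernel x z * \<phi> z)"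

lemma int_prim: "integrable lborel (\<lambda>z. prim_kernel x z * \<phi> z)"
  by (rule int_weight(1)[OF _ prim_kernel_bound]) measurable

lemma prim_deriv: "(prim has_vector_derivative fourier 0 x) (at x)"
proof (rule quadratic_bound_imp_vector_derivative)
  fix h :: real
  let ?g = "\<lambda>z. prim_kernel (x + h) z - prim_kernel x z - h *\<^sub>R ((- \<i> * of_real z) ^ 0 * iexp (- (z * x)))"
  have "prim (x + h) - prim x - h *\<^sub>R fourier 0 x
    = (LINT z|lborel. prim_kernel (x + h) z * \<phi> z - prim_kernel x z * \<phi> z - h *\<^sub>R ((- \<i> * of_real z) ^ 0 * iexp (- (z * x)) * \<phi> z))"
    using integral_diff3[OF int_prim[of "x + h"] int_prim[of x] integrable_scaleR_right[OF int_fourier[of 0 x], of h]]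
    unfolding fourier_def prim_def integral_scaleR_right by (rule sym)
  also have "\<dots> = (LINT z|lborel. ?g z * \<phi> z)"
    by (simp add: algebra_simps)
  finally have eq: "prim (x + h) - prim x - h *\<^sub>R fourier 0 x = (LINT z|lborel. ?g z * \<phi> z)" .
  have "norm (LINT z|lborel. ?g z * \<phi> z) \<le> h\<^sup>2 / 2 * C * (LINT z|lborel. \<bar>z\<bar> ^ 1 * exp (- c * \<bar>z\<bar>))"
  proof (rule int_weight(2))
    show "norm (?g z) \<le> h\<^sup>2 / 2 * \<bar>z\<bar> ^ 1" for z
    proof (cases "z = 0")
      case False
      have e: "iexp (- (z * (x + h))) = iexp (- (z * x)) * iexp (- (z * h))"
        by (simp add: mult_exp_exp ring_distribs)
      have "?g z = - iexp (- (z * x)) * (iexp (- (z * h)) - 1 - \<i> * of_real (- (z * h))) / (\<i> * of_real z)"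
        using False unfolding prim_kernel_def e scaleR_conv_of_real by (simp add: field_simps)
      also have "norm \<dots> = norm (iexp (- (z * h)) - 1 - \<i> * of_real (- (z * h))) / \<bar>z\<bar>"
        by (simp add: norm_mult norm_divide)
      also have "\<dots> \<le> ((- (z * h))\<^sup>2 / 2) / \<bar>z\<bar>" by (intro divide_right_mono norm_iexp_minus2) auto
      also have "\<dots> = h\<^sup>2 / 2 * \<bar>z\<bar> ^ 1" using False by (simp add: power_mult_distrib power2_eq_square field_simps)
      finally show ?thesis .
    qed (simp add: prim_kernel_def scaleR_conv_of_real)
  qed measurable
  then show "norm (prim (x + h) - prim x - h *\<^sub>R fourier 0 x)
    \<le> (C / 2 * (LINT z|lborel. \<bar>z\<bar> ^ 1 * exp (- c * \<bar>z\<bar>))) * h\<^sup>2"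
    unfolding eq by (simp add: mult_ac)
qed

lemma deriv_rprim: "((\<lambda>x. Re (prim x) / (2 * pi)) has_real_derivative pdf x) (at x)"
  unfolding pdf_def by (intro DERIV_cdivide has_field_derivative_Re prim_deriv)

text \<open>Levy's inversion formula expresses the mass of half-open intervals without atoms at the
  end points as increments of \<open>prim\<close>, and right continuity extends this to all
  intervals. So the distribution function has derivative \<open>pdf\<close>, nonnegative by
  monotonicity, and the fundamental theorem of calculus identifies the density.\<close>

lemma density_eqI:
  assumes M: "real_distribution M" and char: "\<And>z. char M z = \<phi> z"
  shows "0 \<le> pdf x" and "M = density lborel (\<lambda>x. ennreal (pdf x))"
proof -
  interpret real_distribution M by (rule M)
  let ?P = "\<lambda>x. Re (prim x) / (2 * pi)"
  have cont_pdf: "isCont pdf x" for x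
  proof -
    have "(pdf has_real_derivative Re (fourier 1 x) / (2 * pi)) (at x)"
      unfolding pdf_def using fourier_deriv[of 0] by (intro DERIV_cdivide has_field_derivative_Re) simp
    then show ?thesis by (rule DERIV_isCont)
  qed
  have [measurable]: "pdf \<in> borel_measurable borel"
    by (intro borel_measurable_continuous_onI continuous_at_imp_continuous_on ballI cont_pdf)
  have inv: "measure M {a<..b} = ?P b - ?P a" if "a \<le> b" "measure M {a} = 0" "measure M {b} = 0" for a b
  proof -
    let ?g = "\<lambda>t. prim_kernel b t * \<phi> t - prim_kernel a t * \<phi> t"
    have eq: "(CLBINT t=ereal (real_of_int (- int T))..ereal (real T). (iexp (-(t * a)) - iexp (-(t * b))) / (\<i> * t) * char M t)
       = (LINT w|lborel. indicator {- real T..real T} w *\<^sub>R ?g w)" for T :: nat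
    proof -
      have "(CLBINT t=ereal (real_of_int (- int T))..ereal (real T). (iexp (-(t * a)) - iexp (-(t * b))) / (\<i> * t) * char M t)
        = (LINT t|lborel. indicator {- real T..real T} t *\<^sub>R ((iexp (-(t * a)) - iexp (-(t * b))) / (\<i> * t) * char M t))"
        by (subst interval_integral_Icc) (simp_all add: set_lebesgue_integral_def)
      also have "\<dots> = (LINT w|lborel. indicator {- real T..real T} w *\<^sub>R ?g w)"
      \<comment> \<open>At t = 0 the quotient of the inversion formula is 0 by the convention on
        division, whereas \<open>prim_kernel\<close> has its limit value there.\<close>
      proof (rule integral_discrete_difference[where X = "{0}"])
        fix t :: real assume "t \<notin> {0}"
        then have "(iexp (-(t * a)) - iexp (-(t * b))) / (\<i> * t) = prim_kernel b t - prim_kernel a t"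
          by (simp add: prim_kernel_def flip: diff_divide_distrib)
        then show "indicator {- real T..real T} t *\<^sub>R ((iexp (-(t * a)) - iexp (-(t * b))) / (\<i> * t) * char M t)
          = indicator {- real T..real T} t *\<^sub>R ?g t"
          by (simp only: char left_diff_distrib)
      qed auto
      finally show ?thesis .
    qed
    have lim: "(\<lambda>T. complex_of_real (1 / (2 * pi)) * (LINT w|lborel. indicator {- real T..real T} w *\<^sub>R ?g w)) \<longlonglongrightarrow> complex_of_real (1 / (2 * pi)) * (LINT w|lborel. ?g w)"
      by (intro tendsto_mult tendsto_const integral_symmetric_limit Bochner_Integration.integrable_diff int_prim)
    have "complex_of_real (measure M {a<..b}) = complex_of_real (1 / (2 * pi)) * (LINT w|lborel. ?g w)"
      by (rule LIMSEQ_unique[OF Levy_Inversion[OF that, unfolded eq] lim])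
    also have "\<dots> = (prim b - prim a) / of_real (2 * pi)"
      by (simp add: prim_def int_prim)
    finally have "Re (complex_of_real (measure M {a<..b})) = Re ((prim b - prim a) / of_real (2 * pi))" by simp
    then show ?thesis unfolding Re_divide_of_real by (simp add: diff_divide_distrib)
  qed
  have count: "countable {x. measure M {x} \<noteq> 0}" by (rule countable_support)
  \<comment> \<open>Atoms are countable, so every point is a limit from the right of points without
    mass; right continuity of the distribution function then suffices.\<close>
  have right: "\<exists>s. (\<forall>n. a < s n \<and> measure M {s n} = 0) \<and> s \<longlonglongrightarrow> a" for a
  proof -
    have "\<exists>x. a < x \<and> x < a + 1 / real (Suc n) \<and> measure M {x} = 0" for n
      using open_minus_countable[OF count, of "{a<..<a + 1 / real (Suc n)}"] by auto
    then obtain s where s: "\<And>n. a < s n \<and> s n < a + 1 / real (Suc n) \<and> measure M {s n} = 0" by metis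
    have "(\<lambda>n. a + 1 / real (Suc n)) \<longlonglongrightarrow> a + 0"
      by (intro tendsto_add tendsto_const LIMSEQ_inverse_real_of_nat[unfolded inverse_eq_divide])
    then have "s \<longlonglongrightarrow> a"
      using s by (intro tendsto_sandwich[of "\<lambda>_. a" s sequentially "\<lambda>n. a + 1 / real (Suc n)" a] always_eventually)
        (auto intro: less_imp_le)
    then show ?thesis using s by (intro exI[of _ s]) simp
  qed
  have diff: "cdf M b - cdf M a = ?P b - ?P a" if "a < b" for a b
  proof -
    obtain s where s: "\<And>n. a < s n \<and> measure M {s n} = 0" "s \<longlonglongrightarrow> a" using right by blast
    obtain r where r: "\<And>n. b < r n \<and> measure M {r n} = 0" "r \<longlonglongrightarrow> b" using right by blast
    have cdf_lim: "(\<lambda>n. cdf M (u n)) \<longlonglongrightarrow> cdf M c" if "\<And>n. c < u n" "u \<longlonglongrightarrow> c" for u c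
    proof -
      have "filterlim u (at_right c) sequentially"
        using that by (intro tendsto_imp_filterlim_at_right always_eventually) auto
      with cdf_is_right_cont[of c] show ?thesis
        unfolding continuous_within by (rule filterlim_compose)
    qed
    have P_lim: "(\<lambda>n. ?P (u n)) \<longlonglongrightarrow> ?P c" if "u \<longlonglongrightarrow> c" for u c
      using isCont_tendsto_compose[OF DERIV_isCont[OF deriv_rprim] that] .
    have "\<forall>\<^sub>F n in sequentially. s n < b" using order_tendstoD(2)[OF s(2) that] .
    then have "\<forall>\<^sub>F n in sequentially. cdf M (r n) - cdf M (s n) = ?P (r n) - ?P (s n)"
    proof eventually_elim
      case (elim n)
      then have "s n < r n" using r(1)[of n] by linarith
      then show ?case using inv[of "s n" "r n"] s(1) r(1) by (subst cdf_diff_eq) auto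
    qed
    moreover have "(\<lambda>n. cdf M (r n) - cdf M (s n)) \<longlonglongrightarrow> cdf M b - cdf M a"
      by (intro tendsto_diff cdf_lim s r conjunct1[OF s(1)] conjunct1[OF r(1)])
    ultimately have "(\<lambda>n. ?P (r n) - ?P (s n)) \<longlonglongrightarrow> cdf M b - cdf M a"
      by (rule Lim_transform_eventually[rotated])
    moreover have "(\<lambda>n. ?P (r n) - ?P (s n)) \<longlonglongrightarrow> ?P b - ?P a"
      by (intro tendsto_diff P_lim s r)
    ultimately show ?thesis by (rule LIMSEQ_unique)
  qed
  have nonneg: "0 \<le> pdf x" for x
  proof (rule mono_on_imp_deriv_nonneg[OF _ deriv_rprim])
    show "mono_on UNIV ?P"
    proof (rule mono_onI)
      fix r s :: real assume "r \<le> s"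
      then show "?P r \<le> ?P s"
        using diff[of r s] cdf_nondecreasing[of r s] by (cases "r = s") auto
    qed
  qed simp
  then show "0 \<le> pdf x" .
  show "M = density lborel (\<lambda>x. ennreal (pdf x))"
  proof (rule measure_eqI_lessThan)
    have Ioc: "emeasure M {a<..b} = emeasure (density lborel (\<lambda>x. ennreal (pdf x))) {a<..b}" if "a < b" for a b
    proof -
      have "emeasure (density lborel (\<lambda>x. ennreal (pdf x))) {a<..b} = (\<integral>\<^sup>+x. ennreal (pdf x) * indicator {a<..b} x \<partial>lborel)"
        by (simp add: emeasure_density)
      also have "\<dots> = (\<integral>\<^sup>+x. ennreal (pdf x) * indicator {a..b} x \<partial>lborel)"
        by (intro nn_integral_cong_AE, use AE_lborel_singleton[of a] in eventually_elim) (auto simp: indicator_def)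
      also have "\<dots> = ennreal (?P b - ?P a)"
        using that by (intro nn_integral_FTC_Icc deriv_rprim nonneg) auto
      also have "\<dots> = emeasure M {a<..b}" using that diff[OF that] by (simp add: emeasure_Ioc)
      finally show ?thesis ..
    qed
    fix x :: real
    have U: "{x<..} = (\<Union>n. {x<..x + real (Suc n)})"
    proof (intro equalityI subsetI)
      fix y assume "y \<in> {x<..}"
      moreover obtain n :: nat where "y - x \<le> real n" using real_arch_simple by blast
      ultimately show "y \<in> (\<Union>n. {x<..x + real (Suc n)})" by (intro UN_I[of n]) auto
    qed auto
    have inc: "incseq (\<lambda>n. {x<..x + real (Suc n)})" by (auto simp: incseq_def)
    show "emeasure M {x<..} = emeasure (density lborel (\<lambda>x. ennreal (pdf x))) {x<..}"
    proof -
      have "emeasure M {x<..} = (SUP n. emeasure M {x<..x + real (Suc n)})"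
        unfolding U using inc by (intro SUP_emeasure_incseq[symmetric]) auto
      also have "\<dots> = (SUP n. emeasure (density lborel (\<lambda>x. ennreal (pdf x))) {x<..x + real (Suc n)})"
        using Ioc by (intro SUP_cong) auto
      also have "\<dots> = emeasure (density lborel (\<lambda>x. ennreal (pdf x))) {x<..}"
        unfolding U using inc by (intro SUP_emeasure_incseq) auto
      finally show ?thesis .
    qed
  qed (auto simp: emeasure_eq_measure less_top[symmetric])
qed

end

section \<open>Stochastic integrals\<close>

text \<open>Off the event |X n - Y| > e the two exponentials differ by at most |z| e, on it by at
  most 2.\<close>

lemma char_converges_in_prob:
  assumes "prob_space M" and [measurable]: "\<And>n. X n \<in> borel_measurable M"
    and conv: "converges_in_prob M X Y"
  shows "(\<lambda>n. char (distr M borel (X n)) z) \<longlonglongrightarrow> char (distr M borel Y) z"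
proof -
  interpret prob_space M by fact
  have [measurable]: "Y \<in> borel_measurable M" using conv by (simp add: converges_in_prob_def)
  have char_eq: "char (distr M borel f) z = (LINT \<omega>|M. iexp (z * f \<omega>))" if [measurable]: "f \<in> borel_measurable M" for f
    by (simp add: char_def integral_distr)
  have bound: "norm (char (distr M borel (X n)) z - char (distr M borel Y) z)
      \<le> \<bar>z\<bar> * e + 2 * measure M {\<omega> \<in> space M. \<bar>X n \<omega> - Y \<omega>\<bar> > e}" if "0 < e" for n e
  proof -
    let ?S = "{\<omega> \<in> space M. \<bar>X n \<omega> - Y \<omega>\<bar> > e}"
    have int: "integrable M (\<lambda>\<omega>. iexp (z * f \<omega>))" if [measurable]: "f \<in> borel_measurable M" for f
      by (rule integrable_const_bound[of _ 1]) auto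
    have "char (distr M borel (X n)) z - char (distr M borel Y) z = (LINT \<omega>|M. iexp (z * X n \<omega>) - iexp (z * Y \<omega>))"
      unfolding char_eq[OF assms(2)] char_eq[OF \<open>Y \<in> borel_measurable M\<close>]
      by (rule Bochner_Integration.integral_diff[symmetric, OF int[OF assms(2)] int]) measurable
    then have "norm (char (distr M borel (X n)) z - char (distr M borel Y) z) \<le> (LINT \<omega>|M. norm (iexp (z * X n \<omega>) - iexp (z * Y \<omega>)))"
      by (simp only: integral_norm_bound)
    also have "\<dots> \<le> (LINT \<omega>|M. \<bar>z\<bar> * e + 2 * indicator ?S \<omega>)"
    proof (rule integral_mono)
      show "integrable M (\<lambda>\<omega>. norm (iexp (z * X n \<omega>) - iexp (z * Y \<omega>)))"
        by (intro integrable_norm Bochner_Integration.integrable_diff int) measurable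
      show "integrable M (\<lambda>\<omega>. \<bar>z\<bar> * e + 2 * indicator ?S \<omega>)"
        by (intro Bochner_Integration.integrable_add integrable_mult_right) (auto simp: emeasure_eq_measure)
      fix \<omega> assume "\<omega> \<in> space M"
      show "norm (iexp (z * X n \<omega>) - iexp (z * Y \<omega>)) \<le> \<bar>z\<bar> * e + 2 * indicator ?S \<omega>"
      proof (cases "\<omega> \<in> ?S")
        case True
        have "norm (iexp (z * X n \<omega>) - iexp (z * Y \<omega>)) \<le> norm (iexp (z * X n \<omega>)) + norm (iexp (z * Y \<omega>))"
          by (rule norm_triangle_ineq4)
        also have "\<dots> = 2" by simp
        also have "\<dots> \<le> \<bar>z\<bar> * e + 2" using \<open>0 < e\<close> by simp
        finally show ?thesis using True by simp
      next
        case False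
        then have le: "\<bar>X n \<omega> - Y \<omega>\<bar> \<le> e" using \<open>\<omega> \<in> space M\<close> by auto
        have "iexp (z * X n \<omega>) - iexp (z * Y \<omega>) = iexp (z * Y \<omega>) * (iexp (z * (X n \<omega> - Y \<omega>)) - 1)"
          by (simp add: right_diff_distrib mult_exp_exp)
        also have "norm \<dots> = norm (iexp (z * (X n \<omega> - Y \<omega>)) - 1)" by (simp add: norm_mult)
        also have "\<dots> \<le> \<bar>z * (X n \<omega> - Y \<omega>)\<bar>"
          using iexp_approx1[of "z * (X n \<omega> - Y \<omega>)" 0] by simp
        also have "\<dots> \<le> \<bar>z\<bar> * e" unfolding abs_mult using le by (intro mult_left_mono) auto
        finally show ?thesis using False by simp
      qed
    qed
    also have "\<dots> = \<bar>z\<bar> * e + 2 * measure M ?S"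
      by (subst Bochner_Integration.integral_add) (auto simp: emeasure_eq_measure prob_space)
    finally show ?thesis .
  qed
  show ?thesis
    unfolding LIMSEQ_iff
  proof (intro allI impI)
    fix r :: real assume "0 < r"
    define e where "e = r / (2 * (\<bar>z\<bar> + 1))"
    have e: "0 < e" "\<bar>z\<bar> * e < r / 2" using \<open>0 < r\<close> by (auto simp: e_def field_simps)
    have "(\<lambda>n. measure M {\<omega> \<in> space M. \<bar>X n \<omega> - Y \<omega>\<bar> > e}) \<longlonglongrightarrow> 0"
      using conv e by (auto simp: converges_in_prob_def)
    then obtain N where N: "\<And>n. n \<ge> N \<Longrightarrow> measure M {\<omega> \<in> space M. \<bar>X n \<omega> - Y \<omega>\<bar> > e} < r / 4"
      using order_tendstoD(2)[of "\<lambda>n. measure M {\<omega> \<in> space M. \<bar>X n \<omega> - Y \<omega>\<bar> > e}" 0 sequentially "r / 4"] \<open>0 < r\<close>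
      unfolding eventually_sequentially by auto
    show "\<exists>N. \<forall>n\<ge>N. norm (char (distr M borel (X n)) z - char (distr M borel Y) z) < r"
    proof (intro exI[of _ N] allI impI)
      fix n assume "N \<le> n"
      from bound[OF e(1), of n] N[OF this] e(2)
      show "norm (char (distr M borel (X n)) z - char (distr M borel Y) z) < r" by linarith
    qed
  qed
qed

text \<open>Multiplicative form of the Nikodym convergence theorem, proved by a gliding hump: if no cylinder
  of subsets of \<open>\<nat>\<close> were uniformly Cauchy, nested cylinders would produce a set \<open>J\<close> along
  which \<open>F n J\<close> diverges.\<close>

lemma multiplicative_Nikodym:
  fixes F :: "nat \<Rightarrow> nat set \<Rightarrow> complex"
  assumes mult: "\<And>n J T. J \<inter> T = {} \<Longrightarrow> F n (J \<union> T) = F n J * F n T"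
    and le1: "\<And>n J. norm (F n J) \<le> 1"
    and lim: "\<And>J. (\<lambda>n. F n J) \<longlonglongrightarrow> L J"
    and tail: "\<And>n e. 0 < e \<Longrightarrow> \<exists>m. \<forall>T. T \<subseteq> {m..} \<longrightarrow> norm (F n T - 1) < e"
    and nz: "L UNIV \<noteq> 0"
  shows "(\<lambda>k. L {..<k}) \<longlonglongrightarrow> L UNIV"
proof -
  have L_mult: "L (J \<union> T) = L J * L T" if "J \<inter> T = {}" for J T
  proof (rule LIMSEQ_unique[OF lim])
    show "(\<lambda>n. F n (J \<union> T)) \<longlonglongrightarrow> L J * L T" unfolding mult[OF that] by (intro tendsto_mult lim)
  qed
  have L_le1: "norm (L J) \<le> 1" for J
    by (rule LIMSEQ_le_const2[OF tendsto_norm[OF lim]]) (use le1 in auto)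
  define c where "c = norm (L UNIV)"
  have c: "0 < c" using nz by (simp add: c_def)
  \<comment> \<open>\<open>L UNIV\<close> is the product of \<open>L J\<close> and the value at the
    complement, and both factors have norm at most 1. So no \<open>L J\<close> is small, which
    permits division by \<open>L J0\<close> at the end.\<close>
  have c_le: "c \<le> norm (L J)" for J
  proof -
    have "L UNIV = L J * L (- J)" using L_mult[of J "- J"] by simp
    then have "c = norm (L J) * norm (L (- J))" by (simp add: c_def norm_mult)
    also have "\<dots> \<le> norm (L J) * 1" using L_le1 by (intro mult_left_mono) auto
    finally show ?thesis by simp
  qed
  have cyl: "\<exists>N m J0. J0 \<subseteq> {..<m} \<and> (\<forall>J n n'. J \<inter> {..<m} = J0 \<longrightarrow> N \<le> n \<longrightarrow> N \<le> n' \<longrightarrow> norm (F n J - F n' J) \<le> e)" if e: "0 < e" for e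
  proof (rule ccontr)
    assume "\<not> ?thesis"
    then have neg: "\<And>N m J0. J0 \<subseteq> {..<m} \<Longrightarrow> \<exists>J n n'. J \<inter> {..<m} = J0 \<and> N \<le> n \<and> N \<le> n' \<and> e < norm (F n J - F n' J)"
      by (meson not_le)
    \<comment> \<open>\<open>J'\<close> fixes membership below m'. The oscillation between some two
      indices beyond m then exceeds e / 2 for every set with this trace, however it
      continues.\<close>
    define R where "R m m' J' \<longleftrightarrow> (\<exists>n\<ge>m. \<exists>n'\<ge>m. \<forall>J. J \<inter> {..<m'} = J' \<longrightarrow> e / 2 < norm (F n J - F n' J))" for m m' J'
    have step: "\<exists>m' J0'. m < m' \<and> J0' \<subseteq> {..<m'} \<and> J0' \<inter> {..<m} = J0 \<and> R m m' J0'"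
      if J0: "J0 \<subseteq> {..<m}" for m J0
    proof -
      obtain J n n' where J: "J \<inter> {..<m} = J0" "m \<le> n" "m \<le> n'" "e < norm (F n J - F n' J)"
        using neg[OF J0, of m] by blast
      obtain k1 where k1: "\<And>T. T \<subseteq> {k1..} \<Longrightarrow> norm (F n T - 1) < e / 8" using tail[of "e / 8" n] e by auto
      obtain k2 where k2: "\<And>T. T \<subseteq> {k2..} \<Longrightarrow> norm (F n' T - 1) < e / 8" using tail[of "e / 8" n'] e by auto
      \<comment> \<open>Beyond this point any change of the set alters \<open>F n\<close> and
        \<open>F n'\<close> by less than e / 4 each, so more than e / 2 of the oscillation
        survives.\<close>
      define m' where "m' = Suc (max m (max k1 k2))"
      have near: "norm (F i J - F i J') < e / 4"
        if "J' \<inter> {..<m'} = J \<inter> {..<m'}" "i = n \<or> i = n'" for J' i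
      proof -
        have s: "F i K = F i (K \<inter> {..<m'}) * F i (K - {..<m'})" for K
          using mult[of "K \<inter> {..<m'}" "K - {..<m'}" i] by (metis Int_Diff_disjoint Int_Diff_Un)
        have t: "norm (F i (K - {..<m'}) - 1) < e / 8" for K
        proof -
          have "K - {..<m'} \<subseteq> {k1..}" "K - {..<m'} \<subseteq> {k2..}" by (auto simp: m'_def)
          then show ?thesis using that(2) k1 k2 by blast
        qed
        have "F i J - F i J' = F i (J \<inter> {..<m'}) * ((F i (J - {..<m'}) - 1) - (F i (J' - {..<m'}) - 1))"
          unfolding s[of J] s[of J'] that(1) by (simp add: algebra_simps)
        then have "norm (F i J - F i J') = norm (F i (J \<inter> {..<m'})) * norm ((F i (J - {..<m'}) - 1) - (F i (J' - {..<m'}) - 1))"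
          by (simp add: norm_mult)
        also have "\<dots> \<le> 1 * norm ((F i (J - {..<m'}) - 1) - (F i (J' - {..<m'}) - 1))"
          by (intro mult_right_mono le1) auto
        also have "\<dots> \<le> norm (F i (J - {..<m'}) - 1) + norm (F i (J' - {..<m'}) - 1)"
          unfolding mult_1 by (rule norm_triangle_ineq4)
        also have "\<dots> < e / 4" using t[of J] t[of J'] by linarith
        finally show ?thesis .
      qed
      have "e / 2 < norm (F n J' - F n' J')" if J': "J' \<inter> {..<m'} = J \<inter> {..<m'}" for J'
      proof -
        have "F n J - F n' J = (F n J - F n J') + (F n J' - F n' J') - (F n' J - F n' J')" by simp
        then have "norm (F n J - F n' J) \<le> norm (F n J - F n J') + norm (F n J' - F n' J') + norm (F n' J - F n' J')"
          by (simp only:) (intro order_trans[OF norm_triangle_ineq4] add_right_mono norm_triangle_ineq)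
        then show ?thesis using near[OF J', of n, OF disjI1[OF refl]] near[OF J', of n', OF disjI2[OF refl]] J(4) by linarith
      qed
      then have "R m m' (J \<inter> {..<m'})" unfolding R_def using J(2,3) by blast
      moreover have "m < m'" "J \<inter> {..<m'} \<inter> {..<m} = J0" "J \<inter> {..<m'} \<subseteq> {..<m'}" using J(1) by (auto simp: m'_def)
      ultimately show ?thesis by blast
    qed
    have "\<exists>f :: nat \<Rightarrow> nat \<times> nat set. \<forall>i. (snd (f i) \<subseteq> {..<fst (f i)}) \<and>
       (fst (f i) < fst (f (Suc i)) \<and> snd (f (Suc i)) \<inter> {..<fst (f i)} = snd (f i) \<and> R (fst (f i)) (fst (f (Suc i))) (snd (f (Suc i))))"
    proof (rule dependent_nat_choice)
      show "\<exists>x :: nat \<times> nat set. snd x \<subseteq> {..<fst x}" by (intro exI[of _ "(0, {})"]) auto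
      fix x :: "nat \<times> nat set" and i :: nat assume "snd x \<subseteq> {..<fst x}"
      from step[OF this] obtain m' J0' where "fst x < m'" "J0' \<subseteq> {..<m'}" "J0' \<inter> {..<fst x} = snd x" "R (fst x) m' J0'" by blast
      then show "\<exists>y. snd y \<subseteq> {..<fst y} \<and> fst x < fst y \<and> snd y \<inter> {..<fst x} = snd x \<and> R (fst x) (fst y) (snd y)"
        by (intro exI[of _ "(m', J0')"]) (simp only: fst_conv snd_conv simp_thms)
    qed
    then obtain f :: "nat \<Rightarrow> nat \<times> nat set" where
      f: "\<forall>i. (snd (f i) \<subseteq> {..<fst (f i)}) \<and>
       (fst (f i) < fst (f (Suc i)) \<and> snd (f (Suc i)) \<inter> {..<fst (f i)} = snd (f i) \<and> R (fst (f i)) (fst (f (Suc i))) (snd (f (Suc i))))" ..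
    have f1: "snd (f i) \<subseteq> {..<fst (f i)}" and f2: "fst (f i) < fst (f (Suc i))"
      and f3: "snd (f (Suc i)) \<inter> {..<fst (f i)} = snd (f i)"
      and f4: "R (fst (f i)) (fst (f (Suc i))) (snd (f (Suc i)))" for i
      using spec[OF f, of i] by simp_all
    have mono: "strict_mono (fst \<circ> f)" using f2 by (simp add: strict_mono_Suc_iff)
    have nest: "snd (f (i + k)) \<inter> {..<fst (f i)} = snd (f i)" for i k
    proof (induction k)
      case 0
      then show ?case using f1[of i] by auto
    next
      case (Suc k)
      have "fst (f i) \<le> fst (f (i + k))" using strict_mono_leD[OF mono, of i "i + k"] by simp
      then have "snd (f (i + Suc k)) \<inter> {..<fst (f i)} = (snd (f (Suc (i + k))) \<inter> {..<fst (f (i + k))}) \<inter> {..<fst (f i)}" by auto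
      also have "\<dots> = snd (f i)" unfolding f3 by (rule Suc.IH)
      finally show ?case .
    qed
    \<comment> \<open>\<open>J\<close> has all the prescribed traces, so \<open>F n J\<close>
      oscillates by more than e / 2 at arbitrarily late indices.\<close>
    define J where "J = (\<Union>i. snd (f i))"
    have J: "J \<inter> {..<fst (f i)} = snd (f i)" for i
    proof (intro equalityI subsetI)
      fix x assume "x \<in> J \<inter> {..<fst (f i)}"
      then obtain k where k: "x \<in> snd (f k)" "x < fst (f i)" by (auto simp: J_def)
      show "x \<in> snd (f i)"
      proof (cases "i \<le> k")
        case True
        then show ?thesis using nest[of i "k - i"] k by auto
      next
        case False
        then show ?thesis using nest[of k "i - k"] k f1[of k] by auto
      qed
    next
      fix x assume "x \<in> snd (f i)"
      then show "x \<in> J \<inter> {..<fst (f i)}" using f1[of i] by (auto simp: J_def)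
    qed
    have "Cauchy (\<lambda>n. F n J)" using lim[of J] by (rule LIMSEQ_imp_Cauchy)
    then obtain N where N: "\<And>n n'. N \<le> n \<Longrightarrow> N \<le> n' \<Longrightarrow> norm (F n J - F n' J) < e / 2"
      using CauchyD[OF _ half_gt_zero[OF e]] by blast
    obtain n n' where "fst (f N) \<le> n" "fst (f N) \<le> n'" "e / 2 < norm (F n J - F n' J)"
      using f4[of N] J[of "Suc N"] unfolding R_def by blast
    moreover have "N \<le> fst (f N)" using strict_mono_imp_increasing[OF mono, of N] by simp
    ultimately show False using N[of n n'] by linarith
  qed
  \<comment> \<open>\<open>J0\<close> and \<open>J0 \<union> {k..}\<close> have the same trace below
    m, so the uniform estimate covers both. They are compared at the fixed index N, where far tails
    are near 1, and the factor \<open>L J0\<close> of norm at least c is divided out; the three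
    errors total 3 e < c r.\<close>
  have "(\<lambda>k. L {k..}) \<longlonglongrightarrow> 1"
    unfolding LIMSEQ_iff
  proof (intro allI impI)
    fix r :: real assume r: "0 < r"
    define e where "e = c * r / 4"
    have e: "0 < e" using c r by (simp add: e_def)
    obtain N m J0 where J0: "J0 \<subseteq> {..<m}"
      and J0': "\<And>J n n'. J \<inter> {..<m} = J0 \<Longrightarrow> N \<le> n \<Longrightarrow> N \<le> n' \<Longrightarrow> norm (F n J - F n' J) \<le> e"
      using cyl[OF e] by blast
    have LF: "norm (L J - F n J) \<le> e" if "J \<inter> {..<m} = J0" "N \<le> n" for J n
    proof (rule LIMSEQ_le_const2)
      show "(\<lambda>n'. norm (F n' J - F n J)) \<longlonglongrightarrow> norm (L J - F n J)" by (intro tendsto_intros lim)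
      show "\<exists>N. \<forall>n'\<ge>N. norm (F n' J - F n J) \<le> e" using J0' that by (intro exI[of _ N]) auto
    qed
    obtain k0 where k0: "\<And>T. T \<subseteq> {k0..} \<Longrightarrow> norm (F N T - 1) < e" using tail[OF e, of N] by blast
    show "\<exists>k0. \<forall>k\<ge>k0. norm (L {k..} - 1) < r"
    proof (intro exI[of _ "max m k0"] allI impI)
      fix k assume k: "max m k0 \<le> k"
      have d: "J0 \<inter> {k..} = {}" using J0 k by auto
      have i1: "(J0 \<union> {k..}) \<inter> {..<m} = J0" using J0 k by auto
      have i2: "J0 \<inter> {..<m} = J0" using J0 by auto
      have "L J0 * (L {k..} - 1) = (L (J0 \<union> {k..}) - F N (J0 \<union> {k..})) + F N J0 * (F N {k..} - 1) - (L J0 - F N J0)"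
        unfolding L_mult[OF d] mult[OF d] by (simp add: algebra_simps)
      then have "norm (L J0) * norm (L {k..} - 1) = norm ((L (J0 \<union> {k..}) - F N (J0 \<union> {k..})) + F N J0 * (F N {k..} - 1) - (L J0 - F N J0))"
        by (metis norm_mult)
      also have "\<dots> \<le> norm (L (J0 \<union> {k..}) - F N (J0 \<union> {k..})) + norm (F N J0 * (F N {k..} - 1)) + norm (L J0 - F N J0)"
        by (intro order_trans[OF norm_triangle_ineq4] add_right_mono norm_triangle_ineq)
      also have "\<dots> \<le> e + e + e"
      proof (intro add_mono LF i1 i2 order_refl)
        have "norm (F N J0 * (F N {k..} - 1)) \<le> 1 * e"
          unfolding norm_mult using k0[of "{k..}"] k le1 by (intro mult_mono) auto
        then show "norm (F N J0 * (F N {k..} - 1)) \<le> e" by simp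
      qed
      finally have "norm (L J0) * norm (L {k..} - 1) \<le> 3 * e" by simp
      moreover have "c * norm (L {k..} - 1) \<le> norm (L J0) * norm (L {k..} - 1)" by (intro mult_right_mono c_le) auto
      ultimately have "c * norm (L {k..} - 1) \<le> 3 * e" by linarith
      also have "\<dots> < c * r" using c r by (simp add: e_def)
      finally show "norm (L {k..} - 1) < r" using c by simp
    qed
  qed
  then have "(\<lambda>k. L UNIV / L {k..}) \<longlonglongrightarrow> L UNIV / 1" by (intro tendsto_divide tendsto_const) auto
  moreover have "L UNIV / L {k..} = L {..<k}" for k
  proof -
    have "{..<k} \<inter> {k..} = {}" "{..<k} \<union> {k..} = UNIV" by auto
    then have "L UNIV = L {..<k} * L {k..}" using L_mult[of "{..<k}" "{k..}"] by simp
    moreover have "L {k..} \<noteq> 0" using c_le[of "{k..}"] c by auto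
    ultimately show ?thesis by simp
  qed
  ultimately show ?thesis by simp
qed

lemma bounded_borel_Int: "A \<in> bounded_borel \<Longrightarrow> B \<in> sets borel \<Longrightarrow> B \<inter> A \<in> bounded_borel"
  by (auto simp: bounded_borel_def intro: bounded_subset)

lemma bounded_borel_emeasure: "A \<in> bounded_borel \<Longrightarrow> emeasure lborel A < \<infinity>"
  by (intro emeasure_bounded_finite) (simp add: bounded_borel_def)

text \<open>\<open>psi_double\<close> is 1 - cos (2 y) <= 4 (1 - cos y) integrated against the
  jumps. It takes the place of infinite divisibility in showing that the limiting characteristic
  functions have no zeros.\<close>

locale scattered = prob_space M for M :: "'w measure" +
  fixes \<Lambda> :: "real set \<Rightarrow> 'w \<Rightarrow> real" and \<psi> :: "real \<Rightarrow> complex"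
  assumes scat: "independently_scattered M \<Lambda>"
    and Lambda_Ioc: "\<And>a b z. a < b \<Longrightarrow> char (distr M borel (\<Lambda> {a<..b})) z = exp (of_real (b - a) * \<psi> z)"
    and Lambda_empty: "AE \<omega> in M. \<Lambda> {} \<omega> = 0"
    and psi_cont: "continuous_on UNIV \<psi>" and psi_0 [simp]: "\<psi> 0 = 0"
    and psi_nonpos: "\<And>z. Re (\<psi> z) \<le> 0"
    and psi_double: "\<And>z. 4 * Re (\<psi> z) \<le> Re (\<psi> (2 * z))"
begin

lemma psi_measurable [measurable]: "\<psi> \<in> borel_measurable borel"
  using psi_cont by (rule borel_measurable_continuous_onI)

lemma Lambda_measurable [measurable]: "A \<in> bounded_borel \<Longrightarrow> \<Lambda> A \<in> borel_measurable M"
  using scat by (auto simp: independently_scattered_def)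

lemma char_cong_AE:
  assumes "AE \<omega> in M. X \<omega> = Y \<omega>" "X \<in> borel_measurable M" "Y \<in> borel_measurable M"
  shows "char (distr M borel X) z = char (distr M borel Y) z"
  using distr_cong_AE[of M M borel borel X Y] assms by simp

lemma empty_bounded [simp]: "{} \<in> bounded_borel" by (simp add: bounded_borel_def)

lemma char_Lambda_empty: "char (distr M borel (\<Lambda> {})) z = 1"
proof -
  have "char (distr M borel (\<Lambda> {})) z = char (distr M borel (\<lambda>_. 0)) z"
    by (rule char_cong_AE[OF Lambda_empty]) auto
  also have "\<dots> = 1" by (simp add: char_def integral_distr prob_space del: distr_const)
  finally show ?thesis .
qed

lemma indep_Lambda:
  assumes "range A \<subseteq> bounded_borel" "disjoint_family A"
  shows "indep_vars (\<lambda>_. borel) (\<lambda>n. \<Lambda> (A n)) (UNIV :: nat set)"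
  using scat assms by (auto simp: independently_scattered_def)

lemma char_weighted_sum:
  assumes "range A \<subseteq> bounded_borel" "disjoint_family A"
  shows "char (distr M borel (\<lambda>\<omega>. \<Sum>i<(n::nat). c i * \<Lambda> (A i) \<omega>)) z = (\<Prod>i<n. char (distr M borel (\<Lambda> (A i))) (z * c i))"
proof -
  have "indep_vars (\<lambda>_. borel) (\<lambda>n. \<Lambda> (A n)) {..<n}"
    by (rule indep_vars_subset[OF indep_Lambda[OF assms]]) auto
  then have "indep_vars (\<lambda>_. borel) (\<lambda>i \<omega>. c i * \<Lambda> (A i) \<omega>) {..<n}"
    by (rule indep_vars_compose2) measurable
  from char_distr_sum[OF this, of z]
  have "char (distr M borel (\<lambda>\<omega>. \<Sum>i<n. c i * \<Lambda> (A i) \<omega>)) z = (\<Prod>i<n. char (distr M borel (\<lambda>\<omega>. c i * \<Lambda> (A i) \<omega>)) z)" .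
  also have "\<dots> = (\<Prod>i<n. char (distr M borel (\<Lambda> (A i))) (z * c i))"
  proof (rule prod.cong[OF refl])
    fix i
    have [measurable]: "\<Lambda> (A i) \<in> borel_measurable M" using assms by (intro Lambda_measurable) auto
    show "char (distr M borel (\<lambda>\<omega>. c i * \<Lambda> (A i) \<omega>)) z = char (distr M borel (\<Lambda> (A i))) (z * c i)"
      by (simp add: char_def integral_distr mult.assoc)
  qed
  finally show ?thesis .
qed

lemma char_Lambda_sums:
  assumes A: "range A \<subseteq> bounded_borel" "disjoint_family A" "(\<Union>i::nat. A i) \<in> bounded_borel"
  shows "(\<lambda>n. \<Prod>i<n. char (distr M borel (\<Lambda> (A i))) z) \<longlonglongrightarrow> char (distr M borel (\<Lambda> (\<Union>i. A i))) z"
proof -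
  have [measurable]: "\<Lambda> (A i) \<in> borel_measurable M" for i using A by (intro Lambda_measurable) auto
  have [measurable]: "\<Lambda> (\<Union>i. A i) \<in> borel_measurable M" using A by (intro Lambda_measurable)
  have s: "AE \<omega> in M. (\<lambda>n. \<Lambda> (A n) \<omega>) sums \<Lambda> (\<Union>n. A n) \<omega>"
    using scat A by (auto simp: independently_scattered_def)
  have "(\<lambda>n. LINT \<omega>|M. iexp (z * (\<Sum>i<n. \<Lambda> (A i) \<omega>))) \<longlonglongrightarrow> (LINT \<omega>|M. iexp (z * \<Lambda> (\<Union>i. A i) \<omega>))"
  proof (rule integral_dominated_convergence[where w = "\<lambda>_. 1"])
    show "AE \<omega> in M. (\<lambda>n. iexp (z * (\<Sum>i<n. \<Lambda> (A i) \<omega>))) \<longlonglongrightarrow> iexp (z * \<Lambda> (\<Union>i. A i) \<omega>)"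
      using s
    proof eventually_elim
      case (elim \<omega>)
      then have "(\<lambda>n. z * (\<Sum>i<n. \<Lambda> (A i) \<omega>)) \<longlonglongrightarrow> z * \<Lambda> (\<Union>i. A i) \<omega>"
        unfolding sums_def by (rule tendsto_mult_left)
      then show ?case by (rule isCont_tendsto_compose[OF isCont_iexp])
    qed
  qed auto
  moreover have "(LINT \<omega>|M. iexp (z * (\<Sum>i<n. \<Lambda> (A i) \<omega>))) = (\<Prod>i<n. char (distr M borel (\<Lambda> (A i))) z)" for n
    using char_weighted_sum[OF A(1,2), of "\<lambda>_. 1" n z] by (simp add: char_def integral_distr)
  ultimately show ?thesis by (simp add: char_def integral_distr)
qed

lemma char_Lambda_Un:
  assumes "A \<in> bounded_borel" "B \<in> bounded_borel" "A \<inter> B = {}"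
  shows "char (distr M borel (\<Lambda> (A \<union> B))) z = char (distr M borel (\<Lambda> A)) z * char (distr M borel (\<Lambda> B)) z"
proof -
  let ?C = "binaryset A B"
  have U: "(\<Union>i. ?C i) = A \<union> B" by (rule UN_binaryset_eq)
  have "A \<union> B \<in> bounded_borel" using assms by (auto simp: bounded_borel_def)
  then have lim: "(\<lambda>n. \<Prod>i<n. char (distr M borel (\<Lambda> (?C i))) z) \<longlonglongrightarrow> char (distr M borel (\<Lambda> (\<Union>i. ?C i))) z"
    using assms by (intro char_Lambda_sums) (auto simp: range_binaryset_eq U disjoint_family_on_def binaryset_def)
  \<comment> \<open>After its first two members \<open>binaryset\<close> is constantly empty, and
    the empty set contributes the factor 1, so the products are constant from index 2 on.\<close>
  have "(\<Prod>i<n + 2. char (distr M borel (\<Lambda> (?C i))) z) = char (distr M borel (\<Lambda> A)) z * char (distr M borel (\<Lambda> B)) z" for n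
    by (induction n) (simp_all add: binaryset_def char_Lambda_empty numeral_2_eq_2)
  then have "(\<lambda>n. \<Prod>i<n + 2. char (distr M borel (\<Lambda> (?C i))) z) \<longlonglongrightarrow> char (distr M borel (\<Lambda> A)) z * char (distr M borel (\<Lambda> B)) z"
    by simp
  from LIMSEQ_unique[OF LIMSEQ_ignore_initial_segment[OF lim, of 2] this] show ?thesis by (simp add: U)
qed

text \<open>Dynkin's argument on the intersection-stable half-open intervals. Intersecting with a
  fixed bounded interval keeps complements and countable unions inside the ring on which \<Lambda>
  is controlled.\<close>

lemma char_Lambda_Int:
  assumes "B \<in> sets borel"
  shows "char (distr M borel (\<Lambda> ({-real N<..real N} \<inter> B))) z = exp (of_real (measure lborel ({-real N<..real N} \<inter> B)) * \<psi> z)"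
proof -
  let ?I = "{-real N<..real N}"
  have I: "?I \<in> bounded_borel" by (auto simp: bounded_borel_def intro: bounded_subset[OF bounded_closed_interval[of "- real N" "real N"]])
  have bI: "?I \<inter> A \<in> bounded_borel" if "A \<in> sets borel" for A using bounded_borel_Int[OF I that] by (simp add: Int_commute)
  have fin: "emeasure lborel (?I \<inter> A) \<noteq> \<infinity>" if "A \<in> sets borel" for A
    using bounded_borel_emeasure[OF bI[OF that]] by auto
  have sb: "sets borel = sigma_sets UNIV (range (\<lambda>(a, b). {a<..b::real}))"
    by (subst borel_sigma_sets_Ioc) (rule sets_measure_of, simp)
  have stab: "Int_stable (range (\<lambda>(a, b). {a<..b::real}))"
  proof (rule Int_stableI)
    fix A B assume "A \<in> range (\<lambda>(a, b). {a<..b::real})" "B \<in> range (\<lambda>(a, b). {a<..b::real})"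
    then obtain a b c d where "A = {a<..b}" "B = {c<..d}" by auto
    then have "A \<inter> B = (\<lambda>(a, b). {a<..b}) (max a c, min b d)" by auto
    then show "A \<inter> B \<in> range (\<lambda>(a, b). {a<..b::real})" by blast
  qed
  have pow: "range (\<lambda>(a, b). {a<..b::real}) \<subseteq> Pow UNIV" by simp
  from assms have "B \<in> sigma_sets UNIV (range (\<lambda>(a, b). {a<..b::real}))" by (simp only: sb)
  from stab pow this show ?thesis
  proof (induction B rule: sigma_sets_induct_disjoint)
    case (basic A)
    then obtain a b where A: "A = {a<..b}" by auto
    have e: "?I \<inter> A = {max (- real N) a<..min (real N) b}" by (auto simp: A)
    show ?case
    proof (cases "max (- real N) a < min (real N) b")
      case True
      then show ?thesis unfolding e using Lambda_Ioc[OF True] by simp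
    next
      case False
      then have "?I \<inter> A = {}" unfolding e by (intro greaterThanAtMost_empty) (simp only: not_less)
      then show ?thesis by (simp add: char_Lambda_empty)
    qed
  next
    case empty
    then show ?case by (simp add: char_Lambda_empty)
  next
    case (compl A)
    have A: "A \<in> sets borel" "UNIV - A \<in> sets borel" using compl(1) unfolding sb[symmetric] by (auto simp flip: Compl_eq_Diff_UNIV)
    have U: "(?I \<inter> A) \<union> (?I \<inter> (UNIV - A)) = ?I" "(?I \<inter> A) \<inter> (?I \<inter> (UNIV - A)) = {}" by auto
    have "char (distr M borel (\<Lambda> ?I)) z = exp (of_real (measure lborel ?I) * \<psi> z)"
    proof (cases "N = 0")
      case False
      then show ?thesis using Lambda_Ioc[of "- real N" "real N" z] by simp
    qed (simp add: char_Lambda_empty)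
    also have "measure lborel ?I = measure lborel (?I \<inter> A) + measure lborel (?I \<inter> (UNIV - A))"
      using measure_Union[OF fin[OF A(1)] fin[OF A(2)] _ _ U(2)] A U(1) by simp
    \<comment> \<open>Additivity determines the factor of the complement because the factor of
      \<open>A\<close> is an exponential and can be cancelled.\<close>
    finally have "char (distr M borel (\<Lambda> (?I \<inter> A))) z * char (distr M borel (\<Lambda> (?I \<inter> (UNIV - A)))) z
      = exp (of_real (measure lborel (?I \<inter> A)) * \<psi> z) * exp (of_real (measure lborel (?I \<inter> (UNIV - A))) * \<psi> z)"
      using char_Lambda_Un[OF bI[OF A(1)] bI[OF A(2)] U(2), of z] U(1) by (simp add: ring_distribs exp_add)
    then show ?case using compl(2) by simp
  next
    case (union A)
    have A: "A i \<in> sets borel" for i using union(2) unfolding sb[symmetric] by auto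
    have U: "?I \<inter> (\<Union>i. A i) = (\<Union>i. ?I \<inter> A i)" by auto
    have dis: "disjoint_family (\<lambda>i. ?I \<inter> A i)" using union(1) by (auto simp: disjoint_family_on_def)
    have sUn: "(\<Union>i. A i) \<in> sets borel" using A by auto
    have "(\<lambda>n. \<Prod>i<n. char (distr M borel (\<Lambda> (?I \<inter> A i))) z) \<longlonglongrightarrow> char (distr M borel (\<Lambda> (\<Union>i. ?I \<inter> A i))) z"
      using bI[OF sUn] unfolding U by (intro char_Lambda_sums dis) (auto intro: bI A)
    moreover have "(\<lambda>n. \<Prod>i<n. char (distr M borel (\<Lambda> (?I \<inter> A i))) z) = (\<lambda>n. exp (of_real (\<Sum>i<n. measure lborel (?I \<inter> A i)) * \<psi> z))"
      unfolding union(3) by (simp add: exp_sum[symmetric] sum_distrib_right)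
    moreover have "(\<lambda>n. exp (complex_of_real (\<Sum>i<n. measure lborel (?I \<inter> A i)) * \<psi> z)) \<longlonglongrightarrow> exp (of_real (measure lborel (\<Union>i. ?I \<inter> A i)) * \<psi> z)"
    proof -
      have "(\<lambda>i. measure lborel (?I \<inter> A i)) sums measure lborel (\<Union>i. ?I \<inter> A i)"
        using fin[OF sUn] A unfolding U by (intro measure_UNION dis) auto
      then show ?thesis unfolding sums_def by (intro tendsto_intros)
    qed
    ultimately show ?case unfolding U by (metis LIMSEQ_unique)
  qed
qed

lemma char_Lambda:
  assumes "B \<in> bounded_borel"
  shows "char (distr M borel (\<Lambda> B)) z = exp (of_real (measure lborel B) * \<psi> z)"
proof -
  obtain r where r: "\<And>x. x \<in> B \<Longrightarrow> \<bar>x\<bar> \<le> r" using assms by (auto simp: bounded_borel_def bounded_iff)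
  obtain N :: nat where "r < real N" using reals_Archimedean2 by blast
  then have "{-real N<..real N} \<inter> B = B" using r by force
  then show ?thesis using char_Lambda_Int[of B N z] assms by (simp add: bounded_borel_def)
qed

lemma simple_psi:
  assumes g: "simple_integrand g" and A: "A \<in> sets borel"
  shows "integrable lborel (\<lambda>s. \<psi> (z * g s))"
    and "(LINT s:A|lborel. \<psi> (z * g s)) = (\<Sum>c\<in>range g - {0}. of_real (measure lborel (A \<inter> g -` {c})) * \<psi> (z * c))"
proof -
  let ?R = "range g - {0}"
  have fin: "finite ?R" using g by (simp add: simple_integrand_def)
  have bb: "g -` {c} \<in> bounded_borel" if "c \<in> ?R" for c using g that by (auto simp: simple_integrand_def)
  have meas: "B \<inter> g -` {c} \<in> sets lborel" "emeasure lborel (B \<inter> g -` {c}) < \<infinity>" if "c \<in> ?R" "B \<in> sets borel" for c B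
    using bounded_borel_Int[OF bb[OF that(1)] that(2)] bounded_borel_emeasure[OF bounded_borel_Int[OF bb[OF that(1)] that(2)]]
    by (simp_all add: bounded_borel_def)
  have eq: "indicator B s *\<^sub>R \<psi> (z * g s) = (\<Sum>c\<in>?R. indicator (B \<inter> g -` {c}) s *\<^sub>R \<psi> (z * c))" for s B
  proof (cases "g s = 0 \<or> s \<notin> B")
    case True
    have "(\<Sum>c\<in>?R. indicator (B \<inter> g -` {c}) s *\<^sub>R \<psi> (z * c)) = 0"
    proof (rule sum.neutral, rule ballI)
      fix c assume "c \<in> ?R"
      with True have "s \<notin> B \<inter> g -` {c}" by blast
      then show "indicator (B \<inter> g -` {c}) s *\<^sub>R \<psi> (z * c) = 0" by simp
    qed
    moreover have "indicator B s *\<^sub>R \<psi> (z * g s) = 0" using True by (elim disjE) simp_all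
    ultimately show ?thesis by (simp only:)
  next
    case False
    have "(\<Sum>c\<in>?R. indicator (B \<inter> g -` {c}) s *\<^sub>R \<psi> (z * c)) = (\<Sum>c\<in>?R. if g s = c then \<psi> (z * c) else 0)"
      using False by (intro sum.cong refl) (simp add: indicator_def)
    also have "\<dots> = \<psi> (z * g s)" using False fin by (subst sum.delta') simp_all
    finally show ?thesis using False by simp
  qed
  have int: "integrable lborel (\<lambda>s. indicator (B \<inter> g -` {c}) s *\<^sub>R \<psi> (z * c))" if "c \<in> ?R" "B \<in> sets borel" for c B
    using meas[OF that] by (intro integrable_scaleR_left integrable_real_indicator)
  have "integrable lborel (\<lambda>s. \<Sum>c\<in>?R. indicator (UNIV \<inter> g -` {c}) s *\<^sub>R \<psi> (z * c))"
    by (rule Bochner_Integration.integrable_sum) (rule int, simp_all)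
  then show "integrable lborel (\<lambda>s. \<psi> (z * g s))"
    unfolding eq[symmetric] by simp
  have "(LINT s:A|lborel. \<psi> (z * g s)) = (\<Sum>c\<in>?R. LINT s|lborel. indicator (A \<inter> g -` {c}) s *\<^sub>R \<psi> (z * c))"
    unfolding set_lebesgue_integral_def eq using int[OF _ A] by (intro Bochner_Integration.integral_sum) auto
  also have "\<dots> = (\<Sum>c\<in>?R. of_real (measure lborel (A \<inter> g -` {c})) * \<psi> (z * c))"
  proof (rule sum.cong[OF refl])
    fix c assume "c \<in> ?R"
    then show "(LINT s|lborel. indicator (A \<inter> g -` {c}) s *\<^sub>R \<psi> (z * c)) = of_real (measure lborel (A \<inter> g -` {c})) * \<psi> (z * c)"
      using meas[of c A] A by (subst integral_scaleR_left) (auto simp: scaleR_conv_of_real)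
  qed
  finally show "(LINT s:A|lborel. \<psi> (z * g s)) = (\<Sum>c\<in>?R. of_real (measure lborel (A \<inter> g -` {c})) * \<psi> (z * c))" .
qed

lemma simple_stoch_integral_measurable:
  assumes g: "simple_integrand g" and A: "A \<in> sets borel"
  shows "simple_stoch_integral \<Lambda> A g \<in> borel_measurable M"
  unfolding simple_stoch_integral_def
proof (intro borel_measurable_sum borel_measurable_times borel_measurable_const Lambda_measurable)
  fix c assume "c \<in> range g - {0}"
  then show "A \<inter> g -` {c} \<in> bounded_borel" using g A by (intro bounded_borel_Int) (auto simp: simple_integrand_def)
qed

text \<open>Independence is available for sequences of disjoint sets, so the finitely many nonzero
  levels are numbered by \<open>h\<close> and padded with empty sets.\<close>

lemma char_simple_stoch_integral:
  assumes g: "simple_integrand g" and A: "A \<in> sets borel"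
  shows "char (distr M borel (simple_stoch_integral \<Lambda> A g)) z = exp (LINT s:A|lborel. \<psi> (z * g s))"
proof -
  let ?R = "range g - {0}"
  have fin: "finite ?R" using g by (simp add: simple_integrand_def)
  obtain h where h: "bij_betw h {..<card ?R} ?R" using ex_bij_betw_nat_finite[OF fin] by (auto simp: atLeast0LessThan)
  have hR: "h i \<in> ?R" if "i < card ?R" for i using h that by (auto simp: bij_betw_def)
  define B where "B i = (if i < card ?R then A \<inter> g -` {h i} else {})" for i
  have bB: "B i \<in> bounded_borel" for i
  proof (cases "i < card ?R")
    case True
    then have "g -` {h i} \<in> bounded_borel" using g hR[OF True] by (auto simp: simple_integrand_def)
    then show ?thesis using True A by (simp add: B_def bounded_borel_Int)
  qed (simp add: B_def)
  have rB: "range B \<subseteq> bounded_borel" using bB by blast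
  have dB: "disjoint_family B"
    unfolding disjoint_family_on_def
  proof (intro ballI impI)
    fix i j :: nat assume "i \<noteq> j"
    then have "i < card ?R \<Longrightarrow> j < card ?R \<Longrightarrow> h i \<noteq> h j" using h by (auto simp: bij_betw_def inj_on_def)
    then show "B i \<inter> B j = {}" by (auto simp: B_def)
  qed
  have "simple_stoch_integral \<Lambda> A g = (\<lambda>\<omega>. \<Sum>i<card ?R. h i * \<Lambda> (B i) \<omega>)"
  proof
    fix \<omega>
    have "(\<Sum>i<card ?R. h i * \<Lambda> (B i) \<omega>) = (\<Sum>i<card ?R. h i * \<Lambda> (A \<inter> g -` {h i}) \<omega>)"
      by (intro sum.cong) (auto simp: B_def)
    also have "\<dots> = (\<Sum>c\<in>?R. c * \<Lambda> (A \<inter> g -` {c}) \<omega>)" by (rule sum.reindex_bij_betw[OF h])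
    finally show "simple_stoch_integral \<Lambda> A g \<omega> = (\<Sum>i<card ?R. h i * \<Lambda> (B i) \<omega>)"
      by (simp add: simple_stoch_integral_def)
  qed
  then have "char (distr M borel (simple_stoch_integral \<Lambda> A g)) z = (\<Prod>i<card ?R. char (distr M borel (\<Lambda> (B i))) (z * h i))"
    by (simp only: char_weighted_sum[OF rB dB])
  also have "\<dots> = (\<Prod>i<card ?R. exp (of_real (measure lborel (A \<inter> g -` {h i})) * \<psi> (z * h i)))"
    unfolding char_Lambda[OF bB] by (intro prod.cong) (simp_all add: B_def)
  also have "\<dots> = exp (\<Sum>i<card ?R. of_real (measure lborel (A \<inter> g -` {h i})) * \<psi> (z * h i))"
    by (simp add: exp_sum)
  finally have "char (distr M borel (simple_stoch_integral \<Lambda> A g)) z = exp (\<Sum>i<card ?R. of_real (measure lborel (A \<inter> g -` {h i})) * \<psi> (z * h i))" .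
  then show ?thesis
    unfolding simple_psi(2)[OF g A] sum.reindex_bij_betw[OF h, of "\<lambda>c. of_real (measure lborel (A \<inter> g -` {c})) * \<psi> (z * c)"] .
qed

text \<open>Continuity gives a nonzero value at z / 2^n for some n; the doubling inequality carries
  this up to z in n steps.\<close>

lemma char_nonzero_of_doubling:
  fixes \<phi> :: "real \<Rightarrow> complex"
  assumes cont: "isCont \<phi> 0" and 0: "\<phi> 0 \<noteq> 0" and double: "\<And>z. norm (\<phi> z) ^ 4 \<le> norm (\<phi> (2 * z))"
  shows "\<phi> z \<noteq> 0"
proof -
  have "(\<lambda>n. \<phi> (z / 2 ^ n)) \<longlonglongrightarrow> \<phi> 0"
  proof (rule isCont_tendsto_compose[OF cont])
    show "(\<lambda>n. z / 2 ^ n) \<longlonglongrightarrow> 0" by (rule LIMSEQ_divide_realpow_zero) simp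
  qed
  then have "\<forall>\<^sub>F n in sequentially. \<phi> (z / 2 ^ n) \<noteq> 0" using 0 by (rule tendsto_imp_eventually_ne)
  then obtain n where n: "\<phi> (z / 2 ^ n) \<noteq> 0" by (auto simp: eventually_sequentially)
  have "\<phi> (z / 2 ^ n * 2 ^ k) \<noteq> 0" for k
  proof (induction k)
    case (Suc k)
    then have "0 < norm (\<phi> (z / 2 ^ n * 2 ^ k)) ^ 4" by simp
    also have "\<dots> \<le> norm (\<phi> (2 * (z / 2 ^ n * 2 ^ k)))" by (rule double)
    finally show ?case by (simp add: mult_ac)
  qed (use n in simp)
  from this[of n] show ?thesis by simp
qed

text \<open>On each \<open>B k\<close> the limit in n follows by dominated convergence. Letting k
  grow afterwards exchanges two limits; \<open>multiplicative_Nikodym\<close> justifies this from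
  the convergence over all unions of disjoint pieces, given that the limit over the whole line does
  not vanish.\<close>

lemma char_stoch_limit:
  fixes G :: "nat \<Rightarrow> real \<Rightarrow> real" and g :: "real \<Rightarrow> real"
  assumes G: "\<And>n. simple_integrand (G n)" and ae: "AE s in lborel. (\<lambda>n. G n s) \<longlonglongrightarrow> g s"
    and meas: "\<And>n. G n \<in> borel_measurable borel" "g \<in> borel_measurable borel"
    and conv: "\<And>A. A \<in> sets borel \<Longrightarrow> \<exists>Y. converges_in_prob M (\<lambda>n. simple_stoch_integral \<Lambda> A (G n)) Y"
    and X: "converges_in_prob M (\<lambda>n. simple_stoch_integral \<Lambda> UNIV (G n)) X"
  obtains B where "\<And>k. B k \<in> sets borel" "\<And>k. B k \<subseteq> {- real k..real k}" "incseq B" "AE s in lborel. s \<in> (\<Union>k. B k)"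
    "\<And>k s. s \<in> B k \<Longrightarrow> \<bar>g s\<bar> \<le> real k"
    "\<And>z. (\<lambda>k. exp (LINT s:B k|lborel. \<psi> (z * g s))) \<longlonglongrightarrow> char (distr M borel X) z"
    "\<And>z. char (distr M borel X) z \<noteq> 0"
proof -
  note [measurable] = meas
  \<comment> \<open>The bound is imposed on all approximants at once, which allows dominated
    convergence in n on \<open>B k\<close>. A convergent sequence is bounded, so these sets exhaust
    almost all of the line.\<close>
  define B where "B k = {s \<in> {- real k..real k}. (\<forall>n. \<bar>G n s\<bar> \<le> real k) \<and> (\<lambda>n. G n s) \<longlonglongrightarrow> g s}" for k :: nat
  have B_sets: "B k \<in> sets borel" for k
  proof -
    have "{s \<in> space borel. (\<lambda>n. G n s) \<longlonglongrightarrow> g s} \<in> sets borel" by measurable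
    moreover have "{s \<in> space borel. \<forall>n. \<bar>G n s\<bar> \<le> real k} \<in> sets borel" by measurable
    ultimately have "{- real k..real k} \<inter> ({s \<in> space borel. \<forall>n. \<bar>G n s\<bar> \<le> real k} \<inter> {s \<in> space borel. (\<lambda>n. G n s) \<longlonglongrightarrow> g s}) \<in> sets borel"
      by (intro sets.Int) auto
    also have "{- real k..real k} \<inter> ({s \<in> space borel. \<forall>n. \<bar>G n s\<bar> \<le> real k} \<inter> {s \<in> space borel. (\<lambda>n. G n s) \<longlonglongrightarrow> g s}) = B k"
      by (auto simp: B_def)
    finally show ?thesis .
  qed
  have B_sub: "B k \<subseteq> {- real k..real k}" for k by (auto simp: B_def)
  have B_inc: "incseq B"
  proof (rule incseq_SucI)
    fix k
    have le: "real k \<le> real (Suc k)" by simp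
    show "B k \<subseteq> B (Suc k)"
    proof
      fix s assume s: "s \<in> B k"
      then have "\<forall>n. \<bar>G n s\<bar> \<le> real (Suc k)" using le order_trans unfolding B_def by blast
      moreover have "s \<in> {- real (Suc k)..real (Suc k)}" using s by (auto simp: B_def)
      ultimately show "s \<in> B (Suc k)" using s unfolding B_def by blast
    qed
  qed
  have g_le: "\<bar>g s\<bar> \<le> real k" if "s \<in> B k" for k s
  proof -
    have l: "(\<lambda>n. \<bar>G n s\<bar>) \<longlonglongrightarrow> \<bar>g s\<bar>" using that by (intro tendsto_rabs) (simp add: B_def)
    have "\<forall>n. \<bar>G n s\<bar> \<le> real k" using that by (simp add: B_def)
    then show ?thesis by (intro LIMSEQ_le_const2[OF l]) blast
  qed
  have B_all: "AE s in lborel. s \<in> (\<Union>k. B k)"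
    using ae
  proof eventually_elim
    case (elim s)
    then have "Bseq (\<lambda>n. G n s)" by (intro convergent_imp_Bseq convergentI)
    then obtain K where "\<forall>n. norm (G n s) \<le> K" by (rule BseqE)
    then have K: "\<And>n. \<bar>G n s\<bar> \<le> K" by simp
    obtain k :: nat where "max K \<bar>s\<bar> \<le> real k" using real_arch_simple by blast
    then have "K \<le> real k" "\<bar>s\<bar> \<le> real k" by simp_all
    then have "s \<in> B k" using elim K unfolding B_def by (auto simp: abs_le_iff intro: order_trans)
    then show ?case by blast
  qed
  \<comment> \<open>Disjoint pieces make the exponential of the integral multiplicative in the set
    of indices, the setting of \<open>multiplicative_Nikodym\<close>.\<close>
  define E where "E = disjointed B"
  have E_sets: "E j \<in> sets borel" for j
    using sets.range_disjointed_sets[of B borel] B_sets by (auto simp: E_def)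
  have E_dis: "disjoint_family E" by (simp add: E_def disjoint_family_disjointed)
  have E_un: "(\<Union>j<k. E j) = (if k = 0 then {} else B (k - 1))" for k
  proof (cases k)
    case (Suc m)
    have "(\<Union>j<Suc m. E j) = (\<Union>j<Suc m. B j)"
      unfolding E_def using finite_UN_disjointed_eq[of B "Suc m"] by (simp add: atLeast0LessThan)
    also have "\<dots> = B m" using B_inc by (auto simp: incseq_def lessThan_Suc_atMost)
    finally show ?thesis by (simp add: Suc)
  qed simp
  define S where "S J = (\<Union>j\<in>J. E j)" for J :: "nat set"
  have S_sets: "S J \<in> sets borel" for J using E_sets by (auto simp: S_def)
  define F where "F z n J = exp (LINT s:S J|lborel. \<psi> (z * G n s))" for z n J
  \<comment> \<open>For a general set of indices the limit is only known to exist, hence the choice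
    operator; for initial segments and for \<open>UNIV\<close> it is identified below.\<close>
  define L where "L z J = char (distr M borel (SOME Y. converges_in_prob M (\<lambda>n. simple_stoch_integral \<Lambda> (S J) (G n)) Y)) z" for z J
  have F_char: "F z n J = char (distr M borel (simple_stoch_integral \<Lambda> (S J) (G n))) z" for z n J
    by (simp add: F_def char_simple_stoch_integral G S_sets)
  have lim: "(\<lambda>n. F z n J) \<longlonglongrightarrow> L z J" for z J
  proof -
    have "converges_in_prob M (\<lambda>n. simple_stoch_integral \<Lambda> (S J) (G n)) (SOME Y. converges_in_prob M (\<lambda>n. simple_stoch_integral \<Lambda> (S J) (G n)) Y)"
      by (rule someI_ex[OF conv[OF S_sets]])
    from char_converges_in_prob[OF prob_space_axioms simple_stoch_integral_measurable[OF G S_sets] this]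
    show ?thesis unfolding F_char L_def .
  qed
  have int: "integrable lborel (\<lambda>s. \<psi> (z * G n s))" for z n by (rule simple_psi(1)[OF G, of UNIV]) simp
  have sint: "set_integrable lborel A (\<lambda>s. \<psi> (z * G n s))" if "A \<in> sets borel" for z n A
    unfolding set_integrable_def using that by (intro integrable_mult_indicator int) simp
  have mult: "F z n (J \<union> T) = F z n J * F z n T" if "J \<inter> T = {}" for z n J T
  proof -
    have "S J \<inter> S T = {}"
    proof (rule ccontr)
      assume "S J \<inter> S T \<noteq> {}"
      then obtain x i j where "i \<in> J" "j \<in> T" "x \<in> E i" "x \<in> E j" unfolding S_def by blast
      moreover from this that have "i \<noteq> j" by blast
      ultimately show False using disjoint_family_onD[OF E_dis, of i j] by blast
    qed
    moreover have "S (J \<union> T) = S J \<union> S T" unfolding S_def by (rule UN_Un)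
    ultimately have "(LINT s:S (J \<union> T)|lborel. \<psi> (z * G n s)) = (LINT s:S J|lborel. \<psi> (z * G n s)) + (LINT s:S T|lborel. \<psi> (z * G n s))"
      using set_integral_Un[OF _ sint[OF S_sets] sint[OF S_sets]] by (simp only:)
    then show ?thesis unfolding F_def by (simp only: exp_add)
  qed
  have Re_nonpos: "Re (LINT s:A|lborel. \<psi> (z * G n s)) \<le> 0" if A: "A \<in> sets borel" for A z n
  proof -
    note i = sint[OF A, of z n, unfolded set_integrable_def]
    have "Re (LINT s:A|lborel. \<psi> (z * G n s)) = (LINT s|lborel. Re (indicator A s *\<^sub>R \<psi> (z * G n s)))"
      unfolding set_lebesgue_integral_def by (rule integral_Re[OF i, symmetric])
    also have "\<dots> \<le> (LINT s::real|lborel. 0)"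
    proof (rule integral_mono[OF integrable_Re[OF i]])
      show "Re (indicator A s *\<^sub>R \<psi> (z * G n s)) \<le> 0" for s
        using psi_nonpos[of "z * G n s"] by (simp add: indicator_def)
    qed simp
    also have "\<dots> = 0" by simp
    finally show ?thesis .
  qed
  have le1: "norm (F z n J) \<le> 1" for z n J using Re_nonpos[OF S_sets] by (simp add: F_def)
  have tail: "\<exists>m. \<forall>T. T \<subseteq> {m..} \<longrightarrow> norm (F z n T - 1) < e" if "0 < e" for z n e
  proof -
    have "(\<lambda>m. LINT s|lborel. indicator (S {m..}) s *\<^sub>R norm (\<psi> (z * G n s))) \<longlonglongrightarrow> (LINT s::real|lborel. (0::real))"
    proof (rule integral_dominated_convergence[where w = "\<lambda>s. norm (\<psi> (z * G n s))" and f = "\<lambda>_. 0" and M = lborel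
          and s = "\<lambda>m s. indicator (S {m..}) s *\<^sub>R norm (\<psi> (z * G n s))"])
      show "AE s in lborel. (\<lambda>m. indicator (S {m..}) s *\<^sub>R norm (\<psi> (z * G n s))) \<longlonglongrightarrow> 0"
      proof (intro AE_I2 tendsto_eventually)
        fix s
        show "\<forall>\<^sub>F m in sequentially. indicator (S {m..}) s *\<^sub>R norm (\<psi> (z * G n s)) = 0"
        proof (cases "\<exists>j. s \<in> E j")
          case True
          then obtain j where j: "s \<in> E j" by blast
          have "s \<notin> S {m..}" if "j < m" for m
          proof
            assume "s \<in> S {m..}"
            then obtain i where "m \<le> i" "s \<in> E i" by (auto simp: S_def)
            moreover have "E i \<inter> E j = {}"
              using E_dis \<open>m \<le> i\<close> that by (intro disjoint_family_onD[of E UNIV]) simp_all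
            ultimately show False using j by blast
          qed
          then show ?thesis unfolding eventually_sequentially by (intro exI[of _ "Suc j"]) simp
        next
          case False
          then have "s \<notin> S {m..}" for m by (simp add: S_def)
          then show ?thesis by simp
        qed
      qed
      show "(\<lambda>s. indicator (S {m..}) s *\<^sub>R norm (\<psi> (z * G n s))) \<in> borel_measurable lborel" for m
        using S_sets[of "{m..}"] borel_measurable_integrable[OF int[of z n]]
        by (intro borel_measurable_scaleR borel_measurable_norm borel_measurable_indicator) simp_all
      show "integrable lborel (\<lambda>s. norm (\<psi> (z * G n s)))" by (rule integrable_norm[OF int])
      show "AE s in lborel. norm (indicator (S {m..}) s *\<^sub>R norm (\<psi> (z * G n s))) \<le> norm (\<psi> (z * G n s))" for m
        by (rule AE_I2) (simp add: indicator_def)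
    qed simp
    then have l: "(\<lambda>m. LINT s|lborel. indicator (S {m..}) s *\<^sub>R norm (\<psi> (z * G n s))) \<longlonglongrightarrow> 0" by simp
    have "isCont exp (0::complex)" by simp
    then have "\<exists>d>0. \<forall>w::complex. dist w 0 < d \<longrightarrow> dist (exp w) (exp 0) < e"
      using that unfolding continuous_at_eps_delta by blast
    then obtain d where d: "0 < d" and d': "\<forall>w::complex. dist w 0 < d \<longrightarrow> dist (exp w) (exp 0) < e" by blast
    have dw: "norm (exp w - 1) < e" if "norm w < d" for w :: complex
      using spec[OF d', of w] that by (simp add: dist_norm)
    obtain m where m: "(LINT s|lborel. indicator (S {m..}) s *\<^sub>R norm (\<psi> (z * G n s))) < d"
      using eventually_happens'[OF sequentially_bot order_tendstoD(2)[OF l d]] by blast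
    show ?thesis
    proof (intro exI[of _ m] allI impI)
      fix T assume T: "T \<subseteq> {m..}"
      have h1: "norm (LINT s:S T|lborel. \<psi> (z * G n s)) \<le> (LINT s|lborel. norm (indicator (S T) s *\<^sub>R \<psi> (z * G n s)))"
        unfolding set_lebesgue_integral_def by (rule integral_norm_bound)
      have h2: "(LINT s|lborel. norm (indicator (S T) s *\<^sub>R \<psi> (z * G n s))) \<le> (LINT s|lborel. indicator (S {m..}) s *\<^sub>R norm (\<psi> (z * G n s)))"
      proof (rule integral_mono)
        show "integrable lborel (\<lambda>s. norm (indicator (S T) s *\<^sub>R \<psi> (z * G n s)))"
          using sint[OF S_sets, of T z n] unfolding set_integrable_def by (rule integrable_norm)
        show "integrable lborel (\<lambda>s. indicator (S {m..}) s *\<^sub>R norm (\<psi> (z * G n s)))"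
          using S_sets int by (intro integrable_mult_indicator) auto
        show "norm (indicator (S T) s *\<^sub>R \<psi> (z * G n s)) \<le> indicator (S {m..}) s *\<^sub>R norm (\<psi> (z * G n s))" for s
          using T by (auto simp: indicator_def S_def)
      qed
      show "norm (F z n T - 1) < e" unfolding F_def by (rule dw[OF le_less_trans[OF order_trans[OF h1 h2] m]])
    qed
  qed
  have S_UNIV: "(LINT s:S UNIV|lborel. \<psi> (z * G n s)) = (LINT s:UNIV|lborel. \<psi> (z * G n s))" for z n
    unfolding set_lebesgue_integral_def
  proof (rule integral_cong_AE)
    have SU: "S UNIV = (\<Union>k. B k)" by (simp add: S_def E_def UN_disjointed_eq)
    show "AE s in lborel. indicator (S UNIV) s *\<^sub>R \<psi> (z * G n s) = indicator UNIV s *\<^sub>R \<psi> (z * G n s)"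
      using B_all unfolding SU[symmetric] by eventually_elim simp
  qed (use borel_measurable_integrable[OF sint[OF S_sets, of UNIV z n, unfolded set_integrable_def]]
         borel_measurable_integrable[OF int[of z n]] in simp_all)
  have F_UNIV: "(\<lambda>n. F z n UNIV) \<longlonglongrightarrow> char (distr M borel X) z" for z
    unfolding F_def S_UNIV
    using char_converges_in_prob[OF prob_space_axioms _ X, of z] simple_stoch_integral_measurable[OF G, of UNIV]
    by (simp add: char_simple_stoch_integral G)
  have L_UNIV: "L z UNIV = char (distr M borel X) z" for z using LIMSEQ_unique[OF lim F_UNIV] .
  have Xm: "X \<in> borel_measurable M" using X by (simp add: converges_in_prob_def)
  interpret X: real_distribution "distr M borel X" using Xm by (rule real_distribution_distr)
  \<comment> \<open>\<open>psi_double\<close> gives the doubling inequality for the approximating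
    characteristic functions, and it survives the limit.\<close>
  have nz: "char (distr M borel X) z \<noteq> 0" for z
  proof (rule char_nonzero_of_doubling)
    show "isCont (char (distr M borel X)) 0" by (rule X.isCont_char)
    show "char (distr M borel X) 0 \<noteq> 0" by (simp add: X.char_zero)
    fix z
    show "norm (char (distr M borel X) z) ^ 4 \<le> norm (char (distr M borel X) (2 * z))"
    proof (rule LIMSEQ_le)
      show "(\<lambda>n. norm (F z n UNIV) ^ 4) \<longlonglongrightarrow> norm (char (distr M borel X) z) ^ 4" by (intro tendsto_intros F_UNIV)
      show "(\<lambda>n. norm (F (2 * z) n UNIV)) \<longlonglongrightarrow> norm (char (distr M borel X) (2 * z))" by (intro tendsto_intros F_UNIV)
      have "norm (F z n UNIV) ^ 4 \<le> norm (F (2 * z) n UNIV)" for n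
      proof -
        have "4 * Re (LINT s|lborel. \<psi> (z * G n s)) = (LINT s|lborel. 4 * Re (\<psi> (z * G n s)))"
          using int[of z n] by simp
        also have "\<dots> \<le> (LINT s|lborel. Re (\<psi> (2 * z * G n s)))"
          using int[of z n] int[of "2 * z" n] psi_double[of "z * G n _"]
          by (intro integral_mono integrable_mult_right integrable_Re) (auto simp: mult.assoc)
        also have "\<dots> = Re (LINT s|lborel. \<psi> (2 * z * G n s))" using int[of "2 * z" n] by simp
        finally have "exp (4 * Re (LINT s|lborel. \<psi> (z * G n s))) \<le> exp (Re (LINT s|lborel. \<psi> (2 * z * G n s)))" by simp
        then show ?thesis
          unfolding F_def S_UNIV by (simp add: set_lebesgue_integral_def exp_of_nat_mult[of 4, simplified, symmetric])
      qed
      then show "\<exists>N. \<forall>n\<ge>N. norm (F z n UNIV) ^ 4 \<le> norm (F (2 * z) n UNIV)" by blast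
    qed
  qed
  have "(\<lambda>k. L z {..<k}) \<longlonglongrightarrow> L z UNIV" for z
    by (rule multiplicative_Nikodym[where F = "F z"]) (use mult le1 lim tail nz L_UNIV in auto)
  then have Llim: "(\<lambda>k. L z {..<Suc k}) \<longlonglongrightarrow> char (distr M borel X) z" for z
    unfolding L_UNIV by (rule LIMSEQ_Suc)
  have "L z {..<Suc k} = exp (LINT s:B k|lborel. \<psi> (z * g s))" for z k
  proof (rule LIMSEQ_unique[OF lim])
    have SB: "S {..<Suc k} = B k" using E_un[of "Suc k"] by (simp add: S_def)
    have "(\<lambda>n. LINT s|lborel. indicator (B k) s *\<^sub>R \<psi> (z * G n s)) \<longlonglongrightarrow> (LINT s|lborel. indicator (B k) s *\<^sub>R \<psi> (z * g s))"
    proof -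
      have "compact (\<psi> ` {- (\<bar>z\<bar> * real k)..\<bar>z\<bar> * real k})"
        by (intro compact_continuous_image continuous_on_subset[OF psi_cont]) auto
      then obtain C where C': "\<forall>x\<in>\<psi> ` {- (\<bar>z\<bar> * real k)..\<bar>z\<bar> * real k}. norm x \<le> C"
        by (meson bounded_iff compact_imp_bounded)
      have C: "norm (\<psi> y) \<le> C" if "\<bar>y\<bar> \<le> \<bar>z\<bar> * real k" for y
        using C' that by (auto simp: abs_le_iff)
      have m: "(\<lambda>s. indicator (B k) s *\<^sub>R \<psi> (z * h s)) \<in> borel_measurable lborel" if [measurable]: "h \<in> borel_measurable borel" for h
      proof -
        have [measurable]: "B k \<in> sets borel" by (rule B_sets)
        show ?thesis by measurable
      qed
      show ?thesis
      proof (rule integral_dominated_convergence[where w = "\<lambda>s. indicator (B k) s *\<^sub>R C"])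
        show "integrable lborel (\<lambda>s. indicator (B k) s *\<^sub>R C)"
        proof (rule integrable_scaleR_left, rule integrable_real_indicator)
          show "emeasure lborel (B k) < \<infinity>"
            by (rule emeasure_bounded_finite[OF bounded_subset[OF bounded_closed_interval B_sub]])
          show "B k \<in> sets lborel" using B_sets by simp
        qed
        show "AE s in lborel. (\<lambda>n. indicator (B k) s *\<^sub>R \<psi> (z * G n s)) \<longlonglongrightarrow> indicator (B k) s *\<^sub>R \<psi> (z * g s)"
        proof (rule AE_I2)
          fix s
          show "(\<lambda>n. indicator (B k) s *\<^sub>R \<psi> (z * G n s)) \<longlonglongrightarrow> indicator (B k) s *\<^sub>R \<psi> (z * g s)"
          proof (cases "s \<in> B k")
            case True
            then have "(\<lambda>n. z * G n s) \<longlonglongrightarrow> z * g s" by (intro tendsto_mult_left) (simp add: B_def)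
            moreover have "isCont \<psi> (z * g s)" using psi_cont by (simp add: continuous_on_eq_continuous_at)
            ultimately have "(\<lambda>n. \<psi> (z * G n s)) \<longlonglongrightarrow> \<psi> (z * g s)"
              by (rule isCont_tendsto_compose[rotated])
            then show ?thesis using True by simp
          qed simp
        qed
        show "AE s in lborel. norm (indicator (B k) s *\<^sub>R \<psi> (z * G n s)) \<le> indicator (B k) s *\<^sub>R C" for n
        proof (rule AE_I2)
          fix s
          have "norm (\<psi> (z * G n s)) \<le> C" if "s \<in> B k"
          proof (rule C)
            have "\<bar>G n s\<bar> \<le> real k" using that by (simp add: B_def)
            then show "\<bar>z * G n s\<bar> \<le> \<bar>z\<bar> * real k" unfolding abs_mult by (rule mult_left_mono) simp
          qed
          then show "norm (indicator (B k) s *\<^sub>R \<psi> (z * G n s)) \<le> indicator (B k) s *\<^sub>R C"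
            by (simp add: indicator_def)
        qed
      qed (rule m[OF meas(2)], rule m[OF meas(1)])
    qed
    then have "(\<lambda>n. LINT s:S {..<Suc k}|lborel. \<psi> (z * G n s)) \<longlonglongrightarrow> (LINT s:B k|lborel. \<psi> (z * g s))"
      unfolding SB by (simp only: set_lebesgue_integral_def)
    then show "(\<lambda>n. F z n {..<Suc k}) \<longlonglongrightarrow> exp (LINT s:B k|lborel. \<psi> (z * g s))"
      unfolding F_def by (rule tendsto_exp)
  qed
  then have final: "(\<lambda>k. exp (LINT s:B k|lborel. \<psi> (z * g s))) \<longlonglongrightarrow> char (distr M borel X) z" for z
    using Llim[of z] by (simp only:)
  show ?thesis by (rule that[OF B_sets B_sub B_inc B_all g_le final nz])
qed

end

section \<open>Moments of the Levy measure and the fractional kernel\<close>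

context exp_moments
begin

text \<open>Where \<open>V\<close> is negative, e^(\<xi> V) decreases in \<xi>, but there it is at
  most 1, and the moment at 0 accounts for that part. This bounds even moments on compact ranges of
  \<xi>.\<close>

lemma mom_le_add:
  assumes "even k" "2 \<le> k" "0 \<le> \<xi>" "\<xi> \<le> \<xi>'"
  shows "mom k \<xi> \<le> mom k \<xi>' + mom k 0"
proof -
  have "mom k \<xi> \<le> (LINT x|Q. V x ^ k * exp (\<xi>' * V x) + V x ^ k * exp (0 * V x))"
    unfolding mom_def
  proof (rule integral_mono[OF int_power_exp_real Bochner_Integration.integrable_add[OF int_power_exp_real int_power_exp_real]])
    fix x
    have p: "0 \<le> V x ^ k" using assms(1) by (rule zero_le_even_power)
    have "exp (\<xi> * V x) \<le> exp (\<xi>' * V x) + exp (0 * V x)"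
    proof (cases "0 \<le> V x")
      case True
      then have "exp (\<xi> * V x) \<le> exp (\<xi>' * V x)" using assms by (simp add: mult_right_mono)
      then show ?thesis by (simp add: add_increasing2)
    next
      case False
      then have "exp (\<xi> * V x) \<le> 1" using assms by (simp add: mult_nonneg_nonpos)
      then show ?thesis by (simp add: add_increasing)
    qed
    from mult_left_mono[OF this p]
    show "V x ^ k * exp (\<xi> * V x) \<le> V x ^ k * exp (\<xi>' * V x) + V x ^ k * exp (0 * V x)"
      by (simp only: ring_distribs)
  qed (use assms in simp_all)
  also have "\<dots> = mom k \<xi>' + mom k 0"
    unfolding mom_def by (rule Bochner_Integration.integral_add[OF int_power_exp_real[OF assms(2)] int_power_exp_real[OF assms(2)]])
  finally show ?thesis .
qed

end

locale levy_exp =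
  fixes \<mu> :: "real measure"
  assumes sets_mu [measurable_cong]: "sets \<mu> = sets borel"
    and null_0: "emeasure \<mu> {0} = 0"
    and min_int: "(\<integral>\<^sup>+u. ennreal (min 1 (u\<^sup>2)) \<partial>\<mu>) < \<infinity>"
    and exp_int: "\<And>C::real. (\<integral>\<^sup>+y\<in>{y. 1 \<le> \<bar>y\<bar>}. ennreal (exp (C * y)) \<partial>\<mu>) < \<infinity>"
    and pos_half: "emeasure \<mu> {0<..} > 0"
begin

lemma space_mu [simp]: "space \<mu> = UNIV"
  using sets_eq_imp_space_eq[OF sets_mu] by simp

text \<open>For |u| >= 1 the square costs one more unit in the exponent, and e^(D |u|) <= e^(D u) +
  e^(- D u) with D = |C| + 1 reduces to the signed exponentials of \<open>exp_int\<close>.\<close>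

lemma square_exp_le:
  fixes u C :: real
  shows "u\<^sup>2 * exp (C * \<bar>u\<bar>) \<le> exp \<bar>C\<bar> * min 1 (u\<^sup>2)
    + 2 * (exp ((\<bar>C\<bar> + 1) * u) * indicator {y. 1 \<le> \<bar>y\<bar>} u + exp (- (\<bar>C\<bar> + 1) * u) * indicator {y. 1 \<le> \<bar>y\<bar>} u)"
proof (cases "1 \<le> \<bar>u\<bar>")
  case False
  then have u: "\<bar>u\<bar> \<le> 1" by simp
  have "C * \<bar>u\<bar> \<le> \<bar>C\<bar> * 1" using u by (intro mult_mono) auto
  then have "u\<^sup>2 * exp (C * \<bar>u\<bar>) \<le> u\<^sup>2 * exp \<bar>C\<bar>" by (intro mult_left_mono) auto
  moreover have "u\<^sup>2 \<le> 1" using u by (simp add: abs_square_le_1)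
  ultimately show ?thesis using False by (simp add: mult.commute)
next
  case True
  have "\<bar>u\<bar> ^ 2 * exp (C * \<bar>u\<bar>) \<le> fact 2 / 1 ^ 2 * exp (1 * \<bar>u\<bar>) * exp (C * \<bar>u\<bar>)"
    by (intro mult_right_mono power_le_exp) auto
  also have "\<dots> = 2 * exp ((1 + C) * \<bar>u\<bar>)" by (simp add: mult_exp_exp ring_distribs)
  also have "\<dots> \<le> 2 * exp ((\<bar>C\<bar> + 1) * \<bar>u\<bar>)"
  proof -
    have "(1 + C) * \<bar>u\<bar> \<le> (\<bar>C\<bar> + 1) * \<bar>u\<bar>" by (intro mult_right_mono) auto
    then show ?thesis by simp
  qed
  also have "\<dots> \<le> 2 * (exp ((\<bar>C\<bar> + 1) * u) + exp (- (\<bar>C\<bar> + 1) * u))"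
  proof (cases "0 \<le> u")
    case True
    then have e: "exp ((\<bar>C\<bar> + 1) * \<bar>u\<bar>) = exp ((\<bar>C\<bar> + 1) * u)" by simp
    show ?thesis unfolding e by (rule mult_left_mono[OF add_increasing2[OF exp_ge_zero order_refl]]) simp
  next
    case False
    then have e: "exp ((\<bar>C\<bar> + 1) * \<bar>u\<bar>) = exp (- (\<bar>C\<bar> + 1) * u)" by (simp only: abs_of_neg mult_minus_left mult_minus_right not_le)
    show ?thesis unfolding e by (rule mult_left_mono[OF add_increasing[OF exp_ge_zero order_refl]]) simp
  qed
  finally have "u\<^sup>2 * exp (C * \<bar>u\<bar>) \<le> 2 * (exp ((\<bar>C\<bar> + 1) * u) + exp (- (\<bar>C\<bar> + 1) * u))"
    by (simp only: power2_abs)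
  moreover have "0 \<le> exp \<bar>C\<bar> * min 1 (u\<^sup>2)" by simp
  moreover have "indicator {y. 1 \<le> \<bar>y\<bar>} u = (1::real)" using True by simp
  ultimately show ?thesis by (simp only: mult_1_right)
qed

lemma integrable_square_exp: "integrable \<mu> (\<lambda>u. u\<^sup>2 * exp (C * \<bar>u\<bar>))"
proof (rule integrableI_bounded)
  let ?I = "indicator {y. 1 \<le> \<bar>y\<bar>} :: real \<Rightarrow> ennreal"
  let ?D = "\<bar>C\<bar> + 1"
  have "(\<integral>\<^sup>+u. ennreal (norm (u\<^sup>2 * exp (C * \<bar>u\<bar>))) \<partial>\<mu>) \<le> (\<integral>\<^sup>+u. ennreal (exp \<bar>C\<bar>) * ennreal (min 1 (u\<^sup>2))
      + 2 * (ennreal (exp (?D * u)) * ?I u + ennreal (exp (- ?D * u)) * ?I u) \<partial>\<mu>)"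
  proof (rule nn_integral_mono)
    fix u
    have "ennreal (norm (u\<^sup>2 * exp (C * \<bar>u\<bar>))) \<le> ennreal (exp \<bar>C\<bar> * min 1 (u\<^sup>2)
    + 2 * (exp (?D * u) * indicator {y. 1 \<le> \<bar>y\<bar>} u + exp (- ?D * u) * indicator {y. 1 \<le> \<bar>y\<bar>} u))"
      using square_exp_le[of u C] by (intro ennreal_leI) (simp add: abs_mult)
    also have "\<dots> = ennreal (exp \<bar>C\<bar>) * ennreal (min 1 (u\<^sup>2))
      + 2 * (ennreal (exp (?D * u)) * ?I u + ennreal (exp (- ?D * u)) * ?I u)"
    proof (cases "1 \<le> \<bar>u\<bar>")
      case True
      then have i: "indicator {y. 1 \<le> \<bar>y\<bar>} u = (1::real)" "indicator {y. 1 \<le> \<bar>y\<bar>} u = (1::ennreal)" by simp_all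
      have p: "0 \<le> exp \<bar>C\<bar> * min 1 (u\<^sup>2)" "0 \<le> exp (?D * u)" "0 \<le> exp (- ?D * u)" "0 \<le> min 1 (u\<^sup>2)" by simp_all
      show ?thesis
        unfolding i mult_1_right
        by (subst ennreal_plus[OF p(1)], simp, subst ennreal_mult[OF exp_ge_zero p(4)], subst ennreal_mult, simp, simp add: p)
           (subst ennreal_plus[OF p(2,3)], simp)
    next
      case False
      then have i: "indicator {y. 1 \<le> \<bar>y\<bar>} u = (0::real)" "indicator {y. 1 \<le> \<bar>y\<bar>} u = (0::ennreal)" by simp_all
      show ?thesis unfolding i by (simp add: ennreal_mult)
    qed
    finally show "ennreal (norm (u\<^sup>2 * exp (C * \<bar>u\<bar>))) \<le> ennreal (exp \<bar>C\<bar>) * ennreal (min 1 (u\<^sup>2))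
      + 2 * (ennreal (exp (?D * u)) * ?I u + ennreal (exp (- ?D * u)) * ?I u)" .
  qed
  also have "\<dots> = ennreal (exp \<bar>C\<bar>) * (\<integral>\<^sup>+u. ennreal (min 1 (u\<^sup>2)) \<partial>\<mu>)
      + 2 * ((\<integral>\<^sup>+u. ennreal (exp (?D * u)) * ?I u \<partial>\<mu>) + (\<integral>\<^sup>+u. ennreal (exp (- ?D * u)) * ?I u \<partial>\<mu>))"
    by (simp add: nn_integral_add nn_integral_cmult)
  also have "\<dots> < \<infinity>"
    using min_int exp_int[of ?D] exp_int[of "- ?D"] by (simp add: ennreal_mult_less_top)
  finally show "(\<integral>\<^sup>+u. ennreal (norm (u\<^sup>2 * exp (C * \<bar>u\<bar>))) \<partial>\<mu>) < \<infinity>" .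
qed measurable

sublocale mu: exp_moments \<mu> "\<lambda>u. u"
proof
  show "(\<lambda>u. u) \<in> borel_measurable \<mu>" by measurable
  show "integrable \<mu> (\<lambda>u. u\<^sup>2 * exp (C * \<bar>u\<bar>))" for C by (rule integrable_square_exp)
qed

lemma exp_moment_eq: "exp_moment \<mu> k \<xi> = mu.mom k \<xi>"
  by (simp add: exp_moment_def mu.mom_def)

lemma emeasure_away_from_0:
  assumes "0 < e" "A \<in> sets borel" "\<And>u. u \<in> A \<Longrightarrow> e \<le> \<bar>u\<bar>"
  shows "emeasure \<mu> A < \<infinity>"
proof -
  have e2: "0 < e\<^sup>2" using assms by simp
  have "emeasure \<mu> A = (\<integral>\<^sup>+u. indicator A u \<partial>\<mu>)" using assms by (simp add: sets_mu)
  also have "\<dots> \<le> (\<integral>\<^sup>+u. ennreal (norm (1 / e\<^sup>2 * (u\<^sup>2 * exp (0 * \<bar>u\<bar>)))) \<partial>\<mu>)"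
  proof (rule nn_integral_mono)
    fix u
    show "indicator A u \<le> ennreal (norm (1 / e\<^sup>2 * (u\<^sup>2 * exp (0 * \<bar>u\<bar>))))"
    proof (cases "u \<in> A")
      case True
      have "e\<^sup>2 \<le> u\<^sup>2" using assms(1) assms(3)[OF True] by (metis abs_le_square_iff abs_of_pos)
      then have "1 \<le> 1 / e\<^sup>2 * (u\<^sup>2 * exp (0 * \<bar>u\<bar>))" using e2 by simp
      then show ?thesis using True by (simp add: ennreal_leI[of 1, simplified])
    qed simp
  qed
  also have "\<dots> < \<infinity>"
    using integrable_mult_right[OF integrable_square_exp[of 0], of "1 / e\<^sup>2"] by (simp only: integrable_iff_bounded)
  finally show ?thesis .
qed

text \<open>Wanted for Fubini: {0} is a null set, and the sets |u| >= 1 / (n + 1) have finite mass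
  by Chebyshev's inequality.\<close>

lemma sigma_finite_mu: "sigma_finite_measure \<mu>"
proof
  let ?A = "insert {0} (range (\<lambda>n::nat. {u::real. 1 / real (Suc n) \<le> \<bar>u\<bar>}))"
  have "\<Union>?A = UNIV"
  proof (rule UNIV_eq_I[symmetric])
    fix u :: real
    show "u \<in> \<Union>?A"
    proof (cases "u = 0")
      case False
      then obtain n where "inverse (real (Suc n)) < \<bar>u\<bar>" using reals_Archimedean[of "\<bar>u\<bar>"] by auto
      then have "u \<in> {u::real. 1 / real (Suc n) \<le> \<bar>u\<bar>}" by (simp add: inverse_eq_divide)
      then show ?thesis by blast
    qed simp
  qed
  moreover have "a \<in> sets \<mu> \<and> emeasure \<mu> a \<noteq> \<infinity>" if a: "a \<in> ?A" for a
  proof (cases "a = {0}")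
    case False
    then obtain n where n: "a = {u::real. 1 / real (Suc n) \<le> \<bar>u\<bar>}" using a by blast
    then have s: "a \<in> sets borel" by simp
    have "emeasure \<mu> a < \<infinity>" by (rule emeasure_away_from_0[of "1 / real (Suc n)", OF _ s]) (auto simp: n)
    then show ?thesis using s by (simp add: sets_mu)
  qed (simp add: null_0 sets_mu)
  ultimately show "\<exists>A. countable A \<and> A \<subseteq> sets \<mu> \<and> \<Union> A = space \<mu> \<and> (\<forall>a\<in>A. emeasure \<mu> a \<noteq> \<infinity>)"
    by (intro exI[of _ ?A]) auto
qed

sublocale sigma_finite_measure \<mu> by (rule sigma_finite_mu)

text \<open>The source of every lower bound: the growth of the second moment of \<mu> and both decay
  estimates use just this compact piece of positive jumps.\<close>

lemma pos_interval:
  obtains u0 u1 m where "0 < u0" "u0 \<le> u1" "0 < m" "emeasure \<mu> {u0..u1} = ennreal m"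
proof -
  have "\<exists>n. emeasure \<mu> {1 / real (Suc n)..real (Suc n)} \<noteq> 0"
  proof (rule ccontr)
    assume "\<nexists>n. emeasure \<mu> {1 / real (Suc n)..real (Suc n)} \<noteq> 0"
    then have z: "\<And>n. {1 / real (Suc n)..real (Suc n)} \<in> null_sets \<mu>" by (simp add: null_sets_def sets_mu)
    have "{0<..} = (\<Union>n. {1 / real (Suc n)..real (Suc n)})"
    proof (intro equalityI subsetI)
      fix u :: real assume "u \<in> {0<..}"
      then have u: "0 < u" by simp
      obtain n where n: "inverse (real (Suc n)) < u" using reals_Archimedean[OF u] by blast
      obtain k :: nat where k: "u \<le> real k" using real_arch_simple by blast
      have "1 / real (Suc (max n k)) \<le> 1 / real (Suc n)" by (intro divide_left_mono) auto
      then have "1 / real (Suc (max n k)) \<le> u" using n by (simp add: inverse_eq_divide)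
      moreover have "u \<le> real (Suc (max n k))" using k by simp
      ultimately show "u \<in> (\<Union>n. {1 / real (Suc n)..real (Suc n)})" by (intro UN_I[of "max n k"]) auto
    next
      fix u :: real assume "u \<in> (\<Union>n. {1 / real (Suc n)..real (Suc n)})"
      then obtain n where "1 / real (Suc n) \<le> u" by auto
      moreover have "0 < 1 / real (Suc n)" by simp
      ultimately have "0 < u" by (rule less_le_trans[rotated])
      then show "u \<in> {0<..}" by simp
    qed
    then have "{0<..} \<in> null_sets \<mu>" using null_sets_UN[of "\<lambda>n. {1 / real (Suc n)..real (Suc n)}" \<mu>, OF z] by simp
    then show False using pos_half by (simp add: null_sets_def)
  qed
  then obtain n where n: "emeasure \<mu> {1 / real (Suc n)..real (Suc n)} \<noteq> 0" by blast
  have fin: "emeasure \<mu> {1 / real (Suc n)..real (Suc n)} < \<infinity>"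
  proof (rule emeasure_away_from_0)
    show "0 < 1 / real (Suc n)" by simp
    fix u :: real assume "u \<in> {1 / real (Suc n)..real (Suc n)}"
    then show "1 / real (Suc n) \<le> \<bar>u\<bar>" by auto
  qed simp
  obtain m where m: "0 \<le> m" "emeasure \<mu> {1 / real (Suc n)..real (Suc n)} = ennreal m"
    using fin by (cases "emeasure \<mu> {1 / real (Suc n)..real (Suc n)}") auto
  have "0 < m" using n m by (cases "m = 0") auto
  show ?thesis
  proof (rule that[of "1 / real (Suc n)" "real (Suc n)" m])
    have "1 / real (Suc n) \<le> 1" by simp
    also have "1 \<le> real (Suc n)" by simp
    finally show "1 / real (Suc n) \<le> real (Suc n)" .
  qed (use m \<open>0 < m\<close> in auto)
qed

lemma mom2_lower:
  obtains u0 m where "0 < u0" "0 < m" "\<And>\<xi>. 0 \<le> \<xi> \<Longrightarrow> m * exp (u0 * \<xi>) \<le> mu.mom 2 \<xi>"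
proof -
  obtain u0 u1 m where u: "0 < u0" "u0 \<le> u1" "0 < m" "emeasure \<mu> {u0..u1} = ennreal m" by (rule pos_interval)
  show ?thesis
  proof (rule that[of u0 "u0\<^sup>2 * m"])
    fix \<xi> :: real assume \<xi>: "0 \<le> \<xi>"
    have U: "{u0..u1} \<in> sets \<mu>" "emeasure \<mu> {u0..u1} < \<infinity>" using u by (simp_all add: sets_mu)
    have "measure \<mu> {u0..u1} = m" using u by (simp add: measure_def)
    then have "u0\<^sup>2 * m * exp (u0 * \<xi>) = (LINT u|\<mu>. (u0\<^sup>2 * exp (\<xi> * u0)) * indicator {u0..u1} u)"
      using U by (simp add: mult_ac)
    also have "\<dots> \<le> mu.mom 2 \<xi>"
      unfolding mu.mom_def
    proof (rule integral_mono[OF integrable_mult_right mu.int_power_exp_real])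
      show "integrable \<mu> (indicator {u0..u1} :: real \<Rightarrow> real)" using U by (rule integrable_real_indicator)
      fix u
      show "(u0\<^sup>2 * exp (\<xi> * u0)) * indicator {u0..u1} u \<le> u ^ 2 * exp (\<xi> * u)"
      proof (cases "u \<in> {u0..u1}")
        case True
        have "u0\<^sup>2 * exp (\<xi> * u0) \<le> u\<^sup>2 * exp (\<xi> * u)"
          using True u \<xi> by (intro mult_mono power_mono) (auto intro: mult_left_mono)
        then show ?thesis using True by simp
      qed simp
    qed simp
    finally show "u0\<^sup>2 * m * exp (u0 * \<xi>) \<le> mu.mom 2 \<xi>" .
  qed (use u in auto)
qed

end

section \<open>Elementary inequalities for powers, sine and cosine\<close>

lemma powr_diff_bounds:
  fixes x a :: real
  assumes "0 < x" "0 < a" "a < 1"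
  shows "a * (1 + x) powr (a - 1) \<le> (1 + x) powr a - x powr a"
    and "(1 + x) powr a - x powr a \<le> a * x powr (a - 1)"
proof -
  have "\<exists>z. x < z \<and> z < 1 + x \<and> (1 + x) powr a - x powr a = (1 + x - x) * (a * z powr (a - 1))"
  proof (rule MVT2)
    show "x < 1 + x" by simp
    fix y assume "x \<le> y"
    then have "0 < y" using assms by simp
    then show "((\<lambda>y. y powr a) has_real_derivative a * y powr (a - 1)) (at y)"
      by (rule has_real_derivative_powr)
  qed
  then obtain z where z: "x < z" "z < 1 + x" "(1 + x) powr a - x powr a = a * z powr (a - 1)" by auto
  show "a * (1 + x) powr (a - 1) \<le> (1 + x) powr a - x powr a"
    unfolding z(3) using z assms by (intro mult_left_mono powr_mono2') auto
  show "(1 + x) powr a - x powr a \<le> a * x powr (a - 1)"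
    unfolding z(3) using z assms by (intro mult_left_mono powr_mono2') auto
qed

text \<open>Divide by (1 + x)^a: the fractions 1 / (1 + x) and x / (1 + x) add up to 1, and y <= y^a
  on [0, 1].\<close>

lemma powr_add_one_le:
  fixes x a :: real
  assumes "0 \<le> x" "0 < a" "a < 1"
  shows "(1 + x) powr a \<le> 1 + x powr a"
proof -
  let ?p = "1 / (1 + x)" and ?q = "x / (1 + x)"
  have le: "y \<le> y powr a" if "0 \<le> y" "y \<le> 1" for y :: real
    using powr_mono'[of a 1 y] that assms by (cases "y = 0") auto
  have "?p + ?q = 1" using assms by (simp add: add_divide_distrib[symmetric])
  moreover have "?p \<le> ?p powr a" using assms by (intro le) auto
  moreover have "?q \<le> ?q powr a" using assms by (intro le) auto
  ultimately have "1 \<le> ?p powr a + ?q powr a" by linarith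
  also have "\<dots> = (1 + x powr a) / (1 + x) powr a" using assms by (simp add: powr_divide add_divide_distrib)
  finally show ?thesis using assms by (simp add: le_divide_eq)
qed

text \<open>The constant is 1/2 - 1/6: for |x| <= 1 the cubic remainder |x|^3 / 6 is at most x^2 /
  6.\<close>

lemma one_minus_cos_ge:
  fixes x :: real
  assumes "\<bar>x\<bar> \<le> 1"
  shows "x\<^sup>2 / 3 \<le> 1 - cos x"
proof -
  have "Re (iexp x - 1 - \<i> * x + x\<^sup>2 / 2) \<le> \<bar>x\<bar> ^ 3 / 6"
    using norm_iexp_minus3[of x] complex_Re_le_cmod order_trans by blast
  then have "cos x - 1 + x\<^sup>2 / 2 \<le> \<bar>x\<bar> ^ 3 / 6" by (simp add: Re_exp power2_eq_square)
  also have "\<bar>x\<bar> ^ 3 \<le> x\<^sup>2"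
    using mult_left_mono[OF assms, of "\<bar>x\<bar> * \<bar>x\<bar>"] by (simp add: power3_eq_cube power2_eq_square)
  finally show ?thesis by simp
qed

text \<open>Up to y = 2, write sin y = 2 sin (y/2) cos (y/2) and apply
  \<open>one_minus_cos_ge\<close> at y / 2, whence 12 = 3 * 4. Beyond 2 the bound |sin y| <= 1 is
  less than y / 2.\<close>

lemma abs_sin_le_min:
  fixes y :: real
  assumes "0 < y"
  shows "\<bar>sin y\<bar> \<le> y - y * min (y\<^sup>2) 1 / 12"
proof (cases "y \<le> 2")
  case True
  have h: "\<bar>y / 2\<bar> \<le> 1" using True assms by simp
  have "sin y = 2 * sin (y / 2) * cos (y / 2)" using sin_double[of "y / 2"] by simp
  moreover have "0 \<le> sin y" using True assms pi_gt3 by (intro sin_ge_zero) auto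
  moreover have "sin (y / 2) \<le> y / 2" using sin_x_le_x[of "y / 2"] assms by simp
  moreover have "0 \<le> cos (y / 2)" using True assms pi_gt3 by (intro cos_ge_zero) auto
  ultimately have "\<bar>sin y\<bar> \<le> y * cos (y / 2)"
    by (simp add: mult_right_mono)
  also have "\<dots> \<le> y * (1 - (y / 2)\<^sup>2 / 3)"
    using one_minus_cos_ge[OF h] assms by (intro mult_left_mono) auto
  also have "\<dots> = y - y * y\<^sup>2 / 12" by (simp add: power2_eq_square field_simps)
  also have "\<dots> \<le> y - y * min (y\<^sup>2) 1 / 12"
    using assms by (intro diff_left_mono divide_right_mono mult_left_mono) auto
  finally show ?thesis .
next
  case False
  have "y * min (y\<^sup>2) 1 / 12 \<le> y * 1 / 12" using assms by (intro divide_right_mono mult_left_mono) auto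
  moreover have "\<bar>sin y\<bar> \<le> 1" by simp
  ultimately show ?thesis using False by linarith
qed

section \<open>The fractional kernel: bounds, left tail and self-similarity\<close>

locale frac =
  fixes H :: real
  assumes H_gt: "1/2 < H" and H_lt: "H < 1"
begin

definition a :: real where "a = H - 1/2"

definition c :: real where "c = 1 / Gamma (H + 1/2)"

abbreviation ker :: "real \<Rightarrow> real" where "ker \<equiv> frac_kernel H 1"

lemma a_bounds: "0 < a" "a < 1/2" "a < 1" "a \<noteq> 0" using H_gt H_lt by (auto simp: a_def)

lemma c_pos: "0 < c" using H_gt by (simp add: c_def Gamma_real_pos)

lemma ker_def: "ker s = c * (max (1 - s) 0 powr a - max (- s) 0 powr a)"
  by (simp add: frac_kernel_def c_def a_def)

lemma ker_ge1: "1 \<le> s \<Longrightarrow> ker s = 0"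
  by (simp add: ker_def max_def)

lemma ker_01: "0 \<le> s \<Longrightarrow> s \<le> 1 \<Longrightarrow> ker s = c * (1 - s) powr a"
  by (simp add: ker_def max_def)

lemma ker_neg: "s < 0 \<Longrightarrow> ker s = c * ((1 + (- s)) powr a - (- s) powr a)"
  by (simp add: ker_def max_def)

lemma ker_measurable [measurable]: "frac_kernel H t \<in> borel_measurable borel"
  unfolding frac_kernel_def by measurable

lemma ker_bounds: "0 \<le> ker s" "ker s \<le> c"
proof -
  have "0 \<le> ker s \<and> ker s \<le> c"
  proof (cases "s < 0")
    case True
    have "(- s) powr a \<le> (1 + (- s)) powr a" using True a_bounds by (intro powr_mono2) auto
    moreover have "(1 + (- s)) powr a \<le> 1 + (- s) powr a" using True a_bounds by (intro powr_add_one_le) auto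
    ultimately have "0 \<le> (1 + (- s)) powr a - (- s) powr a" "(1 + (- s)) powr a - (- s) powr a \<le> 1" by linarith+
    then show ?thesis unfolding ker_neg[OF True] using c_pos by (simp only: mult_nonneg_nonneg less_imp_le mult_left_le)
  next
    case False
    show ?thesis
    proof (cases "s \<le> 1")
      case True
      have "(1 - s) powr a \<le> 1 powr a" using True False a_bounds by (intro powr_mono2) auto
      then show ?thesis using True False c_pos by (simp add: ker_01 mult_left_le)
    next
      case False
      then show ?thesis using c_pos by (simp add: ker_ge1)
    qed
  qed
  then show "0 \<le> ker s" "ker s \<le> c" by auto
qed

lemma ker_le_tail: "1 \<le> x \<Longrightarrow> ker (- x) \<le> c * (a * x powr (a - 1))"
  using powr_diff_bounds(2)[of x a] a_bounds c_pos by (simp add: ker_neg)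

lemma ker_ge_tail: "1 \<le> x \<Longrightarrow> c * (a * (2 * x) powr (a - 1)) \<le> ker (- x)"
proof -
  assume x: "1 \<le> x"
  have "(2 * x) powr (a - 1) \<le> (1 + x) powr (a - 1)" using x a_bounds by (intro powr_mono2') auto
  then have "a * (2 * x) powr (a - 1) \<le> a * (1 + x) powr (a - 1)" using a_bounds by (intro mult_left_mono) auto
  also have "\<dots> \<le> (1 + x) powr a - x powr a" using x a_bounds by (intro powr_diff_bounds) auto
  finally show ?thesis using x c_pos by (simp add: ker_neg)
qed

text \<open>The left tail is of order |s|^(a-1), and 2 a - 2 < - 1 says a < 1/2, that is H <
  1.\<close>

lemma ker_square_integrable: "integrable lborel (\<lambda>s. (ker s)\<^sup>2)"
proof -
  have i1: "set_integrable lborel {1..} (\<lambda>x. x powr (2 * a - 2))"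
  proof -
    have "(\<lambda>x. x powr (2 * a - 2)) absolutely_integrable_on {1..}"
      using has_integral_powr_to_inf[of "2 * a - 2" 1] a_bounds
      by (intro nonnegative_absolutely_integrable_1) (auto simp: integrable_on_def)
    then show ?thesis unfolding set_integrable_def by (subst (asm) integrable_completion) auto
  qed
  have i2: "integrable lborel (\<lambda>s. indicator {1..} (- s) *\<^sub>R (- s) powr (2 * a - 2))"
    using lborel_integrable_real_affine[OF i1[unfolded set_integrable_def], of "-1" 0] by simp
  have i3: "integrable lborel (indicator {-1..1} :: real \<Rightarrow> real)" by (rule integrable_real_indicator) auto
  have "integrable lborel (\<lambda>s. c\<^sup>2 * indicator {-1..1} s + (c * a)\<^sup>2 * (indicator {1..} (- s) *\<^sub>R (- s) powr (2 * a - 2)))"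
    by (rule Bochner_Integration.integrable_add[OF integrable_mult_right[OF i3] integrable_mult_right[OF i2]])
  moreover define P where "P s = indicator {1..} (- s) *\<^sub>R (- s) powr (2 * a - 2)" for s :: real
  ultimately have int: "integrable lborel (\<lambda>s. c\<^sup>2 * indicator {-1..1} s + (c * a)\<^sup>2 * P s)" by (simp only:)
  have P: "0 \<le> P s" for s unfolding P_def by (intro scaleR_nonneg_nonneg indicator_pos_le powr_ge_zero)
  have le: "(ker s)\<^sup>2 \<le> c\<^sup>2 * indicator {-1..1} s + (c * a)\<^sup>2 * P s" for s
  proof -
    have P': "0 \<le> (c * a)\<^sup>2 * P s" using P by (intro mult_nonneg_nonneg) auto
    consider "s < -1" | "-1 \<le> s" "s \<le> 1" | "1 < s" by linarith
    then show ?thesis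
    proof cases
      case 1
      have "ker s \<le> c * (a * (- s) powr (a - 1))" using ker_le_tail[of "- s"] 1 by simp
      then have "(ker s)\<^sup>2 \<le> (c * (a * (- s) powr (a - 1)))\<^sup>2" using ker_bounds by (intro power_mono) auto
      also have "\<dots> = (c * a)\<^sup>2 * ((- s) powr (a - 1))\<^sup>2" by (simp add: power_mult_distrib)
      also have "((- s) powr (a - 1))\<^sup>2 = (- s) powr (2 * (a - 1))"
        by (simp only: power2_eq_square powr_add[symmetric] mult_2)
      also have "2 * (a - 1) = 2 * a - 2" by simp
      also have "(- s) powr (2 * a - 2) = P s" using 1 by (simp add: P_def)
      finally show ?thesis using 1 by simp
    next
      case 2
      have "(ker s)\<^sup>2 \<le> c\<^sup>2" using ker_bounds by (intro power_mono) auto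
      moreover have "indicator {-1..1} s = (1::real)" using 2 by simp
      ultimately show ?thesis using P' by (simp only: mult_1_right add_increasing2)
    next
      case 3
      then have "(ker s)\<^sup>2 = 0" by (simp add: ker_ge1)
      moreover have "0 \<le> c\<^sup>2 * indicator {-1..1} s" by simp
      ultimately show ?thesis using P' by linarith
    qed
  qed
  show ?thesis
  proof (rule Bochner_Integration.integrable_bound[OF int])
    show "(\<lambda>s. (ker s)\<^sup>2) \<in> borel_measurable lborel" by simp
    show "AE s in lborel. norm ((ker s)\<^sup>2) \<le> norm (c\<^sup>2 * indicator {-1..1} s + (c * a)\<^sup>2 * P s)"
    proof (rule AE_I2)
      fix s
      have "\<bar>(ker s)\<^sup>2\<bar> = (ker s)\<^sup>2" by simp
      then show "norm ((ker s)\<^sup>2) \<le> norm (c\<^sup>2 * indicator {-1..1} s + (c * a)\<^sup>2 * P s)"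
        unfolding real_norm_def by (simp only:) (rule order_trans[OF le abs_ge_self])
    qed
  qed
qed

text \<open>Self-similarity of degree a = H - 1/2. Together with the change of variable s -> t s it
  reduces every time t to time 1, at the price of a factor t before the exponent and t^a in its
  argument.\<close>

lemma ker_scale:
  assumes "0 < t"
  shows "frac_kernel H t s = t powr a * ker (s / t)"
proof -
  have 1: "max (t - s) 0 = t * max (1 - s / t) 0" using assms by (auto simp: max_def field_simps)
  have 2: "max (- s) 0 = t * max (- (s / t)) 0" using assms by (auto simp: max_def field_simps)
  show ?thesis
    unfolding frac_kernel_def 1 2 a_def[symmetric] using assms by (simp add: powr_mult right_diff_distrib)
qed

lemma integral_scale:
  fixes g :: "real \<Rightarrow> 'b::{banach, second_countable_topology}"
  assumes "0 < t"
  shows "(LINT s|lborel. g (frac_kernel H t s)) = t *\<^sub>R (LINT s|lborel. g (t powr a * ker s))"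
proof -
  have "(LINT s|lborel. g (frac_kernel H t s)) = t *\<^sub>R (LINT s|lborel. g (frac_kernel H t (t * s)))"
    using lborel_integral_real_affine[of t "\<lambda>s. g (frac_kernel H t s)" 0] assms by simp
  moreover have "frac_kernel H t (t * s) = t powr a * ker s" for s
    using ker_scale[OF assms, of "t * s"] assms by simp
  ultimately show ?thesis by (simp only:)
qed

end

section \<open>Decay of the exponent over the product of time and jump size\<close>

locale frac_levy = levy_exp \<mu> + frac H for \<mu> H
begin

sublocale P: pair_sigma_finite lborel \<mu> ..

lemma snd_measurable: "snd \<in> borel_measurable (lborel \<Otimes>\<^sub>M \<mu>)"
proof -
  have "measurable (lborel \<Otimes>\<^sub>M \<mu>) \<mu> = borel_measurable (lborel \<Otimes>\<^sub>M \<mu>)"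
    by (rule measurable_cong_sets[OF refl sets_mu])
  with measurable_snd[of lborel \<mu>] show ?thesis by blast
qed

lemma jump_measurable: "(\<lambda>p. ker (fst p) * snd p) \<in> borel_measurable (lborel \<Otimes>\<^sub>M \<mu>)"
proof -
  have "ker \<in> borel_measurable lborel"
    using ker_measurable[of 1] measurable_cong_sets[OF sets_lborel refl] by blast
  from borel_measurable_times[OF measurable_compose[OF measurable_fst this] snd_measurable]
  show ?thesis .
qed

lemma integrable_product:
  fixes g h :: "real \<Rightarrow> real"
  assumes g: "integrable lborel g" and h: "integrable \<mu> h"
  shows "integrable (lborel \<Otimes>\<^sub>M \<mu>) (\<lambda>p. g (fst p) * h (snd p))"
proof (rule P.Fubini_integrable)
  show "(\<lambda>p. g (fst p) * h (snd p)) \<in> borel_measurable (lborel \<Otimes>\<^sub>M \<mu>)"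
    by (intro borel_measurable_times measurable_compose[OF measurable_fst borel_measurable_integrable[OF g]]
          measurable_compose[OF measurable_snd borel_measurable_integrable[OF h]])
  have eq: "(LINT u|\<mu>. norm (g (fst (s, u)) * h (snd (s, u)))) = \<bar>g s\<bar> * (LINT u|\<mu>. \<bar>h u\<bar>)" for s
    unfolding fst_conv snd_conv real_norm_def abs_mult by (rule integral_mult_right_zero)
  show "integrable lborel (\<lambda>s. LINT u|\<mu>. norm (g (fst (s, u)) * h (snd (s, u))))"
    unfolding eq by (rule integrable_mult_left[OF integrable_abs[OF g]])
  show "AE s in lborel. integrable \<mu> (\<lambda>u. g (fst (s, u)) * h (snd (s, u)))"
  proof (rule AE_I2)
    fix s show "integrable \<mu> (\<lambda>u. g (fst (s, u)) * h (snd (s, u)))"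
      using integrable_mult_right[OF h, of "g s"] by simp
  qed
qed

sublocale Q: exp_moments "lborel \<Otimes>\<^sub>M \<mu>" "\<lambda>p. ker (fst p) * snd p"
proof
  show "(\<lambda>p. ker (fst p) * snd p) \<in> borel_measurable (lborel \<Otimes>\<^sub>M \<mu>)" by (rule jump_measurable)
  fix C :: real
  let ?h = "\<lambda>u. u\<^sup>2 * exp ((\<bar>C\<bar> * c) * \<bar>u\<bar>)"
  show "integrable (lborel \<Otimes>\<^sub>M \<mu>) (\<lambda>p. (ker (fst p) * snd p)\<^sup>2 * exp (C * \<bar>ker (fst p) * snd p\<bar>))"
  proof (rule Bochner_Integration.integrable_bound[OF integrable_product[OF ker_square_integrable integrable_square_exp]])
    show "(\<lambda>p. (ker (fst p) * snd p)\<^sup>2 * exp (C * \<bar>ker (fst p) * snd p\<bar>)) \<in> borel_measurable (lborel \<Otimes>\<^sub>M \<mu>)"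
      by (rule measurable_compose[OF jump_measurable]) simp
    show "AE p in lborel \<Otimes>\<^sub>M \<mu>. norm ((ker (fst p) * snd p)\<^sup>2 * exp (C * \<bar>ker (fst p) * snd p\<bar>))
        \<le> norm ((ker (fst p))\<^sup>2 * ?h (snd p))"
    proof (rule AE_I2)
      fix p :: "real \<times> real"
      have k: "\<bar>ker (fst p)\<bar> \<le> c" using ker_bounds[of "fst p"] by simp
      have "C * \<bar>ker (fst p) * snd p\<bar> \<le> \<bar>C\<bar> * \<bar>ker (fst p) * snd p\<bar>" by (intro mult_right_mono) auto
      also have "\<dots> \<le> \<bar>C\<bar> * (c * \<bar>snd p\<bar>)"
        unfolding abs_mult by (intro mult_left_mono mult_right_mono k abs_ge_zero)
      finally have "exp (C * \<bar>ker (fst p) * snd p\<bar>) \<le> exp ((\<bar>C\<bar> * c) * \<bar>snd p\<bar>)" by (simp add: mult.assoc)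
      then have "(ker (fst p) * snd p)\<^sup>2 * exp (C * \<bar>ker (fst p) * snd p\<bar>) \<le> (ker (fst p) * snd p)\<^sup>2 * exp ((\<bar>C\<bar> * c) * \<bar>snd p\<bar>)"
        by (intro mult_left_mono) auto
      then show "norm ((ker (fst p) * snd p)\<^sup>2 * exp (C * \<bar>ker (fst p) * snd p\<bar>)) \<le> norm ((ker (fst p))\<^sup>2 * ?h (snd p))"
        by (simp only: power_mult_distrib mult.assoc real_norm_def abs_of_nonneg zero_le_mult_iff zero_le_power2 exp_ge_zero simp_thms)
    qed
  qed
qed

lemma Q_cumul: "Q.cumul \<zeta> = (LINT s|lborel. mu.cumul (\<zeta> * of_real (ker s)))"
  unfolding Q.cumul_def mu.cumul_def
  by (subst P.integral_fst'[OF Q.int_cumul, symmetric]) (simp add: mult.assoc)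

lemma mu_cumul_integrable: "integrable lborel (\<lambda>s. mu.cumul (\<zeta> * of_real (ker s)))"
  using P.integrable_fst'[OF Q.int_cumul[of \<zeta>]] unfolding mu.cumul_def by (simp add: mult.assoc)

lemma Q_mom:
  assumes "2 \<le> k"
  shows "Q.mom k \<xi> = (LINT s|lborel. ker s ^ k * mu.mom k (\<xi> * ker s))"
  unfolding Q.mom_def mu.mom_def
  by (subst P.integral_fst'[OF Q.int_power_exp_real[OF assms], symmetric])
     (simp add: power_mult_distrib mult.assoc)

lemma mu_mom_integrable:
  assumes "2 \<le> k"
  shows "integrable lborel (\<lambda>s. ker s ^ k * mu.mom k (\<xi> * ker s))"
  using P.integrable_fst'[OF Q.int_power_exp_real[OF assms, of \<xi>]] unfolding mu.mom_def
  by (simp add: power_mult_distrib mult.assoc)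

text \<open>Tonelli with the jump size outermost, keeping only jumps in [u0, u1]: a lower bound for
  the time integral at each fixed jump size is enough.\<close>

lemma Q_tilted_lower:
  assumes U: "emeasure \<mu> {u0..u1} = ennreal m" "0 < m" and B: "0 \<le> B"
    and le: "\<And>u. u0 \<le> u \<Longrightarrow> u \<le> u1 \<Longrightarrow>
      ennreal B \<le> (\<integral>\<^sup>+s. ennreal (exp (\<xi> * (ker s * u)) * (1 - cos (w * (ker s * u)))) \<partial>lborel)"
  shows "Re (Q.tilted \<xi> w) \<le> - (m * B)"
proof -
  let ?h = "\<lambda>p. exp (\<xi> * (ker (fst p) * snd p)) * (1 - cos (w * (ker (fst p) * snd p)))"
  have hm: "(\<lambda>p. ennreal (?h p)) \<in> borel_measurable (lborel \<Otimes>\<^sub>M \<mu>)"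
    by (rule measurable_compose[OF jump_measurable, of "\<lambda>v. ennreal (exp (\<xi> * v) * (1 - cos (w * v)))"]) simp
  have "ennreal (m * B) = (\<integral>\<^sup>+u. ennreal B * indicator {u0..u1} u \<partial>\<mu>)"
    using U B by (simp add: nn_integral_cmult sets_mu ennreal_mult mult.commute)
  also have "\<dots> \<le> (\<integral>\<^sup>+u. (\<integral>\<^sup>+s. ennreal (?h (s, u)) \<partial>lborel) \<partial>\<mu>)"
  proof (rule nn_integral_mono)
    fix u
    show "ennreal B * indicator {u0..u1} u \<le> (\<integral>\<^sup>+s. ennreal (?h (s, u)) \<partial>lborel)"
      using le[of u] by (cases "u \<in> {u0..u1}") auto
  qed
  also have "\<dots> = (\<integral>\<^sup>+p. ennreal (?h p) \<partial>(lborel \<Otimes>\<^sub>M \<mu>))"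
    by (rule P.nn_integral_snd[OF hm])
  also have "\<dots> = ennreal (LINT p|(lborel \<Otimes>\<^sub>M \<mu>). ?h p)"
    by (intro nn_integral_eq_integral Q.int_one_minus_cos AE_I2 mult_nonneg_nonneg) auto
  also have "\<dots> = ennreal (- Re (Q.tilted \<xi> w))" by (simp only: Q.Re_tilted minus_minus)
  finally show ?thesis
    using Q.Re_tilted_nonpos[of \<xi> w] by (subst (asm) ennreal_le_iff) auto
qed

text \<open>\<open>f0\<close> is the kernel at 1/2, \<open>L0\<close> its drop from the maximum c at
  0 to that value, and \<open>G0\<close> its steepest slope on [0, 1/2], attained at 1/2.\<close>

definition f0 :: real where "f0 = c * (1 / 2) powr a"
definition L0 :: real where "L0 = c - f0"
definition G0 :: real where "G0 = c * a * (1 / 2) powr (a - 1)"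

lemma const_pos: "0 < f0" "0 < L0" "0 < G0"
proof -
  have "(1 / 2 :: real) powr a < 1 powr a" using a_bounds by (intro powr_less_mono2) auto
  then have "c * (1 / 2) powr a < c * 1" using c_pos by (intro mult_strict_left_mono) auto
  then show "0 < L0" by (simp add: L0_def f0_def)
qed (use c_pos a_bounds in \<open>auto simp: f0_def G0_def\<close>)

text \<open>On \<open>[0, 1/2]\<close> the kernel has slope at most \<open>G0\<close>, so inserting the factor \<open>- ker' / G0 \<le> 1\<close>
  turns \<open>1 - cos (x * ker s)\<close> into an exact derivative.\<close>

lemma near_integral:
  assumes x: "x \<noteq> 0" and E: "0 \<le> E"
    and h: "\<And>s. 0 \<le> s \<Longrightarrow> s \<le> 1/2 \<Longrightarrow> E * (1 - cos (x * ker s)) \<le> h s"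
  shows "ennreal (E / G0 * (L0 * min ((\<bar>x\<bar> * L0 / 2)\<^sup>2) 1 / 12)) \<le> (\<integral>\<^sup>+s. ennreal (h s) \<partial>lborel)"
proof -
  define k where "k s = c * (1 - s) powr a" for s
  define k' where "k' s = c * a * (1 - s) powr (a - 1)" for s
  define F where "F s = E / G0 * (- k s + sin (x * k s) / x)" for s
  define f where "f s = E / G0 * (k' s * (1 - cos (x * k s)))" for s
  have k: "(k has_real_derivative - k' s) (at s)" if "s \<le> 1/2" for s
    unfolding k_def k'_def using that by (auto intro!: derivative_eq_intros)
  have F: "(F has_real_derivative f s) (at s)" if "s \<le> 1/2" for s
  proof -
    have "((\<lambda>s. sin (x * k s) / x) has_real_derivative cos (x * k s) * (x * (- k' s)) / x) (at s)"
      by (intro DERIV_cdivide DERIV_fun_sin DERIV_cmult k that)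
    then have "((\<lambda>s. - k s + sin (x * k s) / x) has_real_derivative - (- k' s) + cos (x * k s) * (x * (- k' s)) / x) (at s)"
      by (intro DERIV_add DERIV_minus k that)
    from DERIV_cmult[OF this, of "E / G0"] show ?thesis
      unfolding F_def f_def using x by (simp add: algebra_simps)
  qed
  have k'0: "0 \<le> k' s" "k' s \<le> G0" if "s \<le> 1/2" for s
  proof -
    show "0 \<le> k' s" using c_pos a_bounds by (simp add: k'_def)
    have "(1 - s) powr (a - 1) \<le> (1 / 2) powr (a - 1)" using that a_bounds by (intro powr_mono2') simp_all
    then show "k' s \<le> G0" unfolding k'_def G0_def using c_pos a_bounds by (intro mult_left_mono) simp_all
  qed
  have f0': "0 \<le> f s" if "s \<le> 1/2" for s
  proof -
    have "0 \<le> E / G0" using E const_pos(3) by (rule divide_nonneg_pos)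
    moreover have "0 \<le> k' s * (1 - cos (x * k s))" using k'0(1)[OF that] by (rule mult_nonneg_nonneg) simp
    ultimately show ?thesis unfolding f_def by (rule mult_nonneg_nonneg)
  qed
  have fh: "f s \<le> h s" if "0 \<le> s" "s \<le> 1/2" for s
  proof -
    have ks: "k s = ker s" using ker_01[of s] that by (simp only: k_def)
    have "k' s / G0 \<le> 1" using k'0[OF that(2)] const_pos by simp
    then have "k' s / G0 * (E * (1 - cos (x * ker s))) \<le> 1 * (E * (1 - cos (x * ker s)))"
      using E by (intro mult_right_mono mult_nonneg_nonneg) simp_all
    also have "\<dots> \<le> h s" using h[OF that] by simp
    finally show ?thesis by (simp add: f_def ks mult_ac)
  qed
  have fm: "f \<in> borel_measurable borel"
    unfolding f_def k'_def k_def
    by (intro borel_measurable_times borel_measurable_diff borel_measurable_const powr_real_measurable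
          measurable_compose[OF _ borel_measurable_cos] measurable_ident_sets) simp_all
  have i1: "(\<integral>\<^sup>+s. ennreal (f s) * indicator {0..1/2} s \<partial>lborel) = ennreal (F (1/2) - F 0)"
    by (rule nn_integral_FTC_Icc[OF fm F f0']) simp_all
  have i2: "(\<integral>\<^sup>+s. ennreal (f s) * indicator {0..1/2} s \<partial>lborel) \<le> (\<integral>\<^sup>+s. ennreal (h s) \<partial>lborel)"
  proof (rule nn_integral_mono)
    fix s :: real
    show "ennreal (f s) * indicator {0..1/2} s \<le> ennreal (h s)"
      using ennreal_leI[OF fh[of s]] by (cases "s \<in> {0..1/2}") simp_all
  qed
  have i3: "E / G0 * (L0 * min ((\<bar>x\<bar> * L0 / 2)\<^sup>2) 1 / 12) \<le> F (1/2) - F 0"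
  proof -
    \<comment> \<open>y is half the phase drop across [0, 1/2]. The product formula bounds the
      difference of sines by 2 |sin y|, and \<open>abs_sin_le_min\<close> leaves a definite gain
      over the trivial bound 2 y, which would only give 0.\<close>
    define y where "y = \<bar>x\<bar> * L0 / 2"
    have y: "0 < y" using x const_pos by (simp add: y_def)
    have k0: "k 0 = c" "k (1/2) = f0" by (simp_all add: k_def f0_def)
    have "sin (x * c) - sin (x * f0) = 2 * sin ((x * c - x * f0) / 2) * cos ((x * c + x * f0) / 2)"
      by (rule sin_diff_sin)
    then have "\<bar>sin (x * c) - sin (x * f0)\<bar> = 2 * \<bar>sin (x * L0 / 2)\<bar> * \<bar>cos ((x * c + x * f0) / 2)\<bar>"
      by (simp add: abs_mult L0_def right_diff_distrib)
    also have "\<dots> \<le> 2 * \<bar>sin (x * L0 / 2)\<bar> * 1" by (intro mult_left_mono) auto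
    finally have "\<bar>sin (x * c) - sin (x * f0)\<bar> \<le> 2 * \<bar>sin (x * L0 / 2)\<bar>" by simp
    also have "\<bar>sin (x * L0 / 2)\<bar> = \<bar>sin y\<bar>"
      by (cases "0 \<le> x") (simp_all add: y_def)
    also have "2 * \<bar>sin y\<bar> \<le> 2 * (y - y * min (y\<^sup>2) 1 / 12)"
      using abs_sin_le_min[OF y] by (rule mult_left_mono) simp
    finally have "\<bar>sin (x * c) - sin (x * f0)\<bar> \<le> 2 * (y - y * min (y\<^sup>2) 1 / 12)" .
    then have "\<bar>(sin (x * c) - sin (x * f0)) / x\<bar> \<le> 2 * (y - y * min (y\<^sup>2) 1 / 12) / \<bar>x\<bar>"
      unfolding abs_divide by (intro divide_right_mono) auto
    also have "\<dots> = L0 - L0 * min (y\<^sup>2) 1 / 12" using x by (simp add: y_def field_simps)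
    finally have "L0 * min (y\<^sup>2) 1 / 12 \<le> L0 - (sin (x * c) - sin (x * f0)) / x" by linarith
    then have "E / G0 * (L0 * min (y\<^sup>2) 1 / 12) \<le> E / G0 * (L0 - (sin (x * c) - sin (x * f0)) / x)"
      using E const_pos by (intro mult_left_mono divide_nonneg_pos) auto
    also have "\<dots> = F (1/2) - F 0" unfolding F_def k0 L0_def by (simp add: algebra_simps diff_divide_distrib)
    finally show ?thesis unfolding y_def .
  qed
  show ?thesis by (rule order_trans[OF ennreal_leI[OF i3] i2[unfolded i1]])
qed

text \<open>Far from the origin only the slowly decaying left tail of the kernel matters: on
  \<open>[-2S, -S]\<close> with \<open>S powr (a - 1)\<close> of order \<open>1 / \<bar>x\<bar>\<close> the phase \<open>x * ker s\<close> is of order one.\<close>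

lemma far_integral:
  assumes K: "0 < K" "c * a * u1 \<le> K" and u: "0 < u0" "u0 \<le> u" "u \<le> u1" and w: "1 \<le> K * \<bar>w\<bar>"
    and h: "\<And>s. s \<le> 0 \<Longrightarrow> 1 - cos (w * (ker s * u)) \<le> h s"
  shows "ennreal (\<bar>w\<bar> * (K * ((c * a * 4 powr (a - 1) * u0 / K)\<^sup>2 / 3))) \<le> (\<integral>\<^sup>+s. ennreal (h s) \<partial>lborel)"
proof -
  define y where "y = K * \<bar>w\<bar>"
  \<comment> \<open>Chosen so that S^(a-1) = 1 / y: on [-2S, -S] the kernel is then of order 1 /
    |w|. As the exponent 1 / (1 - a) is at least 1, also S >= y.\<close>
  define S where "S = y powr (1 / (1 - a))"
  have y: "1 \<le> y" using w by (simp add: y_def)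
  have e: "1 \<le> 1 / (1 - a)" using a_bounds by (simp add: le_divide_eq)
  have Sy: "y \<le> S" unfolding S_def using powr_mono[OF e y] y by simp
  have S: "1 \<le> S" using Sy y by linarith
  have "1 / (1 - a) * (a - 1) = -1" using a_bounds by (simp add: field_simps)
  then have Sa: "S powr (a - 1) = 1 / y" unfolding S_def powr_powr using y by (simp add: powr_minus_divide)
  have wy: "\<bar>w\<bar> = y / K" using K by (simp add: y_def)
  define q where "q = (c * a * 4 powr (a - 1) * u0 / K)\<^sup>2 / 3"
  have low: "q \<le> h (- r)" if r: "S \<le> r" "r \<le> 2 * S" for r
  proof -
    have r1: "1 \<le> r" using r S by linarith
    have up: "ker (- r) \<le> c * a / y"
    proof -
      have "ker (- r) \<le> c * (a * r powr (a - 1))" using r1 by (rule ker_le_tail)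
      also have "\<dots> \<le> c * (a * S powr (a - 1))"
        using r S a_bounds c_pos by (intro mult_left_mono powr_mono2') auto
      finally show ?thesis by (simp add: Sa)
    qed
    have dn: "c * a * 4 powr (a - 1) / y \<le> ker (- r)"
    proof -
      have "c * (a * (4 * S) powr (a - 1)) \<le> c * (a * (2 * r) powr (a - 1))"
        using r r1 a_bounds c_pos by (intro mult_left_mono powr_mono2') auto
      also have "\<dots> \<le> ker (- r)" using r1 by (rule ker_ge_tail)
      finally show ?thesis using S by (simp add: powr_mult Sa)
    qed
    define x where "x = w * (ker (- r) * u)"
    have ax: "\<bar>x\<bar> = y / K * (ker (- r) * u)" using u ker_bounds[of "- r"] by (simp add: x_def abs_mult wy)
    have "ker (- r) * u \<le> c * a / y * u1" using up u ker_bounds[of "- r"] a_bounds c_pos y by (intro mult_mono) auto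
    then have "\<bar>x\<bar> \<le> y / K * (c * a / y * u1)" unfolding ax using y K by (intro mult_left_mono) auto
    also have "\<dots> = c * a * u1 / K" using y by simp
    also have "\<dots> \<le> 1" using K by simp
    finally have x1: "\<bar>x\<bar> \<le> 1" .
    have "c * a * 4 powr (a - 1) / y * u0 \<le> ker (- r) * u" using dn u ker_bounds[of "- r"] by (intro mult_mono) auto
    then have "y / K * (c * a * 4 powr (a - 1) / y * u0) \<le> \<bar>x\<bar>" unfolding ax using y K by (intro mult_left_mono) auto
    then have "c * a * 4 powr (a - 1) * u0 / K \<le> \<bar>x\<bar>" using y by simp
    then have "(c * a * 4 powr (a - 1) * u0 / K)\<^sup>2 \<le> \<bar>x\<bar>\<^sup>2"
      using c_pos a_bounds K u by (intro power_mono) auto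
    then have "q \<le> x\<^sup>2 / 3" by (simp add: q_def)
    also have "\<dots> \<le> 1 - cos x" using x1 by (rule one_minus_cos_ge)
    also have "\<dots> \<le> h (- r)" unfolding x_def using r1 by (intro h) auto
    finally show ?thesis .
  qed
  have q0: "0 \<le> q" by (simp add: q_def)
  \<comment> \<open>The interval [-2S, -S] has length S >= y = K |w|, which gives linear growth in
    |w|.\<close>
  have "ennreal (\<bar>w\<bar> * (K * q)) \<le> ennreal (q * S)"
    using mult_left_mono[OF Sy q0] unfolding y_def by (intro ennreal_leI) (simp add: mult_ac)
  also have "\<dots> = (\<integral>\<^sup>+s. ennreal q * indicator {- (2 * S)..- S} s \<partial>lborel)"
    using S q0 by (simp add: nn_integral_cmult ennreal_mult)
  also have "\<dots> \<le> (\<integral>\<^sup>+s. ennreal (h s) \<partial>lborel)"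
  proof (rule nn_integral_mono)
    fix s :: real
    show "ennreal q * indicator {- (2 * S)..- S} s \<le> ennreal (h s)"
      using low[of "- s"] by (cases "s \<in> {- (2 * S)..- S}") (auto intro: ennreal_leI)
  qed
  finally show ?thesis unfolding q_def .
qed

end

context frac_levy
begin

lemma ker_ge_f0: "0 \<le> s \<Longrightarrow> s \<le> 1/2 \<Longrightarrow> f0 \<le> ker s"
proof -
  assume s: "0 \<le> s" "s \<le> 1/2"
  have "(1 / 2) powr a \<le> (1 - s) powr a" using s a_bounds by (intro powr_mono2) simp_all
  then have "c * (1 / 2) powr a \<le> c * (1 - s) powr a" using c_pos by (intro mult_left_mono) simp_all
  then show ?thesis using s by (simp add: ker_01 f0_def)
qed

text \<open>For times in [0, 1/2] and jumps in [u0, u1] the product ker s * u is at least f0 * u0,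
  which becomes the rate d. The profile in w comes from \<open>near_integral\<close>, with the
  constant \<open>\<kappa>\<close> taken out to make it uniform in the jump size.\<close>

lemma near_decay:
  obtains b d where "0 < b" "0 < d"
    "\<And>\<xi> w. 0 \<le> \<xi> \<Longrightarrow> Re (Q.tilted \<xi> w) \<le> - b * exp (d * \<xi>) * min (w\<^sup>2) 1"
proof -
  obtain u0 u1 m where u: "0 < u0" "u0 \<le> u1" "0 < m" "emeasure \<mu> {u0..u1} = ennreal m" by (rule pos_interval)
  define \<kappa> where "\<kappa> = min ((u0 * L0 / 2)\<^sup>2) 1"
  have \<kappa>: "0 < \<kappa>" using u const_pos by (simp add: \<kappa>_def)
  define b where "b = m * (1 / G0 * (L0 * \<kappa> / 12))"
  have b: "0 < b" unfolding b_def using u \<kappa> const_pos by simp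
  show ?thesis
  proof (rule that[OF b])
    show "0 < f0 * u0" using u const_pos by simp
    fix \<xi> w :: real assume \<xi>: "0 \<le> \<xi>"
    show "Re (Q.tilted \<xi> w) \<le> - b * exp (f0 * u0 * \<xi>) * min (w\<^sup>2) 1"
    proof (cases "w = 0")
      case True
      then show ?thesis using Q.Re_tilted_nonpos[of \<xi> w] by simp
    next
      case False
      define E where "E = exp (f0 * u0 * \<xi>)"
      define B where "B = E / G0 * (L0 * (\<kappa> * min (w\<^sup>2) 1) / 12)"
      have E0: "0 \<le> E" "0 \<le> E / G0" using const_pos by (simp_all add: E_def)
      have "Re (Q.tilted \<xi> w) \<le> - (m * B)"
      proof (rule Q_tilted_lower[OF u(4,3)])
        show "0 \<le> B" unfolding B_def using E0 const_pos \<kappa> by simp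
        fix x assume x: "u0 \<le> x" "x \<le> u1"
        have wx: "w * x \<noteq> 0" using False x u by simp
        have "\<kappa> * min (w\<^sup>2) 1 \<le> min ((\<bar>w * x\<bar> * L0 / 2)\<^sup>2) 1"
        proof -
          have "\<kappa> * min (w\<^sup>2) 1 \<le> (u0 * L0 / 2)\<^sup>2 * w\<^sup>2"
            unfolding \<kappa>_def by (intro mult_mono) simp_all
          also have "\<dots> = (\<bar>w\<bar> * u0 * L0 / 2)\<^sup>2" by (simp add: power_mult_distrib power_divide)
          also have "\<dots> \<le> (\<bar>w * x\<bar> * L0 / 2)\<^sup>2"
          proof (rule power_mono)
            have "\<bar>w\<bar> * u0 \<le> \<bar>w * x\<bar>" using x u by (simp add: abs_mult mult_left_mono)
            then show "\<bar>w\<bar> * u0 * L0 / 2 \<le> \<bar>w * x\<bar> * L0 / 2"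
              using const_pos by (intro divide_right_mono mult_right_mono) simp_all
          qed (use u const_pos in simp)
          finally have 1: "\<kappa> * min (w\<^sup>2) 1 \<le> (\<bar>w * x\<bar> * L0 / 2)\<^sup>2" .
          have "\<kappa> * min (w\<^sup>2) 1 \<le> 1 * 1" unfolding \<kappa>_def by (intro mult_mono) simp_all
          with 1 show ?thesis by simp
        qed
        then have "L0 * (\<kappa> * min (w\<^sup>2) 1) / 12 \<le> L0 * min ((\<bar>w * x\<bar> * L0 / 2)\<^sup>2) 1 / 12"
          using const_pos by (intro divide_right_mono mult_left_mono) simp_all
        then have "B \<le> E / G0 * (L0 * min ((\<bar>w * x\<bar> * L0 / 2)\<^sup>2) 1 / 12)"
          unfolding B_def using E0(2) by (rule mult_left_mono)
        then have "ennreal B \<le> ennreal (E / G0 * (L0 * min ((\<bar>w * x\<bar> * L0 / 2)\<^sup>2) 1 / 12))" by (rule ennreal_leI)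
        also have "\<dots> \<le> (\<integral>\<^sup>+s. ennreal (exp (\<xi> * (ker s * x)) * (1 - cos (w * (ker s * x)))) \<partial>lborel)"
        proof (rule near_integral[OF wx E0(1)])
          fix s :: real assume s: "0 \<le> s" "s \<le> 1/2"
          have "f0 * u0 \<le> ker s * x" using ker_ge_f0[OF s] x u const_pos by (intro mult_mono) simp_all
          then have "f0 * u0 * \<xi> \<le> \<xi> * (ker s * x)" using \<xi> by (subst mult.commute) (rule mult_left_mono)
          then have "E \<le> exp (\<xi> * (ker s * x))" by (simp add: E_def)
          then have "E * (1 - cos (w * (ker s * x))) \<le> exp (\<xi> * (ker s * x)) * (1 - cos (w * (ker s * x)))"
            by (rule mult_right_mono) simp
          then show "E * (1 - cos (w * x * ker s)) \<le> exp (\<xi> * (ker s * x)) * (1 - cos (w * (ker s * x)))"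
            by (simp add: mult_ac)
        qed
        finally show "ennreal B \<le> (\<integral>\<^sup>+s. ennreal (exp (\<xi> * (ker s * x)) * (1 - cos (w * (ker s * x)))) \<partial>lborel)" .
      qed
      moreover have "m * B = b * exp (f0 * u0 * \<xi>) * min (w\<^sup>2) 1"
        by (simp add: B_def b_def E_def)
      ultimately show ?thesis by simp
    qed
  qed
qed

text \<open>Kernel and chosen jumps are nonnegative, so tilting by \<xi> >= 0 only enlarges the
  integrand and the bound is uniform in \<xi>. \<open>K = c * a * u1\<close> keeps the phase at most
  1 on the part of the tail used by \<open>far_integral\<close>.\<close>

lemma far_decay:
  obtains b W where "0 < b" "0 < W"
    "\<And>\<xi> w. 0 \<le> \<xi> \<Longrightarrow> W \<le> \<bar>w\<bar> \<Longrightarrow> Re (Q.tilted \<xi> w) \<le> - b * \<bar>w\<bar>"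
proof -
  obtain u0 u1 m where u: "0 < u0" "u0 \<le> u1" "0 < m" "emeasure \<mu> {u0..u1} = ennreal m" by (rule pos_interval)
  define K where "K = c * a * u1"
  have K: "0 < K" unfolding K_def using u c_pos a_bounds by simp
  define q where "q = (c * a * 4 powr (a - 1) * u0 / K)\<^sup>2 / 3"
  have q: "0 < q" unfolding q_def using u c_pos a_bounds K by simp
  show ?thesis
  proof (rule that[of "m * (K * q)" "1 / K"])
    fix \<xi> w :: real assume \<xi>: "0 \<le> \<xi>" and w: "1 / K \<le> \<bar>w\<bar>"
    have w1: "1 \<le> K * \<bar>w\<bar>" using w K by (simp add: divide_le_eq mult.commute)
    have "Re (Q.tilted \<xi> w) \<le> - (m * (\<bar>w\<bar> * (K * q)))"
    proof (rule Q_tilted_lower[OF u(4,3)])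
      show "0 \<le> \<bar>w\<bar> * (K * q)" using K q by simp
      fix x assume x: "u0 \<le> x" "x \<le> u1"
      show "ennreal (\<bar>w\<bar> * (K * q)) \<le> (\<integral>\<^sup>+s. ennreal (exp (\<xi> * (ker s * x)) * (1 - cos (w * (ker s * x)))) \<partial>lborel)"
        unfolding q_def
      proof (rule far_integral[OF K _ u(1) x w1])
        show "c * a * u1 \<le> K" by (simp add: K_def)
        fix s :: real
        have "0 \<le> \<xi> * (ker s * x)" using \<xi> ker_bounds[of s] x u by simp
        then have "1 \<le> exp (\<xi> * (ker s * x))" by simp
        then have "1 * (1 - cos (w * (ker s * x))) \<le> exp (\<xi> * (ker s * x)) * (1 - cos (w * (ker s * x)))"
          by (rule mult_right_mono) simp
        then show "1 - cos (w * (ker s * x)) \<le> exp (\<xi> * (ker s * x)) * (1 - cos (w * (ker s * x)))" by simp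
      qed
    qed
    then show "Re (Q.tilted \<xi> w) \<le> - (m * (K * q)) * \<bar>w\<bar>" by (simp add: mult_ac)
  qed (use u K q in simp_all)
qed

end

section \<open>Transfer of hypotheses 3 and 4 from the Levy measure to the product measure\<close>

locale frac_levy_asym = frac_levy +
  assumes h3: "\<exists>\<gamma>. 0 < \<gamma> \<and> \<gamma> < 1 \<and> ((\<lambda>\<xi>. mu.mom 4 \<xi> / (mu.mom 2 (\<gamma> * \<xi>))\<^sup>2) \<longlongrightarrow> 0) at_top"
    and h4: "((\<lambda>\<xi>. (ln (max (mu.mom 4 \<xi> / mu.mom 2 \<xi>) 1) + ln (ln (mu.mom 2 \<xi>))) / \<xi>) \<longlongrightarrow> 0) at_top"
begin

lemma mu_mom2_at_top: "filterlim (mu.mom 2) at_top at_top"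
proof -
  obtain u0 m where u: "0 < u0" "0 < m" "\<And>\<xi>. 0 \<le> \<xi> \<Longrightarrow> m * exp (u0 * \<xi>) \<le> mu.mom 2 \<xi>" by (rule mom2_lower) blast
  have "filterlim (\<lambda>\<xi>. m * exp (u0 * \<xi>)) at_top at_top" using u(1,2) by real_asymp
  then show ?thesis
    by (rule filterlim_at_top_mono) (use u(3) in \<open>auto intro: eventually_at_top_linorderI[of 0]\<close>)
qed

lemma mu_mom2_pos:
  obtains m where "0 < m" "\<And>\<xi>. 0 \<le> \<xi> \<Longrightarrow> m \<le> mu.mom 2 \<xi>"
proof -
  obtain u0 m where u: "0 < u0" "0 < m" "\<And>\<xi>. 0 \<le> \<xi> \<Longrightarrow> m * exp (u0 * \<xi>) \<le> mu.mom 2 \<xi>" by (rule mom2_lower) blast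
  show ?thesis
  proof (rule that[OF u(2)])
    fix \<xi> :: real assume \<xi>: "0 \<le> \<xi>"
    have "m * 1 \<le> m * exp (u0 * \<xi>)" using u \<xi> by (intro mult_left_mono) simp_all
    then show "m \<le> mu.mom 2 \<xi>" using u(3)[OF \<xi>] by simp
  qed
qed

text \<open>As soon as M_2 >= e both logarithmic terms are nonnegative, so the bound on their sum
  bounds each of them.\<close>

lemma eventually_h4:
  assumes "0 < \<epsilon>"
  shows "\<forall>\<^sub>F \<xi> in at_top. mu.mom 4 \<xi> \<le> exp (\<epsilon> * \<xi>) * mu.mom 2 \<xi> \<and> mu.mom 2 \<xi> \<le> exp (exp (\<epsilon> * \<xi>))"
proof -
  have 1: "\<forall>\<^sub>F \<xi> in at_top. (ln (max (mu.mom 4 \<xi> / mu.mom 2 \<xi>) 1) + ln (ln (mu.mom 2 \<xi>))) / \<xi> < \<epsilon>"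
    by (rule order_tendstoD(2)[OF h4 assms])
  have 2: "\<forall>\<^sub>F \<xi> in at_top. exp 1 \<le> mu.mom 2 \<xi>"
    using mu_mom2_at_top by (simp add: filterlim_at_top)
  show ?thesis
    using 1 2 eventually_gt_at_top[of 0]
  proof eventually_elim
    case (elim \<xi>)
    let ?r = "mu.mom 4 \<xi> / mu.mom 2 \<xi>"
    have M: "0 < mu.mom 2 \<xi>" using elim(2) exp_gt_zero[of 1] by linarith
    have "ln (exp 1) \<le> ln (mu.mom 2 \<xi>)" using elim(2) M by (subst ln_le_cancel_iff) simp_all
    then have l: "1 \<le> ln (mu.mom 2 \<xi>)" by simp
    have "ln (max ?r 1) + ln (ln (mu.mom 2 \<xi>)) < \<epsilon> * \<xi>" using elim(1,3) by (simp add: divide_less_eq)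
    moreover have "0 \<le> ln (max ?r 1)" "0 \<le> ln (ln (mu.mom 2 \<xi>))" using l by simp_all
    ultimately have le: "ln (max ?r 1) \<le> \<epsilon> * \<xi>" "ln (ln (mu.mom 2 \<xi>)) \<le> \<epsilon> * \<xi>" by linarith+
    have "max ?r 1 = exp (ln (max ?r 1))" by (rule exp_ln[symmetric]) simp
    also have "\<dots> \<le> exp (\<epsilon> * \<xi>)" using le(1) by (simp only: exp_le_cancel_iff)
    finally have "?r \<le> exp (\<epsilon> * \<xi>)" by simp
    then have r: "mu.mom 4 \<xi> \<le> exp (\<epsilon> * \<xi>) * mu.mom 2 \<xi>" using M by (simp add: divide_le_eq)
    have "ln (mu.mom 2 \<xi>) = exp (ln (ln (mu.mom 2 \<xi>)))" using l by (intro exp_ln[symmetric]) simp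
    also have "\<dots> \<le> exp (\<epsilon> * \<xi>)" using le by simp
    finally have "exp (ln (mu.mom 2 \<xi>)) \<le> exp (exp (\<epsilon> * \<xi>))" by simp
    then show ?case using r M by simp
  qed
qed

lemma mu_mom_compact:
  assumes "even k" "2 \<le> k" "0 \<le> \<xi>" "\<xi> \<le> X"
  shows "mu.mom k \<xi> \<le> mu.mom k X + mu.mom k 0"
  by (rule mu.mom_le_add[OF assms])

text \<open>Beyond X the constant 1 works; on [0, X] the fourth moment is bounded and the second is
  bounded below, which gives the constant \<open>A\<close>.\<close>

lemma mu_mom4_le:
  assumes "0 < \<epsilon>"
  obtains C where "0 \<le> C" "\<And>\<xi>. 0 \<le> \<xi> \<Longrightarrow> mu.mom 4 \<xi> \<le> C * exp (\<epsilon> * \<xi>) * mu.mom 2 \<xi>"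
proof -
  obtain X where X: "\<And>\<xi>. X \<le> \<xi> \<Longrightarrow> mu.mom 4 \<xi> \<le> exp (\<epsilon> * \<xi>) * mu.mom 2 \<xi>"
    using eventually_h4[OF assms] unfolding eventually_at_top_linorder by blast
  obtain m where m: "0 < m" "\<And>\<xi>. 0 \<le> \<xi> \<Longrightarrow> m \<le> mu.mom 2 \<xi>" by (rule mu_mom2_pos) blast
  define A where "A = (mu.mom 4 X + mu.mom 4 0) / m"
  have A: "0 \<le> A" unfolding A_def using m by (intro divide_nonneg_pos add_nonneg_nonneg mu.mom_nonneg) simp_all
  show ?thesis
  proof (rule that[of "A + 1"])
    fix \<xi> :: real assume \<xi>: "0 \<le> \<xi>"
    have M: "0 \<le> exp (\<epsilon> * \<xi>) * mu.mom 2 \<xi>" by (intro mult_nonneg_nonneg mu.mom_nonneg) simp_all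
    have split: "(A + 1) * exp (\<epsilon> * \<xi>) * mu.mom 2 \<xi> = A * (exp (\<epsilon> * \<xi>) * mu.mom 2 \<xi>) + exp (\<epsilon> * \<xi>) * mu.mom 2 \<xi>"
      by (simp add: algebra_simps)
    show "mu.mom 4 \<xi> \<le> (A + 1) * exp (\<epsilon> * \<xi>) * mu.mom 2 \<xi>"
    proof (cases "X \<le> \<xi>")
      case True
      have "0 \<le> A * (exp (\<epsilon> * \<xi>) * mu.mom 2 \<xi>)" using A M by (rule mult_nonneg_nonneg)
      then show ?thesis unfolding split using X[OF True] by linarith
    next
      case False
      have "mu.mom 4 \<xi> \<le> mu.mom 4 X + mu.mom 4 0" using \<xi> False by (intro mu_mom_compact) simp_all
      also have "\<dots> = A * m" using m by (simp add: A_def)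
      also have "\<dots> \<le> A * (exp (\<epsilon> * \<xi>) * mu.mom 2 \<xi>)"
      proof (rule mult_left_mono[OF _ A])
        have "1 * m \<le> exp (\<epsilon> * \<xi>) * mu.mom 2 \<xi>"
          using m(1) m(2)[OF \<xi>] assms \<xi> by (intro mult_mono) simp_all
        then show "m \<le> exp (\<epsilon> * \<xi>) * mu.mom 2 \<xi>" by simp
      qed
      finally show ?thesis unfolding split using M by linarith
    qed
  qed (use A in simp)
qed

lemma mu_mom2_le:
  assumes "0 < \<epsilon>"
  obtains C where "0 \<le> C" "\<And>\<xi>. 0 \<le> \<xi> \<Longrightarrow> mu.mom 2 \<xi> \<le> C * exp (exp (\<epsilon> * \<xi>))"
proof -
  obtain X where X: "\<And>\<xi>. X \<le> \<xi> \<Longrightarrow> mu.mom 2 \<xi> \<le> exp (exp (\<epsilon> * \<xi>))"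
    using eventually_h4[OF assms] unfolding eventually_at_top_linorder by blast
  define A where "A = mu.mom 2 X + mu.mom 2 0"
  have A: "0 \<le> A" unfolding A_def by (intro add_nonneg_nonneg mu.mom_nonneg) simp_all
  show ?thesis
  proof (rule that[of "A + 1"])
    fix \<xi> :: real assume \<xi>: "0 \<le> \<xi>"
    have e1: "1 \<le> exp (exp (\<epsilon> * \<xi>))" by simp
    have "A * 1 \<le> A * exp (exp (\<epsilon> * \<xi>))" using e1 A by (rule mult_left_mono)
    moreover have "(A + 1) * exp (exp (\<epsilon> * \<xi>)) = A * exp (exp (\<epsilon> * \<xi>)) + exp (exp (\<epsilon> * \<xi>))"
      by (simp add: algebra_simps)
    moreover have "mu.mom 2 \<xi> \<le> A \<or> mu.mom 2 \<xi> \<le> exp (exp (\<epsilon> * \<xi>))"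
      using X[of \<xi>] mu_mom_compact[of 2 \<xi> X] \<xi> unfolding A_def by (cases "X \<le> \<xi>") simp_all
    ultimately show "mu.mom 2 \<xi> \<le> (A + 1) * exp (exp (\<epsilon> * \<xi>))" using A e1 by linarith
  qed (use A in simp)
qed

lemma ker_power_le: "2 \<le> k \<Longrightarrow> ker s ^ k \<le> c ^ (k - 2) * (ker s)\<^sup>2"
proof -
  assume "2 \<le> k"
  then have "ker s ^ k = ker s ^ (k - 2) * (ker s)\<^sup>2" by (metis le_add_diff_inverse2 power_add)
  also have "\<dots> \<le> c ^ (k - 2) * (ker s)\<^sup>2"
    using ker_bounds[of s] by (intro mult_right_mono power_mono) simp_all
  finally show ?thesis .
qed

lemma Q_mom_le:
  assumes "even k" "2 \<le> k" "0 \<le> \<xi>"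
  shows "Q.mom k \<xi> \<le> (c ^ (k - 2) * (LINT s|lborel. (ker s)\<^sup>2)) * (mu.mom k (c * \<xi>) + mu.mom k 0)"
proof -
  let ?M = "mu.mom k (c * \<xi>) + mu.mom k 0"
  have M: "0 \<le> ?M" using assms by (intro add_nonneg_nonneg mu.mom_nonneg)
  have "Q.mom k \<xi> \<le> (LINT s|lborel. (c ^ (k - 2) * ?M) * (ker s)\<^sup>2)"
    unfolding Q_mom[OF assms(2)]
  proof (rule integral_mono[OF mu_mom_integrable[OF assms(2)] integrable_mult_right[OF ker_square_integrable]])
    fix s
    have "\<xi> * ker s \<le> \<xi> * c" using ker_bounds[of s] assms by (intro mult_left_mono)
    then have "mu.mom k (\<xi> * ker s) \<le> ?M"
      using ker_bounds[of s] assms by (intro mu_mom_compact) (simp_all add: mult.commute)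
    then have "ker s ^ k * mu.mom k (\<xi> * ker s) \<le> (c ^ (k - 2) * (ker s)\<^sup>2) * ?M"
      using ker_power_le[OF assms(2), of s] M ker_bounds[of s] assms c_pos
      by (intro mult_mono mu.mom_nonneg) simp_all
    then show "ker s ^ k * mu.mom k (\<xi> * ker s) \<le> (c ^ (k - 2) * ?M) * (ker s)\<^sup>2" by (simp add: mult_ac)
  qed
  then show ?thesis by (simp add: mult_ac)
qed

text \<open>Compared pointwise in time: since ker <= c, the rate \<epsilon> / c for \<mu> becomes at
  most \<epsilon>, and bounding two of the four kernel factors by c leaves the integrand of the
  second moment.\<close>

lemma Q_mom4_le_mom2:
  assumes "0 < \<epsilon>"
  shows "\<exists>C. \<forall>\<xi>\<ge>0. Q.mom 4 \<xi> \<le> C * exp (\<epsilon> * \<xi>) * Q.mom 2 \<xi>"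
proof -
  have "0 < \<epsilon> / c" using assms c_pos by simp
  then obtain C where C: "0 \<le> C" "\<And>\<xi>. 0 \<le> \<xi> \<Longrightarrow> mu.mom 4 \<xi> \<le> C * exp (\<epsilon> / c * \<xi>) * mu.mom 2 \<xi>" by (rule mu_mom4_le) blast
  have "Q.mom 4 \<xi> \<le> (c\<^sup>2 * C) * exp (\<epsilon> * \<xi>) * Q.mom 2 \<xi>" if \<xi>: "0 \<le> \<xi>" for \<xi>
  proof -
    have "Q.mom 4 \<xi> \<le> (LINT s|lborel. ((c\<^sup>2 * C) * exp (\<epsilon> * \<xi>)) * (ker s ^ 2 * mu.mom 2 (\<xi> * ker s)))"
      unfolding Q_mom[of 4, simplified]
    proof (rule integral_mono[OF mu_mom_integrable[of 4, simplified] integrable_mult_right[OF mu_mom_integrable[of 2, simplified]]])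
      fix s
      have p: "0 \<le> \<xi> * ker s" using \<xi> ker_bounds[of s] by simp
      have "\<epsilon> / c * (\<xi> * ker s) \<le> \<epsilon> / c * (\<xi> * c)"
        using ker_bounds[of s] \<xi> assms c_pos by (intro mult_left_mono) simp_all
      then have e: "exp (\<epsilon> / c * (\<xi> * ker s)) \<le> exp (\<epsilon> * \<xi>)" using c_pos by simp
      have m2: "0 \<le> mu.mom 2 (\<xi> * ker s)" by (intro mu.mom_nonneg) simp
      have "mu.mom 4 (\<xi> * ker s) \<le> C * exp (\<epsilon> / c * (\<xi> * ker s)) * mu.mom 2 (\<xi> * ker s)" using p by (rule C(2))
      also have "\<dots> \<le> C * exp (\<epsilon> * \<xi>) * mu.mom 2 (\<xi> * ker s)"
        using e C(1) m2 by (intro mult_right_mono mult_left_mono)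
      finally have "ker s ^ 4 * mu.mom 4 (\<xi> * ker s) \<le> (c\<^sup>2 * (ker s)\<^sup>2) * (C * exp (\<epsilon> * \<xi>) * mu.mom 2 (\<xi> * ker s))"
        using ker_power_le[of 4 s] ker_bounds[of s] C(1) m2 by (intro mult_mono mu.mom_nonneg) simp_all
      then show "ker s ^ 4 * mu.mom 4 (\<xi> * ker s) \<le> ((c\<^sup>2 * C) * exp (\<epsilon> * \<xi>)) * (ker s ^ 2 * mu.mom 2 (\<xi> * ker s))"
        by (simp add: mult_ac)
    qed
    then show ?thesis by (simp add: Q_mom)
  qed
  then show ?thesis by blast
qed

text \<open>Factors in front of the double exponential move into its exponent, by R <= e^R and
  e^(\<epsilon> \<xi>) >= 1.\<close>

lemma Q_mom2_le_expexp:
  assumes "0 < \<epsilon>"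
  shows "\<exists>C. \<forall>\<xi>\<ge>0. Q.mom 2 \<xi> \<le> exp (C * exp (\<epsilon> * \<xi>))"
proof -
  have "0 < \<epsilon> / c" using assms c_pos by simp
  then obtain C where C: "0 \<le> C" "\<And>\<xi>. 0 \<le> \<xi> \<Longrightarrow> mu.mom 2 \<xi> \<le> C * exp (exp (\<epsilon> / c * \<xi>))" by (rule mu_mom2_le) blast
  define I where "I = (LINT s|lborel. (ker s)\<^sup>2)"
  have I: "0 \<le> I" unfolding I_def by (intro integral_nonneg_AE AE_I2) simp
  have m0: "0 \<le> mu.mom 2 0" by (intro mu.mom_nonneg) simp
  define R where "R = I * (C + mu.mom 2 0)"
  have R: "0 \<le> R" unfolding R_def using I C m0 by simp
  have "Q.mom 2 \<xi> \<le> exp ((R + 1) * exp (\<epsilon> * \<xi>))" if \<xi>: "0 \<le> \<xi>" for \<xi>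
  proof -
    define e where "e = exp (\<epsilon> * \<xi>)"
    have e: "1 \<le> e" using assms \<xi> by (simp add: e_def)
    have "mu.mom 2 (c * \<xi>) \<le> C * exp (exp (\<epsilon> / c * (c * \<xi>)))" using c_pos \<xi> by (intro C(2)) simp
    then have 1: "mu.mom 2 (c * \<xi>) \<le> C * exp e" using c_pos by (simp add: e_def)
    have "mu.mom 2 0 * 1 \<le> mu.mom 2 0 * exp e" using m0 e by (intro mult_left_mono) simp_all
    then have "mu.mom 2 (c * \<xi>) + mu.mom 2 0 \<le> (C + mu.mom 2 0) * exp e" using 1 by (simp add: ring_distribs)
    then have "I * (mu.mom 2 (c * \<xi>) + mu.mom 2 0) \<le> I * ((C + mu.mom 2 0) * exp e)" using I by (rule mult_left_mono)
    then have "Q.mom 2 \<xi> \<le> R * exp e"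
      using Q_mom_le[of 2 \<xi>] \<xi> unfolding R_def I_def by (simp add: mult.assoc)
    also have "\<dots> \<le> exp R * exp e"
    proof (rule mult_right_mono)
      show "R \<le> exp R" using exp_ge_add_one_self[of R] by linarith
    qed simp
    also have "\<dots> = exp (R + e)" by (simp add: exp_add)
    also have "\<dots> \<le> exp ((R + 1) * e)"
      using mult_left_mono[OF e R] by (simp add: ring_distribs)
    finally show ?thesis unfolding e_def .
  qed
  then show ?thesis by blast
qed

text \<open>The numerator sees the maximum c of the kernel, attained at a single time, while the
  denominator has to be bounded below over a set of positive length. There the kernel is only at
  least \<gamma> c with \<gamma> < 1, and hypothesis 3 provides this slack.\<close>

lemma Q_mom4_small: "((\<lambda>\<xi>. Q.mom 4 \<xi> / (Q.mom 2 \<xi>)\<^sup>2) \<longlongrightarrow> 0) at_top"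
proof -
  obtain \<gamma> where \<gamma>: "0 < \<gamma>" "\<gamma> < 1" and lim: "((\<lambda>\<xi>. mu.mom 4 \<xi> / (mu.mom 2 (\<gamma> * \<xi>))\<^sup>2) \<longlongrightarrow> 0) at_top"
    using h3 by blast
  define I where "I = (LINT s|lborel. (ker s)\<^sup>2)"
  have I: "0 \<le> I" unfolding I_def by (intro integral_nonneg_AE AE_I2) simp
  \<comment> \<open>Solves (1 - \<delta>)^a = \<gamma>, so the kernel is at least c \<gamma> on
    [0, \<delta>].\<close>
  define \<delta> where "\<delta> = 1 - \<gamma> powr (1 / a)"
  have "\<gamma> powr (1 / a) < 1 powr (1 / a)" using \<gamma> a_bounds by (intro powr_less_mono2) simp_all
  then have \<delta>: "0 < \<delta>" "\<delta> \<le> 1" by (simp_all add: \<delta>_def)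
  have ker\<delta>: "c * \<gamma> \<le> ker s" if "0 \<le> s" "s \<le> \<delta>" for s
  proof -
    have "(\<gamma> powr (1 / a)) powr a \<le> (1 - s) powr a"
      using that a_bounds by (intro powr_mono2) (simp_all add: \<delta>_def)
    then have "\<gamma> \<le> (1 - s) powr a" using \<gamma> a_bounds by (simp add: powr_powr)
    then show ?thesis using that \<delta> c_pos by (simp add: ker_01)
  qed
  define A where "A = \<delta> * (c * \<gamma>)\<^sup>2 / 2"
  have A: "0 < A" unfolding A_def using \<delta> c_pos \<gamma> by simp
  let ?M = "\<lambda>\<xi>. mu.mom 2 (\<gamma> * (c * \<xi>))"
  have c\<gamma>: "filterlim (\<lambda>\<xi>. \<gamma> * (c * \<xi>)) at_top at_top" using \<gamma> c_pos by real_asymp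
  have Mtop: "filterlim ?M at_top at_top" by (rule filterlim_compose[OF mu_mom2_at_top c\<gamma>])
  \<comment> \<open>The additive moment at 0 in \<open>mu_mom_compact\<close> is eventually at most
    half of \<open>?M\<close>; this accounts for the factor 1/2 in \<open>A\<close>.\<close>
  have low: "\<forall>\<^sub>F \<xi> in at_top. A * ?M \<xi> \<le> Q.mom 2 \<xi>"
  proof -
    have "\<forall>\<^sub>F \<xi> in at_top. 2 * mu.mom 2 0 \<le> ?M \<xi>" using Mtop by (simp add: filterlim_at_top)
    then show ?thesis
      using eventually_ge_at_top[of 0]
    proof eventually_elim
      case (elim \<xi>)
      have "A * ?M \<xi> = (LINT s|lborel. ((c * \<gamma>)\<^sup>2 * (?M \<xi> / 2)) * indicator {0..\<delta>} s)"
        using \<delta> by (simp add: A_def)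
      also have "\<dots> \<le> (LINT s|lborel. ker s ^ 2 * mu.mom 2 (\<xi> * ker s))"
      proof (rule integral_mono[OF _ mu_mom_integrable])
        show "integrable lborel (\<lambda>s. ((c * \<gamma>)\<^sup>2 * (?M \<xi> / 2)) * indicator {0..\<delta>} s)"
          using \<delta> by (intro integrable_mult_right integrable_real_indicator) simp_all
        fix s
        have m2: "0 \<le> mu.mom 2 (\<xi> * ker s)" by (intro mu.mom_nonneg) simp
        show "((c * \<gamma>)\<^sup>2 * (?M \<xi> / 2)) * indicator {0..\<delta>} s \<le> ker s ^ 2 * mu.mom 2 (\<xi> * ker s)"
        proof (cases "s \<in> {0..\<delta>}")
          case True
          then have k: "c * \<gamma> \<le> ker s" by (intro ker\<delta>) simp_all
          have "\<xi> * (c * \<gamma>) \<le> \<xi> * ker s" using k elim(2) by (rule mult_left_mono)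
          then have "?M \<xi> \<le> mu.mom 2 (\<xi> * ker s) + mu.mom 2 0"
            using elim(2) c_pos \<gamma> by (intro mu_mom_compact) (simp_all add: mult_ac)
          then have "?M \<xi> / 2 \<le> mu.mom 2 (\<xi> * ker s)" using elim(1) by linarith
          then have "(c * \<gamma>)\<^sup>2 * (?M \<xi> / 2) \<le> ker s ^ 2 * mu.mom 2 (\<xi> * ker s)"
            using k c_pos \<gamma> mu.mom_nonneg[of 2 "\<gamma> * (c * \<xi>)"] by (intro mult_mono power_mono) simp_all
          then show ?thesis using True by simp
        next
          case False
          then show ?thesis using m2 by simp
        qed
      qed simp
      also have "\<dots> = Q.mom 2 \<xi>" by (simp add: Q_mom)
      finally show ?case .
    qed
  qed
  define D where "D = c\<^sup>2 * I / A\<^sup>2"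
  have bound: "\<forall>\<^sub>F \<xi> in at_top. norm (Q.mom 4 \<xi> / (Q.mom 2 \<xi>)\<^sup>2)
      \<le> D * (mu.mom 4 (c * \<xi>) / (?M \<xi>)\<^sup>2 + mu.mom 4 0 * (inverse (?M \<xi>))\<^sup>2)"
  proof -
    have "\<forall>\<^sub>F \<xi> in at_top. 1 \<le> ?M \<xi>" using Mtop by (simp add: filterlim_at_top)
    then show ?thesis
      using low eventually_ge_at_top[of 0]
    proof eventually_elim
      case (elim \<xi>)
      have q4: "0 \<le> Q.mom 4 \<xi>" by (intro Q.mom_nonneg) simp
      have AM: "0 < A * ?M \<xi>" using A elim(1) by simp
      have s4: "0 \<le> mu.mom 4 (c * \<xi>) + mu.mom 4 0" by (intro add_nonneg_nonneg mu.mom_nonneg) simp_all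
      have "Q.mom 4 \<xi> \<le> c\<^sup>2 * I * (mu.mom 4 (c * \<xi>) + mu.mom 4 0)"
        using Q_mom_le[of 4 \<xi>] elim(3) by (simp add: I_def)
      moreover have "(A * ?M \<xi>)\<^sup>2 \<le> (Q.mom 2 \<xi>)\<^sup>2" using elim(2) AM by (intro power_mono) simp_all
      ultimately have "Q.mom 4 \<xi> / (Q.mom 2 \<xi>)\<^sup>2 \<le> c\<^sup>2 * I * (mu.mom 4 (c * \<xi>) + mu.mom 4 0) / (A * ?M \<xi>)\<^sup>2"
        using zero_less_power[OF AM, of 2] mult_nonneg_nonneg[OF mult_nonneg_nonneg[OF zero_le_power2 I] s4]
        by (intro frac_le)
      also have "\<dots> = D * (mu.mom 4 (c * \<xi>) / (?M \<xi>)\<^sup>2 + mu.mom 4 0 * (inverse (?M \<xi>))\<^sup>2)"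
        by (simp add: D_def power_mult_distrib add_divide_distrib ring_distribs divide_inverse power_inverse mult_ac)
      finally show ?case using q4 by simp
    qed
  qed
  have c_top: "filterlim (\<lambda>\<xi>. c * \<xi>) at_top at_top" using c_pos by real_asymp
  have l1: "((\<lambda>\<xi>. mu.mom 4 (c * \<xi>) / (?M \<xi>)\<^sup>2) \<longlongrightarrow> 0) at_top"
    by (rule filterlim_compose[OF lim c_top])
  have "((\<lambda>\<xi>. inverse (?M \<xi>)) \<longlongrightarrow> 0) at_top" by (rule tendsto_inverse_0_at_top[OF Mtop])
  then have "((\<lambda>\<xi>. (inverse (?M \<xi>))\<^sup>2) \<longlongrightarrow> 0\<^sup>2) at_top" by (rule tendsto_power)
  then have l2: "((\<lambda>\<xi>. mu.mom 4 0 * (inverse (?M \<xi>))\<^sup>2) \<longlongrightarrow> 0) at_top" by (intro tendsto_mult_right_zero) simp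
  have "((\<lambda>\<xi>. D * (mu.mom 4 (c * \<xi>) / (?M \<xi>)\<^sup>2 + mu.mom 4 0 * (inverse (?M \<xi>))\<^sup>2)) \<longlongrightarrow> 0) at_top"
    by (rule tendsto_mult_right_zero[OF tendsto_add_zero[OF l1 l2]])
  then show ?thesis by (rule Lim_null_comparison[OF bound])
qed

lemma saddle_exists:
  assumes "0 < t0"
  shows "\<exists>b d W. saddle (lborel \<Otimes>\<^sub>M \<mu>) (\<lambda>p. ker (fst p) * snd p) b d W t0"
proof -
  obtain b1 d where n: "0 < b1" "0 < d" "\<And>\<xi> w. 0 \<le> \<xi> \<Longrightarrow> Re (Q.tilted \<xi> w) \<le> - b1 * exp (d * \<xi>) * min (w\<^sup>2) 1"
    by (rule near_decay) blast
  obtain b2 W where f: "0 < b2" "0 < W" "\<And>\<xi> w. 0 \<le> \<xi> \<Longrightarrow> W \<le> \<bar>w\<bar> \<Longrightarrow> Re (Q.tilted \<xi> w) \<le> - b2 * \<bar>w\<bar>"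
    by (rule far_decay) blast
  define b where "b = min b1 b2"
  have b: "0 < b" "b \<le> b1" "b \<le> b2" using n f by (simp_all add: b_def)
  have "saddle (lborel \<Otimes>\<^sub>M \<mu>) (\<lambda>p. ker (fst p) * snd p) b d W t0"
  proof
    show "0 < b" "0 < d" "0 < t0" by fact+
    fix \<xi> w :: real assume \<xi>: "0 \<le> \<xi>"
    have "b * (exp (d * \<xi>) * min (w\<^sup>2) 1) \<le> b1 * (exp (d * \<xi>) * min (w\<^sup>2) 1)"
      using b by (intro mult_right_mono mult_nonneg_nonneg) simp_all
    then show "Re (Q.tilted \<xi> w) \<le> - b * exp (d * \<xi>) * min (w\<^sup>2) 1" using n(3)[OF \<xi>, of w] by (simp only: mult.assoc mult_minus_left)
    show "Re (Q.tilted \<xi> w) \<le> - b * (\<bar>w\<bar> - W)"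
    proof (cases "W \<le> \<bar>w\<bar>")
      case True
      have "b * (\<bar>w\<bar> - W) \<le> b2 * \<bar>w\<bar>" using b f True by (intro mult_mono) simp_all
      then show ?thesis using f(3)[OF \<xi> True] by simp
    next
      case False
      have "b * (\<bar>w\<bar> - W) \<le> 0" using b False by (simp add: mult_nonneg_nonpos)
      then show ?thesis using Q.Re_tilted_nonpos[of \<xi> w] by simp
    qed
  qed (rule Q_mom4_small Q_mom4_le_mom2 Q_mom2_le_expexp; assumption?)+
  then show ?thesis by blast
qed

end

section \<open>The characteristic function of fractional Levy motion\<close>

lemma simple_integrand_measurable:
  assumes "simple_integrand g"
  shows "g \<in> borel_measurable borel"
proof -
  have fin: "finite (range g)" and lev: "\<And>c. c \<noteq> 0 \<Longrightarrow> g -` {c} \<in> sets borel"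
    using assms by (auto simp: simple_integrand_def bounded_borel_def)
  have lev0: "g -` {0} \<in> sets borel"
  proof -
    have "g -` {0} = - (\<Union>c\<in>range g - {0}. g -` {c})" by auto
    also have "\<dots> \<in> sets borel" using fin lev by (intro borel_comp sets.finite_UN) auto
    finally show ?thesis .
  qed
  have "simple_function borel g"
    unfolding simple_function_def
  proof (intro conjI ballI)
    fix x show "g -` {x} \<inter> space borel \<in> sets borel" using lev[of x] lev0 by (cases "x = 0") simp_all
  qed (use fin in simp)
  then show ?thesis by (rule borel_measurable_simple_function)
qed

text \<open>Continuity keeps L near 1 on a short interval [0, e], yet the integral of the phases
  over it is at most 2 / |\<theta> k| and tends to 0. Dominated convergence makes the two
  incompatible.\<close>

lemma exponential_phases_diverge:
  fixes \<theta> :: "nat \<Rightarrow> real" and L :: "real \<Rightarrow> complex"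
  assumes lim: "\<And>z. (\<lambda>k. iexp (z * \<theta> k)) \<longlonglongrightarrow> L z" and cont: "isCont L 0"
    and inf: "filterlim (\<lambda>k. \<bar>\<theta> k\<bar>) at_top sequentially"
  shows False
proof -
  have L0: "L 0 = 1" using lim[of 0] by (simp add: LIMSEQ_const_iff)
  have "\<exists>d>0. \<forall>z. dist z 0 < d \<longrightarrow> dist (L z) (L 0) < 1/2"
    using cont unfolding continuous_at_eps_delta by (rule allE[of _ "1/2"]) simp
  then obtain d where d: "0 < d" "\<forall>z. dist z 0 < d \<longrightarrow> dist (L z) (L 0) < 1/2" by blast
  define e where "e = d / 2"
  have e: "0 < e" "e < d" using d by (simp_all add: e_def)
  have near: "norm (L z - 1) \<le> 1/2" if "z \<in> {0..e}" for z
  proof -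
    have "dist z 0 < d" using that e by simp
    then show ?thesis using d(2) L0 by (auto simp: dist_norm intro: less_imp_le)
  qed
  have Lm: "L \<in> borel_measurable borel"
  proof (rule borel_measurable_LIMSEQ_metric[where f = "\<lambda>k z. iexp (z * \<theta> k)"])
    show "(\<lambda>z. iexp (z * \<theta> k)) \<in> borel_measurable borel" for k
      by (intro borel_measurable_continuous_onI continuous_intros)
  qed (rule lim)
  have i1: "integrable lborel (\<lambda>z. indicator {0..e} z *\<^sub>R (1::real))"
    by (intro integrable_scaleR_left integrable_real_indicator) (use e in simp_all)
  have conv: "(\<lambda>k. LINT z|lborel. indicator {0..e} z *\<^sub>R iexp (z * \<theta> k)) \<longlonglongrightarrow> (LINT z|lborel. indicator {0..e} z *\<^sub>R L z)"
  proof (rule integral_dominated_convergence[OF _ _ i1])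
    show "(\<lambda>z. indicator {0..e} z *\<^sub>R L z) \<in> borel_measurable lborel" using Lm by simp
    show "(\<lambda>z. indicator {0..e} z *\<^sub>R iexp (z * \<theta> k)) \<in> borel_measurable lborel" for k by simp
    show "AE z in lborel. (\<lambda>k. indicator {0..e} z *\<^sub>R iexp (z * \<theta> k)) \<longlonglongrightarrow> indicator {0..e} z *\<^sub>R L z"
      by (intro AE_I2 tendsto_scaleR tendsto_const lim)
    show "AE z in lborel. norm (indicator {0..e} z *\<^sub>R iexp (z * \<theta> k)) \<le> indicator {0..e} z *\<^sub>R (1::real)" for k
      by (intro AE_I2) (simp add: indicator_def)
  qed
  have zero: "(\<lambda>k. LINT z|lborel. indicator {0..e} z *\<^sub>R iexp (z * \<theta> k)) \<longlonglongrightarrow> 0"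
  proof (rule Lim_null_comparison)
    have "\<forall>\<^sub>F k in sequentially. 1 \<le> \<bar>\<theta> k\<bar>" using inf by (simp add: filterlim_at_top)
    then show "\<forall>\<^sub>F k in sequentially. norm (LINT z|lborel. indicator {0..e} z *\<^sub>R iexp (z * \<theta> k)) \<le> 2 * inverse \<bar>\<theta> k\<bar>"
    proof eventually_elim
      case (elim k)
      then have nz: "\<theta> k \<noteq> 0" by auto
      have "(LINT z|lborel. indicator {0..e} z *\<^sub>R iexp (z * \<theta> k)) = iexp (e * \<theta> k) / (\<i> * \<theta> k) - iexp (0 * \<theta> k) / (\<i> * \<theta> k)"
      proof (rule integral_FTC_Icc)
        show "continuous_on {0..e} (\<lambda>z. iexp (z * \<theta> k))" by (intro continuous_intros)
        fix z
        have "((\<lambda>w. exp (\<i> * (w * of_real (\<theta> k))) / (\<i> * of_real (\<theta> k))) has_field_derivative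
            exp (\<i> * (of_real z * of_real (\<theta> k)))) (at (of_real z))"
          using nz by (auto intro!: derivative_eq_intros simp: mult.left_commute[of \<i> _ \<i>])
        from has_vector_derivative_real_field[OF this]
        show "((\<lambda>z. iexp (z * \<theta> k) / (\<i> * \<theta> k)) has_vector_derivative iexp (z * \<theta> k)) (at z within {0..e})"
          by (simp only: of_real_mult)
      qed (use e in simp)
      also have "\<dots> = (iexp (e * \<theta> k) - 1) / (\<i> * \<theta> k)" by (simp add: diff_divide_distrib)
      finally have eq: "(LINT z|lborel. indicator {0..e} z *\<^sub>R iexp (z * \<theta> k)) = (iexp (e * \<theta> k) - 1) / (\<i> * \<theta> k)" .
      have "norm (iexp (e * \<theta> k) - 1) \<le> norm (iexp (e * \<theta> k)) + norm (1::complex)" by (rule norm_triangle_ineq4)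
      then have "norm (iexp (e * \<theta> k) - 1) \<le> 2" by simp
      then have "norm (iexp (e * \<theta> k) - 1) / \<bar>\<theta> k\<bar> \<le> 2 / \<bar>\<theta> k\<bar>" by (rule divide_right_mono) simp
      moreover have "norm ((iexp (e * \<theta> k) - 1) / (\<i> * \<theta> k)) = norm (iexp (e * \<theta> k) - 1) / \<bar>\<theta> k\<bar>"
        by (simp only: norm_divide norm_mult norm_ii norm_of_real mult_1)
      ultimately show ?case unfolding eq by (simp only: divide_inverse)
    qed
    have "((\<lambda>k. inverse \<bar>\<theta> k\<bar>) \<longlongrightarrow> 0) sequentially" by (rule tendsto_inverse_0_at_top[OF inf])
    then show "(\<lambda>k. 2 * inverse \<bar>\<theta> k\<bar>) \<longlonglongrightarrow> 0" by (rule tendsto_mult_right_zero)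
  qed
  have null: "(LINT z|lborel. indicator {0..e} z *\<^sub>R L z) = 0" by (rule LIMSEQ_unique[OF conv zero])
  have iL: "integrable lborel (\<lambda>z. indicator {0..e} z *\<^sub>R (L z - 1))"
  proof (rule Bochner_Integration.integrable_bound[OF i1])
    show "(\<lambda>z. indicator {0..e} z *\<^sub>R (L z - 1)) \<in> borel_measurable lborel" using Lm by simp
    show "AE z in lborel. norm (indicator {0..e} z *\<^sub>R (L z - 1)) \<le> norm (indicator {0..e} z *\<^sub>R (1::real))"
    proof (rule AE_I2)
      fix z show "norm (indicator {0..e} z *\<^sub>R (L z - 1)) \<le> norm (indicator {0..e} z *\<^sub>R (1::real))"
        using near[of z] by (cases "z \<in> {0..e}") simp_all
    qed
  qed
  have ic: "has_bochner_integral lborel (\<lambda>z. indicator {0..e} z *\<^sub>R (1::complex)) (e *\<^sub>R 1)"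
    using e has_bochner_integral_real_indicator[of "{0..e}" lborel] by (intro has_bochner_integral_scaleR_left) simp
  have "(LINT z|lborel. indicator {0..e} z *\<^sub>R L z) = (LINT z|lborel. indicator {0..e} z *\<^sub>R (L z - 1) + indicator {0..e} z *\<^sub>R 1)"
    by (simp add: scaleR_diff_right)
  also have "\<dots> = (LINT z|lborel. indicator {0..e} z *\<^sub>R (L z - 1)) + e *\<^sub>R 1"
    using ic iL by (subst Bochner_Integration.integral_add) (simp_all add: has_bochner_integral_iff)
  finally have "(LINT z|lborel. indicator {0..e} z *\<^sub>R (L z - 1)) = - of_real e"
    using null by (simp add: scaleR_conv_of_real eq_neg_iff_add_eq_0)
  then have "e = norm (LINT z|lborel. indicator {0..e} z *\<^sub>R (L z - 1))" using e by simp
  also have "\<dots> \<le> (LINT z|lborel. norm (indicator {0..e} z *\<^sub>R (L z - 1)))" by (rule integral_norm_bound)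
  also have "\<dots> \<le> (LINT z|lborel. (1/2) * (indicator {0..e} z *\<^sub>R (1::real)))"
  proof (rule integral_mono[OF integrable_norm[OF iL] integrable_mult_right[OF i1]])
    fix z show "norm (indicator {0..e} z *\<^sub>R (L z - 1)) \<le> (1/2) * (indicator {0..e} z *\<^sub>R (1::real))"
      using near[of z] by (cases "z \<in> {0..e}") simp_all
  qed
  also have "\<dots> = e / 2" using e by simp
  finally show False using e by simp
qed

context frac_levy
begin

text \<open>The first moment of the jumps larger than 1: exactly the discrepancy between the
  truncated compensation in \<open>levy_exponent\<close> and the full one in
  \<open>cumul\<close>.\<close>

definition mean :: real where "mean = (LINT u|\<mu>. u * (1 - indicator {-1..1} u))"

lemma mean_integrable: "integrable \<mu> (\<lambda>u. u * (1 - indicator {-1..1} u))"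
proof (rule mu.int_bounded_by[of 2 _ 1 0])
  have "(\<lambda>u::real. u * (1 - indicator {-1..1} u)) \<in> borel_measurable borel" by simp
  then show "(\<lambda>u. u * (1 - indicator {-1..1} u)) \<in> borel_measurable \<mu>"
    using measurable_cong_sets[OF sets_mu refl] by blast
  show "norm (u * (1 - indicator {-1..1} u)) \<le> 1 * (\<bar>u\<bar>\<^sup>2 * exp (0 * \<bar>u\<bar>))" for u :: real
  proof (cases "u \<in> {-1..1}")
    case False
    then have "1 \<le> \<bar>u\<bar>" by (simp add: abs_le_iff not_le) linarith
    then have "\<bar>u\<bar> * 1 \<le> \<bar>u\<bar> * \<bar>u\<bar>" by (intro mult_left_mono) simp_all
    then show ?thesis using False by (simp add: power2_eq_square)
  qed simp
qed simp

lemma levy_exponent_eq: "levy_exponent \<mu> z = mu.cumul (\<i> * of_real z) + \<i> * of_real z * of_real mean"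
proof -
  have i: "integrable \<mu> (\<lambda>u. \<i> * of_real z * of_real (u * (1 - indicator {-1..1} u)))"
    by (intro integrable_mult_right integrable_of_real mean_integrable)
  have "levy_exponent \<mu> z = (LINT u|\<mu>. (exp (\<i> * of_real z * of_real u) - 1 - \<i> * of_real z * of_real u)
      + \<i> * of_real z * of_real (u * (1 - indicator {-1..1} u)))"
    unfolding levy_exponent_def
    by (intro Bochner_Integration.integral_cong refl) (simp add: algebra_simps)
  also have "\<dots> = mu.cumul (\<i> * of_real z) + (LINT u|\<mu>. \<i> * of_real z * of_real (u * (1 - indicator {-1..1} u)))"
    unfolding mu.cumul_def by (rule Bochner_Integration.integral_add[OF mu.int_cumul i])
  also have "(LINT u|\<mu>. \<i> * of_real z * of_real (u * (1 - indicator {-1..1} u))) = \<i> * of_real z * of_real mean"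
    unfolding mean_def by (simp only: integral_mult_right_zero integral_complex_of_real)
  finally show ?thesis .
qed

lemma mu_cumul_cont: "continuous_on S mu.cumul"
  by (rule continuous_at_imp_continuous_on) (rule ballI, rule DERIV_isCont[OF mu.deriv_cumul])

lemma levy_exponent_cont: "continuous_on UNIV (levy_exponent \<mu>)"
proof -
  have "continuous_on UNIV (\<lambda>z. mu.cumul (\<i> * of_real z) + \<i> * of_real z * of_real mean)"
    by (intro continuous_intros continuous_on_compose2[OF mu_cumul_cont[of UNIV]]) simp_all
  moreover have "levy_exponent \<mu> = (\<lambda>z. mu.cumul (\<i> * of_real z) + \<i> * of_real z * of_real mean)"
    by (rule ext) (rule levy_exponent_eq)
  ultimately show ?thesis by (simp only:)
qed

lemma Re_levy_exponent: "Re (levy_exponent \<mu> z) = - (LINT u|\<mu>. exp (0 * u) * (1 - cos (z * u)))"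
proof -
  have "mu.tilted 0 z = mu.cumul (\<i> * of_real z)"
    by (simp add: mu.tilted_eq mu.cumul_def mu.cumul1_def)
  then have "Re (levy_exponent \<mu> z) = Re (mu.tilted 0 z)" by (simp add: levy_exponent_eq)
  then show ?thesis by (simp only: mu.Re_tilted)
qed

text \<open>The difference of the two sides is 2 (1 - cos (z u))^2 under the integral.\<close>

lemma levy_exponent_doubling: "4 * Re (levy_exponent \<mu> z) \<le> Re (levy_exponent \<mu> (2 * z))"
proof -
  have "(LINT u|\<mu>. exp (0 * u) * (1 - cos (2 * z * u))) \<le> (LINT u|\<mu>. 4 * (exp (0 * u) * (1 - cos (z * u))))"
  proof (rule integral_mono[OF mu.int_one_minus_cos integrable_mult_right[OF mu.int_one_minus_cos]])
    fix u
    have "0 \<le> 2 * (1 - cos (z * u))\<^sup>2" by simp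
    also have "\<dots> = 4 * (1 - cos (z * u)) - (1 - cos (2 * (z * u)))"
      unfolding cos_double_cos by (simp add: power2_eq_square algebra_simps)
    finally show "exp (0 * u) * (1 - cos (2 * z * u)) \<le> 4 * (exp (0 * u) * (1 - cos (z * u)))"
      by (simp add: mult.assoc)
  qed
  then show ?thesis unfolding Re_levy_exponent integral_mult_right_zero by linarith
qed

lemma levy_scattered:
  assumes M: "prob_space M" and Z: "levy_process M Z \<mu>" and \<Lambda>: "random_measure_of M Z \<Lambda>"
  shows "scattered M \<Lambda> (levy_exponent \<mu>)"
proof -
  interpret prob_space M by (rule M)
  have scat: "independently_scattered M \<Lambda>" using \<Lambda> by (simp add: random_measure_of_def)
  have inc: "AE \<omega> in M. \<Lambda> {x<..y} \<omega> = Z y \<omega> - Z x \<omega>" if "x \<le> y" for x y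
    using \<Lambda> that by (simp add: random_measure_of_def)
  have Zm: "Z s \<in> borel_measurable M" for s using Z unfolding levy_process_def by blast
  have Zc: "\<forall>s t z. s < t \<longrightarrow> char (distr M borel (\<lambda>\<omega>. Z t \<omega> - Z s \<omega>)) z = exp (of_real (t - s) * levy_exponent \<mu> z)"
    using Z unfolding levy_process_def by blast
  show ?thesis
  proof
    show "independently_scattered M \<Lambda>" by (rule scat)
    show "continuous_on UNIV (levy_exponent \<mu>)" by (rule levy_exponent_cont)
    show "levy_exponent \<mu> 0 = 0" by (simp add: levy_exponent_def)
    show "Re (levy_exponent \<mu> z) \<le> 0" for z
    proof -
      have "0 \<le> (LINT u|\<mu>. exp (0 * u) * (1 - cos (z * u)))"
        by (intro integral_nonneg_AE AE_I2 mult_nonneg_nonneg) simp_all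
      then show ?thesis unfolding Re_levy_exponent by linarith
    qed
    show "4 * Re (levy_exponent \<mu> z) \<le> Re (levy_exponent \<mu> (2 * z))" for z by (rule levy_exponent_doubling)
    show "AE \<omega> in M. \<Lambda> {} \<omega> = 0" using inc[of 0 0] by simp
    fix x y z :: real assume xy: "x < y"
    have b: "{x<..y} \<in> bounded_borel" by (simp add: bounded_borel_def)
    have "distr M borel (\<Lambda> {x<..y}) = distr M borel (\<lambda>\<omega>. Z y \<omega> - Z x \<omega>)"
    proof (rule distr_cong_AE[OF refl refl inc])
      show "\<Lambda> {x<..y} \<in> borel_measurable M" using scat b unfolding independently_scattered_def by blast
      show "(\<lambda>\<omega>. Z y \<omega> - Z x \<omega>) \<in> borel_measurable M" by (intro borel_measurable_diff Zm)
    qed (use xy in simp)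
    then show "char (distr M borel (\<Lambda> {x<..y})) z = exp (of_real (y - x) * levy_exponent \<mu> z)"
      using Zc xy by (simp only:)
  qed
qed

lemma kernel_nonneg: "0 < t \<Longrightarrow> 0 \<le> frac_kernel H t s"
  by (subst ker_scale) (simp_all only: mult_nonneg_nonneg powr_ge_zero ker_bounds(1))

text \<open>The left tail is of order |s|^(a-1) with a > 0, so [-2 S t, - S t] alone contributes a
  multiple of S^a.\<close>

lemma kernel_not_integrable:
  assumes t: "0 < t"
  shows "(\<integral>\<^sup>+s. ennreal (frac_kernel H t s) \<partial>lborel) = \<infinity>"
proof -
  define A where "A = t * t powr a * (c * (a * 4 powr (a - 1)))"
  have A: "0 < A" using t c_pos a_bounds by (simp add: A_def)
  have le: "ennreal (A * S powr a) \<le> (\<integral>\<^sup>+s. ennreal (frac_kernel H t s) \<partial>lborel)" if S: "1 \<le> S" for S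
  proof -
    define q where "q = t powr a * (c * (a * (4 * S) powr (a - 1)))"
    have q: "0 \<le> q" using c_pos a_bounds by (simp add: q_def)
    have low: "q \<le> frac_kernel H t s" if s: "- (2 * S * t) \<le> s" "s \<le> - (S * t)" for s
    proof -
      define r where "r = - s / t"
      have r: "S \<le> r" "r \<le> 2 * S"
        unfolding r_def pos_le_divide_eq[OF t] pos_divide_le_eq[OF t] using s by simp_all
      have "c * (a * (4 * S) powr (a - 1)) \<le> c * (a * (2 * r) powr (a - 1))"
        using r S a_bounds c_pos by (intro mult_left_mono powr_mono2') simp_all
      also have "\<dots> \<le> ker (- r)" using r S by (intro ker_ge_tail) simp
      finally have "q \<le> t powr a * ker (- r)" unfolding q_def by (rule mult_left_mono) simp
      moreover have "- r = s / t" by (simp add: r_def)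
      ultimately show ?thesis by (simp only: ker_scale[OF t, of s])
    qed
    have "S powr (a - 1) * S = S powr a" using S by (simp add: powr_diff)
    then have "A * S powr a = q * (S * t)" using S by (simp add: A_def q_def powr_mult mult_ac)
    then have "ennreal (A * S powr a) = (\<integral>\<^sup>+s. ennreal q * indicator {- (2 * S * t)..- (S * t)} s \<partial>lborel)"
      using S t q by (simp add: nn_integral_cmult ennreal_mult)
    also have "\<dots> \<le> (\<integral>\<^sup>+s. ennreal (frac_kernel H t s) \<partial>lborel)"
    proof (rule nn_integral_mono)
      fix s :: real
      show "ennreal q * indicator {- (2 * S * t)..- (S * t)} s \<le> ennreal (frac_kernel H t s)"
        using ennreal_leI[OF low[of s]] by (cases "s \<in> {- (2 * S * t)..- (S * t)}") simp_all
    qed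
    finally show ?thesis .
  qed
  show ?thesis
  proof (rule ccontr)
    assume "\<not> ?thesis"
    then obtain R where R: "0 \<le> R" "(\<integral>\<^sup>+s. ennreal (frac_kernel H t s) \<partial>lborel) = ennreal R"
      by (cases "\<integral>\<^sup>+s. ennreal (frac_kernel H t s) \<partial>lborel") auto
    have "filterlim (\<lambda>S. A * S powr a) at_top at_top" using A a_bounds by real_asymp
    then have "\<forall>\<^sub>F S in at_top. R + 1 \<le> A * S powr a \<and> 1 \<le> S"
      by (intro eventually_conj eventually_ge_at_top) (simp add: filterlim_at_top)
    then obtain S where S: "R + 1 \<le> A * S powr a \<and> 1 \<le> S"
      using eventually_happens'[OF trivial_limit_at_top_linorder] by blast
    then have "ennreal (A * S powr a) \<le> ennreal R" using le[of S] R(2) by simp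
    then have "A * S powr a \<le> R" using R(1) by (simp only: ennreal_le_iff)
    then show False using S by linarith
  qed
qed

text \<open>The drift part \<open>mean * frac_kernel\<close> of the exponent is not integrable over the line, so the
  existence of the stochastic integral forces \<open>mean = 0\<close>.\<close>

lemma stoch_integral_char:
  assumes M: "prob_space M" and Z: "levy_process M Z \<mu>" and t: "0 < t"
    and I: "stoch_integral M Z (frac_kernel H t) X"
  shows "mean = 0"
    and "char (distr M borel X) z = exp (of_real t * Q.cumul (\<i> * of_real (z * t powr a)))"
proof -
  interpret prob_space M by (rule M)
  let ?g = "frac_kernel H t"
  obtain \<Lambda> G where GG: "random_measure_of M Z \<Lambda> \<and> (\<forall>n::nat. simple_integrand (G n)) \<and> (AE s in lborel. (\<lambda>n. G n s) \<longlonglongrightarrow> ?g s) \<and>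
      (\<forall>A\<in>sets borel. \<exists>Y. converges_in_prob M (\<lambda>n. simple_stoch_integral \<Lambda> A (G n)) Y) \<and>
      converges_in_prob M (\<lambda>n. simple_stoch_integral \<Lambda> UNIV (G n)) X"
    using I unfolding stoch_integral_def by (elim exE) (rule that)
  note \<Lambda> = GG[THEN conjunct1]
    and G = GG[THEN conjunct2, THEN conjunct1, THEN spec]
    and ae = GG[THEN conjunct2, THEN conjunct2, THEN conjunct1]
    and conv = GG[THEN conjunct2, THEN conjunct2, THEN conjunct2, THEN conjunct1, THEN bspec]
    and X = GG[THEN conjunct2, THEN conjunct2, THEN conjunct2, THEN conjunct2]
  interpret sc: scattered M \<Lambda> "levy_exponent \<mu>" by (rule levy_scattered[OF M Z \<Lambda>])
  obtain B where B: "\<And>k. B k \<in> sets borel" "\<And>k. B k \<subseteq> {- real k..real k}" "incseq B"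
      "AE s in lborel. s \<in> (\<Union>k. B k)" "\<And>k s. s \<in> B k \<Longrightarrow> \<bar>?g s\<bar> \<le> real k"
    and lim: "\<And>z. (\<lambda>k. exp (LINT s:B k|lborel. levy_exponent \<mu> (z * ?g s))) \<longlonglongrightarrow> char (distr M borel X) z"
    and nz: "\<And>z. char (distr M borel X) z \<noteq> 0"
    by (rule sc.char_stoch_limit[OF G ae simple_integrand_measurable[OF G] ker_measurable conv X]) (assumption, rule that)
  define \<kappa> where "\<kappa> z = of_real t * Q.cumul (\<i> * of_real (z * t powr a))" for z
  have cumul_int: "integrable lborel (\<lambda>s. mu.cumul (\<i> * of_real (z * ?g s)))" for z
  proof -
    have "integrable lborel (\<lambda>s. mu.cumul (\<i> * of_real (z * t powr a) * of_real (ker (0 + inverse t * s))))"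
      using lborel_integrable_real_affine[OF mu_cumul_integrable[of "\<i> * of_real (z * t powr a)"], of "inverse t" 0] t by simp
    then show ?thesis by (simp add: ker_scale[OF t] divide_inverse mult_ac)
  qed
  have \<kappa>: "\<kappa> z = (LINT s|lborel. mu.cumul (\<i> * of_real (z * ?g s)))" for z
  proof -
    have "(LINT s|lborel. mu.cumul (\<i> * of_real (z * ?g s))) = t *\<^sub>R (LINT s|lborel. mu.cumul (\<i> * of_real (z * (t powr a * ker s))))"
      by (rule integral_scale[OF t])
    also have "(LINT s|lborel. mu.cumul (\<i> * of_real (z * (t powr a * ker s)))) = Q.cumul (\<i> * of_real (z * t powr a))"
      unfolding Q_cumul by (intro Bochner_Integration.integral_cong refl) (simp add: mult_ac)
    finally show ?thesis by (simp add: \<kappa>_def scaleR_conv_of_real)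
  qed
  have Bm: "B k \<in> sets lborel" for k unfolding sets_lborel by (rule B(1))
  have gm: "?g \<in> borel_measurable lborel" using ker_measurable[of t] by (simp only: measurable_lborel1 measurable_lborel2)
  have fin: "emeasure lborel (B k) < \<infinity>" for k
    by (rule emeasure_bounded_finite[OF bounded_subset[OF bounded_closed_interval B(2)]])
  have g_int: "integrable lborel (\<lambda>s. indicator (B k) s *\<^sub>R ?g s)" for k
  proof (rule Bochner_Integration.integrable_bound)
    show "integrable lborel (\<lambda>s. indicator (B k) s *\<^sub>R real k)"
      by (intro integrable_scaleR_left integrable_real_indicator fin Bm)
    show "(\<lambda>s. indicator (B k) s *\<^sub>R ?g s) \<in> borel_measurable lborel"
      by (intro borel_measurable_scaleR borel_measurable_indicator Bm gm)
    show "AE s in lborel. norm (indicator (B k) s *\<^sub>R ?g s) \<le> norm (indicator (B k) s *\<^sub>R real k)"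
    proof (rule AE_I2)
      fix s show "norm (indicator (B k) s *\<^sub>R ?g s) \<le> norm (indicator (B k) s *\<^sub>R real k)"
        using B(5)[of s k] by (cases "s \<in> B k") simp_all
    qed
  qed
  define I where "I k = (LINT s|lborel. indicator (B k) s *\<^sub>R ?g s)" for k
  define J where "J z k = (LINT s|lborel. indicator (B k) s *\<^sub>R mu.cumul (\<i> * of_real (z * ?g s)))" for z k
  \<comment> \<open>The fully compensated part is integrable over the whole line and will converge;
    the drift contributes a pure phase, with the kernel integral over \<open>B k\<close> as its only
    k-dependence.\<close>
  have split: "(LINT s:B k|lborel. levy_exponent \<mu> (z * ?g s)) = J z k + \<i> * of_real (z * (mean * I k))" for z k
  proof -
    have i1: "integrable lborel (\<lambda>s. indicator (B k) s *\<^sub>R mu.cumul (\<i> * of_real (z * ?g s)))"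
      by (intro integrable_mult_indicator Bm cumul_int)
    have i2: "integrable lborel (\<lambda>s. (\<i> * of_real (z * mean)) * of_real (indicator (B k) s *\<^sub>R ?g s))"
      by (intro integrable_mult_right integrable_of_real g_int)
    have "(LINT s:B k|lborel. levy_exponent \<mu> (z * ?g s)) = (LINT s|lborel. indicator (B k) s *\<^sub>R mu.cumul (\<i> * of_real (z * ?g s))
        + (\<i> * of_real (z * mean)) * of_real (indicator (B k) s *\<^sub>R ?g s))"
      unfolding set_lebesgue_integral_def levy_exponent_eq
      by (intro Bochner_Integration.integral_cong refl) (simp add: scaleR_conv_of_real algebra_simps)
    also have "\<dots> = J z k + (LINT s|lborel. (\<i> * of_real (z * mean)) * of_real (indicator (B k) s *\<^sub>R ?g s))"
      unfolding J_def by (rule Bochner_Integration.integral_add[OF i1 i2])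
    also have "(LINT s|lborel. (\<i> * of_real (z * mean)) * of_real (indicator (B k) s *\<^sub>R ?g s)) = (\<i> * of_real (z * mean)) * of_real (I k)"
      unfolding I_def by (simp only: integral_mult_right_zero integral_complex_of_real)
    finally show ?thesis by (simp add: mult_ac)
  qed
  have ev: "AE s in lborel. \<forall>\<^sub>F k in sequentially. s \<in> B k"
    using B(4)
  proof eventually_elim
    case (elim s)
    then obtain k0 where "s \<in> B k0" by blast
    then have "s \<in> B k" if "k0 \<le> k" for k using incseqD[OF B(3) that] by blast
    then show ?case unfolding eventually_sequentially by blast
  qed
  have Jlim: "(\<lambda>k. J z k) \<longlonglongrightarrow> \<kappa> z" for z
    unfolding J_def \<kappa>
  proof (rule integral_dominated_convergence[where w = "\<lambda>s. norm (mu.cumul (\<i> * of_real (z * ?g s)))"])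
    show "(\<lambda>s. mu.cumul (\<i> * of_real (z * ?g s))) \<in> borel_measurable lborel" by (rule borel_measurable_integrable[OF cumul_int])
    show "(\<lambda>s. indicator (B k) s *\<^sub>R mu.cumul (\<i> * of_real (z * ?g s))) \<in> borel_measurable lborel" for k
      by (intro borel_measurable_scaleR borel_measurable_indicator Bm borel_measurable_integrable[OF cumul_int])
    show "integrable lborel (\<lambda>s. norm (mu.cumul (\<i> * of_real (z * ?g s))))" by (rule integrable_norm[OF cumul_int])
    show "AE s in lborel. norm (indicator (B k) s *\<^sub>R mu.cumul (\<i> * of_real (z * ?g s))) \<le> norm (mu.cumul (\<i> * of_real (z * ?g s)))" for k
      by (rule AE_I2) (simp add: indicator_def)
    show "AE s in lborel. (\<lambda>k. indicator (B k) s *\<^sub>R mu.cumul (\<i> * of_real (z * ?g s))) \<longlonglongrightarrow> mu.cumul (\<i> * of_real (z * ?g s))"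
      using ev
    proof eventually_elim
      case (elim s)
      then have "\<forall>\<^sub>F k in sequentially. indicator (B k) s *\<^sub>R mu.cumul (\<i> * of_real (z * ?g s)) = mu.cumul (\<i> * of_real (z * ?g s))"
        by eventually_elim simp
      then show ?case by (rule tendsto_eventually)
    qed
  qed
  \<comment> \<open>Dividing by the convergent, nonvanishing part isolates the phases. Their limit
    is a quotient continuous at 0, in the form required by
    \<open>exponential_phases_diverge\<close>.\<close>
  have phase: "(\<lambda>k. iexp (z * (mean * I k))) \<longlonglongrightarrow> char (distr M borel X) z / exp (\<kappa> z)" for z
  proof -
    have "(\<lambda>k. exp (J z k + \<i> * of_real (z * (mean * I k))) / exp (J z k)) \<longlonglongrightarrow> char (distr M borel X) z / exp (\<kappa> z)"
      using lim[of z] unfolding split by (intro tendsto_divide tendsto_exp Jlim) simp_all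
    then show ?thesis by (simp add: exp_add)
  qed
  have Xm: "X \<in> borel_measurable M" using X unfolding converges_in_prob_def by (rule conjunct1)
  interpret D: real_distribution "distr M borel X" using Xm by (rule real_distribution_distr)
  show m0: "mean = 0"
  proof (rule ccontr)
    assume m: "mean \<noteq> 0"
    have l: "isCont (\<lambda>z::real. \<i> * complex_of_real (z * t powr a)) 0"
      by (intro continuous_intros)
    have "isCont (\<lambda>z. Q.cumul (\<i> * complex_of_real (z * t powr a))) 0"
      by (rule isCont_o2[OF l DERIV_isCont[OF Q.deriv_cumul]])
    then have "isCont \<kappa> 0" unfolding \<kappa>_def by (rule continuous_mult_left)
    then have "isCont (\<lambda>z. exp (\<kappa> z)) 0" by (rule isCont_exp')
    then have "isCont (\<lambda>z. char (distr M borel X) z / exp (\<kappa> z)) 0"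
      by (rule isCont_divide[OF D.isCont_char]) (rule exp_not_eq_zero)
    moreover have "filterlim (\<lambda>k. \<bar>mean * I k\<bar>) at_top sequentially"
    proof -
      have I_nn: "ennreal (I k) = (\<integral>\<^sup>+s. ennreal (?g s) * indicator (B k) s \<partial>lborel)" for k
      proof -
        have "ennreal (I k) = (\<integral>\<^sup>+s. ennreal (indicator (B k) s *\<^sub>R ?g s) \<partial>lborel)"
          unfolding I_def by (rule nn_integral_eq_integral[OF g_int, symmetric])
            (intro AE_I2 scaleR_nonneg_nonneg indicator_pos_le kernel_nonneg t)
        also have "\<dots> = (\<integral>\<^sup>+s. ennreal (?g s) * indicator (B k) s \<partial>lborel)"
          by (intro nn_integral_cong) (simp add: indicator_def)
        finally show ?thesis .
      qed
      have "(\<lambda>k. \<integral>\<^sup>+s. ennreal (?g s) * indicator (B k) s \<partial>lborel) \<longlonglongrightarrow> (\<integral>\<^sup>+s. ennreal (?g s) * indicator (\<Union>k. B k) s \<partial>lborel)"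
      proof -
        have "(SUP k. \<integral>\<^sup>+s. ennreal (?g s) * indicator (B k) s \<partial>lborel) = (\<integral>\<^sup>+s. (SUP k. ennreal (?g s) * indicator (B k) s) \<partial>lborel)"
        proof (rule nn_integral_monotone_convergence_SUP[symmetric])
          show "incseq (\<lambda>k s. ennreal (?g s) * indicator (B k) s)"
            using B(3) by (auto simp: incseq_def le_fun_def indicator_def)
          show "(\<lambda>s. ennreal (?g s) * indicator (B k) s) \<in> borel_measurable lborel" for k
            by (intro borel_measurable_times_ennreal measurable_compose[OF gm measurable_ennreal] borel_measurable_indicator Bm)
        qed
        also have "\<dots> = (\<integral>\<^sup>+s. ennreal (?g s) * indicator (\<Union>k. B k) s \<partial>lborel)"
        proof (intro nn_integral_cong antisym)
          fix s
          show "(SUP k. ennreal (?g s) * indicator (B k) s) \<le> ennreal (?g s) * indicator (\<Union>k. B k) s"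
            by (rule SUP_least) (simp add: indicator_def)
          show "ennreal (?g s) * indicator (\<Union>k. B k) s \<le> (SUP k. ennreal (?g s) * indicator (B k) s)"
          proof (cases "s \<in> (\<Union>k. B k)")
            case True
            then obtain k where "s \<in> B k" by blast
            then show ?thesis by (intro SUP_upper2[of k]) (auto simp: indicator_def)
          qed simp
        qed
        finally have eq: "(SUP k. \<integral>\<^sup>+s. ennreal (?g s) * indicator (B k) s \<partial>lborel) = (\<integral>\<^sup>+s. ennreal (?g s) * indicator (\<Union>k. B k) s \<partial>lborel)" .
        have "incseq (\<lambda>k. \<integral>\<^sup>+s. ennreal (?g s) * indicator (B k) s \<partial>lborel)"
          by (intro monoI nn_integral_mono mult_left_mono indicator_leI) (simp_all add: subsetD[OF incseqD[OF B(3)]])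
        from LIMSEQ_SUP[OF this] show ?thesis unfolding eq .
      qed
      moreover have "(\<integral>\<^sup>+s. ennreal (?g s) * indicator (\<Union>k. B k) s \<partial>lborel) = \<infinity>"
      proof -
        have "(\<integral>\<^sup>+s. ennreal (?g s) * indicator (\<Union>k. B k) s \<partial>lborel) = (\<integral>\<^sup>+s. ennreal (?g s) \<partial>lborel)"
          by (rule nn_integral_cong_AE) (use B(4) in eventually_elim, simp)
        then show ?thesis using kernel_not_integrable[OF t] by simp
      qed
      ultimately have top: "(\<lambda>k. ennreal (I k)) \<longlonglongrightarrow> \<infinity>" unfolding I_nn by simp
      have "filterlim I at_top sequentially"
        unfolding filterlim_at_top
      proof
        fix r :: real
        have "\<forall>\<^sub>F k in sequentially. ennreal \<bar>r\<bar> < ennreal (I k)" using order_tendstoD(1)[OF top, of "ennreal \<bar>r\<bar>"] by simp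
        then show "\<forall>\<^sub>F k in sequentially. r \<le> I k"
        proof eventually_elim
          case (elim k)
          then have "\<bar>r\<bar> < I k" by (simp add: ennreal_less_iff)
          then show ?case by linarith
        qed
      qed
      then have "filterlim (\<lambda>k. \<bar>mean\<bar> * I k) at_top sequentially"
        using m by (intro filterlim_tendsto_pos_mult_at_top[OF tendsto_const]) simp_all
      then show ?thesis
        by (rule filterlim_at_top_mono) (simp add: abs_mult mult_left_mono)
    qed
    ultimately show False by (rule exponential_phases_diverge[OF phase])
  qed
  \<comment> \<open>With \<open>mean = 0\<close> every phase equals 1, so the limit just found is
    1.\<close>
  have "char (distr M borel X) z / exp (\<kappa> z) = 1"
    using phase[of z] m0 by (simp add: LIMSEQ_const_iff)
  then show "char (distr M borel X) z = exp (of_real t * Q.cumul (\<i> * of_real (z * t powr a)))"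
    by (simp add: \<kappa>_def)
qed

end

section \<open>Asymptotics of the density\<close>

context saddle
begin

lemma char_decay:
  assumes "t0 \<le> t" "0 < r"
  shows "exp_decaying (\<lambda>z. exp (of_real t * cumul (\<i> * of_real (z * r)))) (exp (t * b * W)) (t * b * r)"
proof
  have "continuous_on UNIV cumul" by (rule holomorphic_on_imp_continuous_on[OF cumul_holomorphic])
  then have "continuous_on UNIV (\<lambda>z. cumul (\<i> * of_real (z * r)))"
    by (rule continuous_on_compose2) (auto intro!: continuous_intros)
  then have "continuous_on UNIV (\<lambda>z. exp (of_real t * cumul (\<i> * of_real (z * r))))"
    by (intro continuous_intros)
  then show "(\<lambda>z. exp (of_real t * cumul (\<i> * of_real (z * r)))) \<in> borel_measurable borel"
    by (rule borel_measurable_continuous_onI)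
next
  fix z :: real
  have "Re (cumul (\<i> * of_real (z * r))) = Re (cumul (of_real 0)) + Re (tilted 0 (z * r))"
    using Re_cumul_line[of 0 "z * r"] by simp
  also have "cumul (of_real 0) = 0" by (simp add: cumul_def)
  finally have "Re (cumul (\<i> * of_real (z * r))) \<le> - b * (\<bar>z * r\<bar> - W)"
    using decay_far[of 0 "z * r"] by simp
  then have "t * Re (cumul (\<i> * of_real (z * r))) \<le> t * (- b * (\<bar>z * r\<bar> - W))"
    by (rule mult_left_mono) (use assms pos in simp)
  also have "\<dots> = t * b * W + - (t * b * r) * \<bar>z\<bar>" using assms by (simp add: abs_mult algebra_simps)
  finally have "t * Re (cumul (\<i> * of_real (z * r))) \<le> t * b * W + - (t * b * r) * \<bar>z\<bar>" .
  then show "norm (exp (of_real t * cumul (\<i> * of_real (z * r)))) \<le> exp (t * b * W) * exp (- (t * b * r) * \<bar>z\<bar>)"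
    unfolding norm_exp_eq_Re mult_exp_exp by (simp del: of_real_mult)
qed (use assms pos in simp)

text \<open>The substitution w = r z removes the scale r, which will be t^(H - 1/2); the point x = r
  t y then belongs to the saddle point equation at y.\<close>

lemma pdf_saddle:
  assumes \<xi>: "0 \<le> \<xi>" and t: "t0 \<le> t" and y: "cumul1 (of_real \<xi>) = of_real y" and r: "0 < r"
  shows "exp_decaying.pdf (\<lambda>z. exp (of_real t * cumul (\<i> * of_real (z * r)))) (r * (t * y))
    = exp (t * (Re (cumul (of_real \<xi>)) - \<xi> * y)) * Re (LINT w|lborel. exp (of_real t * tilted \<xi> w)) / (2 * pi * r)"
proof -
  let ?J = "LINT w|lborel. exp (of_real t * tilted \<xi> w)"
  let ?g = "\<lambda>w::real. exp (of_real t * cumul (\<i> * of_real w) - \<i> * of_real w * of_real (t * y))"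
  interpret D: exp_decaying "\<lambda>z. exp (of_real t * cumul (\<i> * of_real (z * r)))" "exp (t * b * W)" "t * b * r"
    by (rule char_decay[OF t r])
  have "D.fourier 0 (r * (t * y)) = (LINT z|lborel. ?g (0 + r * z))"
    unfolding D.fourier_def
    by (intro Bochner_Integration.integral_cong refl) (simp add: mult_exp_exp mult_ac)
  moreover have "integral\<^sup>L lborel ?g = r *\<^sub>R (LINT z|lborel. ?g (0 + r * z))"
    using lborel_integral_real_affine[of r ?g 0] r by simp
  ultimately have "r *\<^sub>R D.fourier 0 (r * (t * y)) = integral\<^sup>L lborel ?g" by simp
  then have "r *\<^sub>R D.fourier 0 (r * (t * y)) = of_real (exp (t * (Re (cumul (of_real \<xi>)) - \<xi> * y))) * ?J"
    unfolding saddle_shift[OF \<xi> t y] .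
  then have "Re (r *\<^sub>R D.fourier 0 (r * (t * y))) = Re (of_real (exp (t * (Re (cumul (of_real \<xi>)) - \<xi> * y))) * ?J)" by (rule arg_cong)
  then have "r * Re (D.fourier 0 (r * (t * y))) = exp (t * (Re (cumul (of_real \<xi>)) - \<xi> * y)) * Re ?J"
    by (simp only: scaleR_conv_of_real[symmetric] scaleR_complex.sel)
  then show ?thesis unfolding D.pdf_def using r by (simp add: field_simps)
qed

lemma pdf_relative_error:
  assumes \<xi>: "0 \<le> \<xi>" and t: "t0 \<le> t" and y: "cumul1 (of_real \<xi>) = of_real y" and r: "0 < r"
    and err: "norm (of_real (sqrt (t * mom 2 \<xi>)) * (LINT w|lborel. exp (of_real t * tilted \<xi> w)) - sqrt (2 * pi)) < e * sqrt (2 * pi)"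
  shows "\<bar>exp_decaying.pdf (\<lambda>z. exp (of_real t * cumul (\<i> * of_real (z * r)))) (r * (t * y))
    / (1 / sqrt (2 * pi * (r\<^sup>2 * t) * mom 2 \<xi>) * exp (t * (Re (cumul (of_real \<xi>)) - \<xi> * y))) - 1\<bar> < e"
proof -
  define J where "J = (LINT w|lborel. exp (of_real t * tilted \<xi> w))"
  define E where "E = exp (t * (Re (cumul (of_real \<xi>)) - \<xi> * y))"
  define s where "s = sqrt (t * mom 2 \<xi>)"
  define \<rho> where "\<rho> = sqrt (2 * pi)"
  have pos': "0 < \<rho>" "0 < E" "\<rho> * \<rho> = 2 * pi" by (simp_all add: \<rho>_def E_def)
  have sq: "sqrt (2 * pi * (r\<^sup>2 * t) * mom 2 \<xi>) = \<rho> * r * s"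
    using r by (simp add: s_def \<rho>_def real_sqrt_mult)
  have "E * Re J / (2 * pi * r) / (1 / (\<rho> * r * s) * E) = Re J * s / \<rho>"
    unfolding pos'(3)[symmetric] using pos' r by (simp add: field_simps)
  then have "exp_decaying.pdf (\<lambda>z. exp (of_real t * cumul (\<i> * of_real (z * r)))) (r * (t * y))
      / (1 / sqrt (2 * pi * (r\<^sup>2 * t) * mom 2 \<xi>) * E) = Re J * s / \<rho>"
    unfolding pdf_saddle[OF \<xi> t y r] sq J_def[symmetric] E_def[symmetric] .
  moreover have "\<bar>Re J * s / \<rho> - 1\<bar> < e"
  proof -
    have "\<bar>Re (of_real s * J - of_real \<rho>)\<bar> \<le> norm (of_real s * J - of_real \<rho>)" by (rule abs_Re_le_cmod)
    also have "\<dots> < e * \<rho>" using err unfolding J_def s_def \<rho>_def .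
    finally have "\<bar>s * Re J - \<rho>\<bar> < e * \<rho>" by simp
    moreover have "Re J * s / \<rho> - 1 = (s * Re J - \<rho>) / \<rho>" using pos' by (simp add: field_simps)
    ultimately show ?thesis using pos' by (simp add: abs_divide pos_divide_less_eq)
  qed
  ultimately show ?thesis unfolding E_def by simp
qed

lemma rcumul1_mono_imp:
  assumes "cumul1 (of_real \<xi>) = of_real y" "Re (cumul1 (of_real q)) < y"
  shows "q \<le> \<xi>"
proof (rule ccontr)
  assume "\<not> q \<le> \<xi>"
  then have "Re (cumul1 (of_real \<xi>)) < Re (cumul1 (of_real q))" by (intro rcumul1_less) simp
  then show False using assms by simp
qed

text \<open>Reduces t + x -> infinity to the alternative of \<open>saddle_uniform\<close>, large t
  or large saddle point. \<open>exponent\<close> stands for H - 1/2, and x enters the saddle point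
  only through x t^(- exponent - 1).\<close>

lemma pdf_asymptotics:
  fixes \<Xi> :: "real \<Rightarrow> real"
  assumes \<Xi>: "\<And>y. 0 \<le> y \<Longrightarrow> cumul1 (of_real (\<Xi> y)) = of_real y"
    and ex: "exponent > (0::real)"
  shows "((\<lambda>(t, x). exp_decaying.pdf (\<lambda>z. exp (of_real t * cumul (\<i> * of_real (z * t powr exponent)))) x
      / (1 / sqrt (2 * pi * t powr (2 * exponent + 1) * mom 2 (\<Xi> (x * t powr (- exponent - 1))))
        * exp (t * (Re (cumul (of_real (\<Xi> (x * t powr (- exponent - 1))))) - \<Xi> (x * t powr (- exponent - 1)) * (x * t powr (- exponent - 1))))))
    \<longlongrightarrow> 1) (inf (filtercomap (\<lambda>(t, x). t + x) at_top) (principal ({t0..} \<times> {0..})))"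
proof (rule tendstoI)
  fix e :: real assume e: "0 < e"
  obtain q where q: "0 < q" and err: "\<And>\<xi> t. 0 \<le> \<xi> \<Longrightarrow> t0 \<le> t \<Longrightarrow> q \<le> t \<or> q \<le> \<xi> \<Longrightarrow>
      norm (of_real (sqrt (t * mom 2 \<xi>)) * (LINT w|lborel. exp (of_real t * tilted \<xi> w)) - sqrt (2 * pi)) < e * sqrt (2 * pi)"
    by (rule saddle_uniform[of "e * sqrt (2 * pi)"]) (use e in simp, rule that)
  define B where "B = Re (cumul1 (of_real q))"
  \<comment> \<open>If t < q, then t + x >= N forces x >= (|B| + 1) t^(exponent + 1). The rescaled y
    then exceeds B, the first derivative at q, so the saddle point lies beyond q.\<close>
  define N where "N = q + (\<bar>B\<bar> + 1) * q powr (exponent + 1)"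
  have main: "dist (exp_decaying.pdf (\<lambda>z. exp (of_real t * cumul (\<i> * of_real (z * t powr exponent)))) x
      / (1 / sqrt (2 * pi * t powr (2 * exponent + 1) * mom 2 (\<Xi> (x * t powr (- exponent - 1))))
        * exp (t * (Re (cumul (of_real (\<Xi> (x * t powr (- exponent - 1))))) - \<Xi> (x * t powr (- exponent - 1)) * (x * t powr (- exponent - 1)))))) 1 < e"
    if N: "N \<le> t + x" and t: "t0 \<le> t" and x: "0 \<le> x" for t x
  proof -
    have t_pos: "0 < t" using t pos by simp
    define y where "y = x * t powr (- exponent - 1)"
    define r where "r = t powr exponent"
    have y0: "0 \<le> y" using x by (simp add: y_def)
    have r: "0 < r" using t_pos by (simp add: r_def)
    have "t powr exponent * (t powr 1 * t powr (- exponent - 1)) = 1"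
      unfolding powr_add[symmetric] using t_pos by simp
    then have xy: "x = r * (t * y)" using t_pos by (simp add: r_def y_def mult_ac)
    have "t powr (2 * exponent + 1) = (t powr exponent)\<^sup>2 * t powr 1"
      unfolding power2_eq_square powr_add[symmetric] by simp
    then have rt: "t powr (2 * exponent + 1) = r\<^sup>2 * t" using t_pos by (simp add: r_def)
    have \<xi>0: "0 \<le> \<Xi> y"
    proof -
      obtain \<xi> where "0 \<le> \<xi>" "cumul1 (of_real \<xi>) = of_real y" by (rule ex_saddle_point[OF y0])
      then show ?thesis using cumul1_inject[of "\<Xi> y" \<xi>] \<Xi>[OF y0] by simp
    qed
    have "q \<le> t \<or> q \<le> \<Xi> y"
    proof (cases "q \<le> t")
      case False
      have "t powr (exponent + 1) \<le> q powr (exponent + 1)"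
        using False t_pos ex by (intro powr_mono2) simp_all
      then have "(\<bar>B\<bar> + 1) * t powr (exponent + 1) \<le> (\<bar>B\<bar> + 1) * q powr (exponent + 1)"
        by (intro mult_left_mono) simp_all
      also have "\<dots> \<le> x" using False N by (simp add: N_def)
      finally have "(\<bar>B\<bar> + 1) * t powr (exponent + 1) * t powr (- exponent - 1) \<le> y"
        unfolding y_def by (rule mult_right_mono) simp
      moreover have "t powr (exponent + 1) * t powr (- exponent - 1) = 1"
        unfolding powr_add[symmetric] using t_pos by simp
      ultimately have "\<bar>B\<bar> + 1 \<le> y" by (simp add: mult.assoc)
      then have "B < y" by linarith
      then show ?thesis using rcumul1_mono_imp[OF \<Xi>[OF y0]] by (simp add: B_def)
    qed simp
    from pdf_relative_error[OF \<xi>0 t \<Xi>[OF y0] r err[OF \<xi>0 t this]]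
    show ?thesis unfolding y_def[symmetric] dist_real_def rt r_def[symmetric] xy[symmetric] .
  qed
  show "\<forall>\<^sub>F p in inf (filtercomap (\<lambda>(t, x). t + x) at_top) (principal ({t0..} \<times> {0..})).
      dist (case p of (t, x) \<Rightarrow> exp_decaying.pdf (\<lambda>z. exp (of_real t * cumul (\<i> * of_real (z * t powr exponent)))) x
      / (1 / sqrt (2 * pi * t powr (2 * exponent + 1) * mom 2 (\<Xi> (x * t powr (- exponent - 1))))
        * exp (t * (Re (cumul (of_real (\<Xi> (x * t powr (- exponent - 1))))) - \<Xi> (x * t powr (- exponent - 1)) * (x * t powr (- exponent - 1)))))) 1 < e"
    unfolding eventually_inf_principal eventually_filtercomap_at_top_linorder
  proof (intro exI[of _ N] allI impI)
    fix p :: "real \<times> real"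
    assume "N \<le> (case p of (t, x) \<Rightarrow> t + x)" "p \<in> {t0..} \<times> {0..}"
    then show "dist (case p of (t, x) \<Rightarrow> exp_decaying.pdf (\<lambda>z. exp (of_real t * cumul (\<i> * of_real (z * t powr exponent)))) x
      / (1 / sqrt (2 * pi * t powr (2 * exponent + 1) * mom 2 (\<Xi> (x * t powr (- exponent - 1))))
        * exp (t * (Re (cumul (of_real (\<Xi> (x * t powr (- exponent - 1))))) - \<Xi> (x * t powr (- exponent - 1)) * (x * t powr (- exponent - 1)))))) 1 < e"
      using main[of "fst p" "snd p"] by (cases p) (simp only: prod.case fst_conv snd_conv mem_Times_iff atLeast_iff)
  qed
qed

end

context frac_levy
begin

text \<open>Truncated and full compensation differ by a multiple of \<open>mean\<close>. The
  rotation - i z comes from the sign in the exponent of \<open>Psi\<close>, so z = i \<xi>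
  corresponds to the real tilt \<xi>.\<close>

lemma Psi_eq_cumul:
  assumes "mean = 0"
  shows "Psi \<mu> H 1 z = Q.cumul (- \<i> * z)"
proof -
  have "(LINT u|\<mu>. exp (- \<i> * z * of_real (ker s * u)) - 1 + \<i> * z * of_real (ker s * u * indicator {-1..1} u))
      = mu.cumul (- \<i> * z * of_real (ker s))" for s
  proof -
    let ?\<zeta> = "- \<i> * z * of_real (ker s)"
    have i: "integrable \<mu> (\<lambda>u. ?\<zeta> * of_real (u * (1 - indicator {-1..1} u)))"
      by (intro integrable_mult_right integrable_of_real mean_integrable)
    have "(LINT u|\<mu>. exp (- \<i> * z * of_real (ker s * u)) - 1 + \<i> * z * of_real (ker s * u * indicator {-1..1} u))
        = (LINT u|\<mu>. (exp (?\<zeta> * of_real u) - 1 - ?\<zeta> * of_real u) + ?\<zeta> * of_real (u * (1 - indicator {-1..1} u)))"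
      by (intro Bochner_Integration.integral_cong refl) (simp add: algebra_simps)
    also have "\<dots> = mu.cumul ?\<zeta> + (LINT u|\<mu>. ?\<zeta> * of_real (u * (1 - indicator {-1..1} u)))"
      unfolding mu.cumul_def by (rule Bochner_Integration.integral_add[OF mu.int_cumul i])
    also have "(LINT u|\<mu>. ?\<zeta> * of_real (u * (1 - indicator {-1..1} u))) = ?\<zeta> * of_real mean"
      unfolding mean_def by (simp only: integral_mult_right_zero integral_complex_of_real)
    finally show ?thesis using assms by simp
  qed
  then show ?thesis unfolding Psi_def Q_cumul by simp
qed

lemma Hfun_imaginary:
  assumes "mean = 0"
  shows "Hfun \<mu> H y (\<i> * of_real \<xi>) = of_real (Re (Q.cumul (of_real \<xi>)) - \<xi> * y)"
proof -
  have "Hfun \<mu> H y (\<i> * of_real \<xi>) = Q.cumul (of_real \<xi>) - of_real (\<xi> * y)"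
    by (simp add: Hfun_def Psi_eq_cumul[OF assms] flip: mult.assoc)
  then show ?thesis by (subst (asm) Q.cumul_Re) simp
qed

text \<open>The derivative at i \<xi> is i (y - cumul1 \<xi>), so the complex critical point
  equation becomes the real saddle point equation.\<close>

lemma Hfun_critical_iff:
  assumes "mean = 0"
  shows "(Hfun \<mu> H y has_field_derivative 0) (at (\<i> * of_real \<xi>)) \<longleftrightarrow> Q.cumul1 (of_real \<xi>) = of_real y"
proof -
  have eq: "Hfun \<mu> H y = (\<lambda>z. \<i> * z * of_real y + Q.cumul (- \<i> * z))"
    by (simp add: fun_eq_iff Hfun_def Psi_eq_cumul[OF assms])
  have "((\<lambda>z. - \<i> * z) has_field_derivative - \<i>) (at (\<i> * of_real \<xi>))"
    by (rule DERIV_cmult_Id)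
  from DERIV_chain2[OF Q.deriv_cumul this]
  have d1: "((\<lambda>z. Q.cumul (- \<i> * z)) has_field_derivative Q.cumul1 (- \<i> * (\<i> * of_real \<xi>)) * - \<i>) (at (\<i> * of_real \<xi>))" .
  have d2: "((\<lambda>z. \<i> * z * of_real y) has_field_derivative \<i> * of_real y) (at (\<i> * of_real \<xi>))"
    by (rule DERIV_cmult_right[OF DERIV_cmult_Id])
  have e1: "- \<i> * (\<i> * of_real \<xi>) = of_real \<xi>" by (simp flip: mult.assoc)
  have e2: "\<i> * of_real y + Q.cumul1 (of_real \<xi>) * - \<i> = \<i> * (of_real y - Q.cumul1 (of_real \<xi>))"
    by (simp add: algebra_simps)
  have d: "(Hfun \<mu> H y has_field_derivative \<i> * (of_real y - Q.cumul1 (of_real \<xi>))) (at (\<i> * of_real \<xi>))"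
    unfolding eq using DERIV_add[OF d2 d1] unfolding e1 e2 .
  show ?thesis
  proof
    assume "(Hfun \<mu> H y has_field_derivative 0) (at (\<i> * of_real \<xi>))"
    from DERIV_unique[OF d this] show "Q.cumul1 (of_real \<xi>) = of_real y" by simp
  next
    assume "Q.cumul1 (of_real \<xi>) = of_real y"
    with d show "(Hfun \<mu> H y has_field_derivative 0) (at (\<i> * of_real \<xi>))" by simp
  qed
qed

end

context frac_levy_asym
begin

lemma density_asymptotics:
  fixes M :: "'w measure" and Z ZH :: "real \<Rightarrow> 'w \<Rightarrow> real"
  assumes M: "prob_space M" and Z: "levy_process M Z \<mu>" and t0: "0 < t0"
    and I: "\<And>t. t0 \<le> t \<Longrightarrow> stoch_integral M Z (frac_kernel H t) (ZH t)"
  defines "p \<equiv> \<lambda>t. exp_decaying.pdf (\<lambda>z. exp (of_real t * Q.cumul (\<i> * of_real (z * t powr a))))"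
  shows "\<And>t x. t0 \<le> t \<Longrightarrow> 0 \<le> p t x"
    and "\<And>t. t0 \<le> t \<Longrightarrow> distributed M lborel (ZH t) (\<lambda>x. ennreal (p t x))"
    and "\<And>t. t0 \<le> t \<Longrightarrow> p t \<in> Cb_infinity"
    and "((\<lambda>(t, x). p t x /
               (1 / sqrt (2 * pi * t powr (2 * H) * Kfun \<mu> H (x * t powr (- H - 1/2)))
                * exp (t * Dfun \<mu> H (x * t powr (- H - 1/2)))))
             \<longlongrightarrow> 1)
             (inf (filtercomap (\<lambda>(t, x). t + x) at_top) (principal ({t0..} \<times> {0..})))"
proof -
  interpret prob_space M by (rule M)
  obtain b d W where "saddle (lborel \<Otimes>\<^sub>M \<mu>) (\<lambda>p. ker (fst p) * snd p) b d W t0"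
    using saddle_exists[OF t0] by (elim exE) (rule that)
  then interpret S: saddle "lborel \<Otimes>\<^sub>M \<mu>" "\<lambda>p. ker (fst p) * snd p" b d W t0 .
  have mean0: "mean = 0" by (rule stoch_integral_char(1)[OF M Z t0 I[OF order_refl]])
  have dec: "exp_decaying (\<lambda>z. exp (of_real t * Q.cumul (\<i> * of_real (z * t powr a)))) (exp (t * b * W)) (t * b * t powr a)"
    if "t0 \<le> t" for t
    by (rule S.char_decay[OF that]) (use that t0 in simp)
  show "p t \<in> Cb_infinity" if "t0 \<le> t" for t
    unfolding p_def by (rule exp_decaying.pdf_Cb_infinity[OF dec[OF that]])
  have ZHm: "ZH t \<in> borel_measurable M" if "t0 \<le> t" for t
    using I[OF that] unfolding stoch_integral_def converges_in_prob_def by (elim exE conjE)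
  have rd: "real_distribution (distr M borel (ZH t))" if "t0 \<le> t" for t
    by (rule real_distribution_distr[OF ZHm[OF that]])
  have t_pos: "0 < t" if "t0 \<le> t" for t using t0 that by simp
  show nn: "0 \<le> p t x" if "t0 \<le> t" for t x
    unfolding p_def
    by (rule exp_decaying.density_eqI(1)[OF dec[OF that] rd[OF that] stoch_integral_char(2)[OF M Z t_pos[OF that] I[OF that]]])
  show "distributed M lborel (ZH t) (\<lambda>x. ennreal (p t x))" if t: "t0 \<le> t" for t
  proof -
    have eq: "distr M borel (ZH t) = density lborel (\<lambda>x. ennreal (p t x))"
      unfolding p_def
      by (rule exp_decaying.density_eqI(2)[OF dec[OF t] rd[OF t] stoch_integral_char(2)[OF M Z t_pos[OF t] I[OF t]]])
    have "distr M lborel (ZH t) = distr M borel (ZH t)" by (rule distr_cong[OF refl sets_lborel refl])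
    moreover have "ZH t \<in> measurable M lborel"
      using ZHm[OF t] by (simp only: measurable_lborel1 measurable_lborel2)
    moreover have "(\<lambda>x. ennreal (p t x)) \<in> borel_measurable lborel"
    proof -
      have "continuous_on UNIV (p t)"
      proof -
        have "p t \<in> Cb_infinity" unfolding p_def by (rule exp_decaying.pdf_Cb_infinity[OF dec[OF t]])
        from spec[OF this[unfolded Cb_infinity_def mem_Collect_eq], of 0]
        have "\<forall>x. p t differentiable (at x)" unfolding funpow.simps id_apply by (rule conjunct1)
        then show ?thesis
          by (intro continuous_at_imp_continuous_on ballI differentiable_imp_continuous_within) (rule spec)
      qed
      then have "p t \<in> borel_measurable borel" by (rule borel_measurable_continuous_onI)
      then have "p t \<in> borel_measurable lborel" by (simp only: measurable_lborel1 measurable_lborel2)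
      then show ?thesis by (rule measurable_compose[OF _ measurable_ennreal])
    qed
    ultimately show ?thesis unfolding distributed_def eq[symmetric] by (intro conjI)
  qed
  \<comment> \<open>Strict monotonicity of the first derivative makes the definite description in
    \<open>crit_pt\<close> pick out any solution; for y >= 0 a solution exists by
    \<open>ex_saddle_point\<close>.\<close>
  have crit_unique: "crit_pt \<mu> H y = \<xi>" if "Q.cumul1 (of_real \<xi>) = of_real y" for y \<xi>
    unfolding crit_pt_def Hfun_critical_iff[OF mean0]
  proof (rule the_equality)
    show "Q.cumul1 (of_real \<xi>) = of_real y" by (rule that)
    show "\<xi>' = \<xi>" if "Q.cumul1 (of_real \<xi>') = of_real y" for \<xi>'
      by (rule S.cumul1_inject) (simp only: that \<open>Q.cumul1 (of_real \<xi>) = of_real y\<close>)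
  qed
  have crit: "Q.cumul1 (of_real (crit_pt \<mu> H y)) = of_real y" if y: "0 \<le> y" for y
  proof -
    obtain \<xi> where "Q.cumul1 (of_real \<xi>) = of_real y" by (rule S.ex_saddle_point[OF y])
    then show ?thesis by (simp only: crit_unique)
  qed
  have D: "Dfun \<mu> H y = Re (Q.cumul (of_real (crit_pt \<mu> H y))) - crit_pt \<mu> H y * y" for y
    unfolding Dfun_def Hfun_imaginary[OF mean0] by (rule Re_complex_of_real)
  \<comment> \<open>The term \<xi> y is linear in \<xi> and disappears in the second derivative; y
    enters only through the critical point.\<close>
  have K: "Kfun \<mu> H y = Q.mom 2 (crit_pt \<mu> H y)" for y
  proof -
    have "((\<lambda>\<xi>. Re (Q.cumul (of_real \<xi>)) - \<xi> * y) has_real_derivative Re (Q.cumul1 (of_real \<xi>)) - y) (at \<xi>)" for \<xi>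
      using DERIV_diff[OF S.deriv_rcumul DERIV_cmult_right[OF DERIV_ident, of y]] unfolding mult_1_left .
    then have 1: "deriv (\<lambda>\<xi>. Re (Q.cumul (of_real \<xi>)) - \<xi> * y) = (\<lambda>\<xi>. Re (Q.cumul1 (of_real \<xi>)) - y)"
      by (intro ext DERIV_imp_deriv)
    have "((\<lambda>\<xi>. Re (Q.cumul1 (of_real \<xi>)) - y) has_real_derivative Q.mom 2 \<xi> - 0) (at \<xi>)" for \<xi>
      by (rule DERIV_diff[OF S.deriv_rcumul1 DERIV_const])
    then have 2: "deriv (\<lambda>\<xi>. Re (Q.cumul1 (of_real \<xi>)) - y) \<xi> = Q.mom 2 \<xi>" for \<xi>
      unfolding diff_zero by (rule DERIV_imp_deriv)
    show ?thesis unfolding Kfun_def Hfun_imaginary[OF mean0] Re_complex_of_real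
      by (simp only: numeral_2_eq_2 funpow.simps comp_apply id_apply 1 2)
  qed
  have ex: "2 * a + 1 = 2 * H" "- a - 1 = - H - 1/2" by (simp_all add: a_def)
  show "((\<lambda>(t, x). p t x /
               (1 / sqrt (2 * pi * t powr (2 * H) * Kfun \<mu> H (x * t powr (- H - 1/2)))
                * exp (t * Dfun \<mu> H (x * t powr (- H - 1/2)))))
             \<longlongrightarrow> 1)
             (inf (filtercomap (\<lambda>(t, x). t + x) at_top) (principal ({t0..} \<times> {0..})))"
    using S.pdf_asymptotics[OF crit a_bounds(1)] unfolding ex D K p_def .
qed

end

theorem theorem1:
  fixes M :: "'w measure" and Z ZH :: "real \<Rightarrow> 'w \<Rightarrow> real"
    and \<mu> :: "real measure" and H t0 :: real
  assumes "prob_space M"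
    and "1/2 < H" and "H < 1" and "0 < t0"
    and "levy_measure \<mu>" and "levy_process M Z \<mu>"
    and "\<And>t. t0 \<le> t \<Longrightarrow> stoch_integral M Z (frac_kernel H t) (ZH t)"
    and "emeasure \<mu> {0<..} > 0"
    and "\<And>C::real. (\<integral>\<^sup>+y\<in>{y. 1 \<le> \<bar>y\<bar>}. ennreal (exp (C * y)) \<partial>\<mu>) < \<infinity>"
    and "\<exists>\<gamma>. 0 < \<gamma> \<and> \<gamma> < 1 \<and>
           ((\<lambda>\<xi>. exp_moment \<mu> 4 \<xi> / (exp_moment \<mu> 2 (\<gamma> * \<xi>))\<^sup>2) \<longlongrightarrow> 0) at_top"
    and "((\<lambda>\<xi>. (ln (max (exp_moment \<mu> 4 \<xi> / exp_moment \<mu> 2 \<xi>) 1)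
                  + ln (ln (exp_moment \<mu> 2 \<xi>))) / \<xi>) \<longlongrightarrow> 0) at_top"
  shows "\<exists>p :: real \<Rightarrow> real \<Rightarrow> real.
           (\<forall>t\<ge>t0. (\<forall>x. 0 \<le> p t x) \<and>
                   distributed M lborel (ZH t) (\<lambda>x. ennreal (p t x)) \<and>
                   p t \<in> Cb_infinity) \<and>
           ((\<lambda>(t, x). p t x /
               (1 / sqrt (2 * pi * t powr (2 * H) * Kfun \<mu> H (x * t powr (- H - 1/2)))
                * exp (t * Dfun \<mu> H (x * t powr (- H - 1/2)))))
             \<longlongrightarrow> 1)
             (inf (filtercomap (\<lambda>(t, x). t + x) at_top) (principal ({t0..} \<times> {0..})))"
proof -
  interpret levy_exp \<mu>
    using assms(5,8,9) by unfold_locales (simp_all only: levy_measure_def)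
  interpret frac_levy \<mu> H
    by unfold_locales (rule assms(2,3))+
  interpret frac_levy_asym \<mu> H
    by unfold_locales (rule assms(10,11)[unfolded exp_moment_eq])+
  note density = density_asymptotics[OF assms(1,6,4,7)]
  show ?thesis
    by (rule exI[of _ "\<lambda>t. exp_decaying.pdf (\<lambda>z. exp (of_real t * Q.cumul (\<i> * of_real (z * t powr a))))"],
        intro conjI allI impI) (rule density; assumption)+
qed

end
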